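(* For each positive integer $n$ let $X_n$ be the random variable `size' on the set of $(2n+1,2n+3)$-core partitions with distinct parts, equipped with the uniform distribution. Then the scaled sixth moment of $X_n$ satisfies $$ \lim_{n\to\infty}\frac{\mathbb{E}\big[(X_n-\mathbb{E}[X_n])^6\big]}{\mathrm{Var}(X_n)^{3}}=\frac{382564191044644975}{1552893421695616}. $$
   Context: A partition is a non-increasing finite sequence $\lambda=(\lambda_1,\dots,\lambda_k)$, $k\ge 0$, of positive integers (the empty partition is allowed); its size is $\lambda_1+\dots+\lambda_k$, and it has distinct parts if the $\lambda_i$ are pairwise distinct. The hook length of a cell $(i,j)$, $1\le j\le\lambda_i$, of its Ferrers (Young) diagram is $\lambda_i-i+\lambda'_j-j+1$, where $\lambda'$ is the conjugate partition. A partition is an $(s,t)$-core partition if none of its hook lengths equals $s$ and none equals $t$. For $s=2n+1$, $t=2n+3$ (relatively prime) the set of $(s,t)$-core partitions is finite. *)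

theory Defs
  imports "HOL-Probability.Probability"
begin

definition is_partition :: "nat list \<Rightarrow> bool" where
  "is_partition xs \<longleftrightarrow> sorted_wrt (\<ge>) xs \<and> (\<forall>p\<in>set xs. 0 < p)"

text \<open>Rows and columns of the diagram are indexed from 1, hence the shift by one
  with respect to list positions.\<close>

definition part :: "nat list \<Rightarrow> nat \<Rightarrow> nat" where
  "part xs i = xs ! (i - 1)"

definition cells :: "nat list \<Rightarrow> (nat \<times> nat) set" where
  "cells xs = {(i, j). 1 \<le> i \<and> i \<le> length xs \<and> 1 \<le> j \<and> j \<le> part xs i}"

definition conj_part :: "nat list \<Rightarrow> nat \<Rightarrow> nat" where
  "conj_part xs j = card {i. (i, j) \<in> cells xs}"

definition hook_length :: "nat list \<Rightarrow> nat \<times> nat \<Rightarrow> int" where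
  "hook_length xs = (\<lambda>(i, j). int (part xs i) - int i + int (conj_part xs j) - int j + 1)"

definition is_core :: "nat \<Rightarrow> nat \<Rightarrow> nat list \<Rightarrow> bool" where
  "is_core s t xs \<longleftrightarrow> is_partition xs \<and>
     (\<forall>c\<in>cells xs. hook_length xs c \<noteq> int s \<and> hook_length xs c \<noteq> int t)"

definition distinct_cores :: "nat \<Rightarrow> nat \<Rightarrow> nat list set" where
  "distinct_cores s t = {xs. is_core s t xs \<and> distinct xs}"

text \<open>The library's \<^const>\<open>pmf_of_set\<close> is the uniform distribution only on finite nonempty
  sets; \<^term>\<open>distinct_cores s t\<close> is such a set for coprime \<open>s\<close> and \<open>t\<close>.\<close>

definition core_pmf :: "nat \<Rightarrow> nat list pmf" where
  "core_pmf n = pmf_of_set (distinct_cores (2 * n + 1) (2 * n + 3))"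

definition partition_size :: "nat list \<Rightarrow> real" where
  "partition_size xs = real (sum_list xs)"

end

theory Submission
  imports Defs "HOL-Real_Asymp.Real_Asymp"
begin

text \<open>
A partition is determined by its set of first-column hook lengths. It is an \<open>s\<close>-core
exactly when this set is closed under subtracting \<open>s\<close>, and it has distinct parts
exactly when the set contains no two consecutive numbers. For \<open>s = 2n + 1\<close> and
\<open>t = 2n + 3\<close> the set is given by the number of its elements in each residue class
modulo \<open>s\<close>. Of the two classes \<open>2j - 1\<close> and \<open>2j\<close> at most
one is occupied, so the core is encoded by \<open>n\<close> integers
\<open>x\<^sub>1, ..., x\<^sub>n\<close>: the number \<open>x\<^sub>j\<close> is the count in
class \<open>2j\<close> if it is positive, and minus the count in class \<open>2j - 1\<close> if
it is negative. Closure under subtracting \<open>t\<close> says that the positive and the negative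
part of the sequence grow by at most one per step. Because \<open>2n + 2\<close> is congruent to
\<open>1\<close> modulo \<open>s\<close>, the walk is closed: the count in the last even class
bounds the count in the first odd class (\<open>cores_walks\<close>). With \<open>A\<close> the
sum of \<open>\<bar>x\<^sub>j\<bar>\<close> and \<open>B\<close> the sum of the squares, the size
of the core is \<open>n B - A\<^sup>2 / 2\<close> up to lower order terms.

It remains to find the joint moments of \<open>A\<close> and \<open>B\<close> asymptotically. Give
a step of height \<open>h\<close> the weight \<open>exp (\<alpha> h + \<beta> h\<^sup>2)\<close>.
The generating function of the walks then satisfies algebraic equations that relate it to the
generating function for the walks raised by one level (\<open>Run_0\<close>, \<open>Cut_0\<close>,
\<open>Closed_eq\<close>), and raising a walk of length \<open>L\<close> only replaces
\<open>A\<close> by \<open>A + L\<close> and \<open>B\<close> by \<open>B + 2 A + L\<close>.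
Extracting the coefficient of \<open>\<alpha>\<^sup>i \<beta>\<^sup>j\<close> gives one series in
\<open>z\<close> for each pair \<open>(i, j)\<close>. Each of them is, up to powers of
\<open>z\<close>, a Laurent polynomial in \<open>y = sqrt (1 - 4 z)\<close>, and only the
coefficient of its leading term at \<open>y = 0\<close> matters as \<open>n\<close> tends to
infinity. These leading coefficients obey a recursion with rational entries
(\<open>lead_exc_gf\<close>, \<open>lead_cut_gf\<close>, \<open>lead_Closed\<close>), the scaling
limit of the algebraic equations. By singularity analysis the \<open>k\<close>-th moment of the
size, divided by \<open>n\<^bsup>3k\<^esup>\<close>, tends to a rational number
\<open>limit_moment k\<close>. Its values for \<open>k \<le> 6\<close> yield the limit of the
scaled central moment.

This agrees with the probabilistic picture in which the scaled walk tends to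
\<open>sqrt 2 W\<close> with \<open>W t = b t - b 1 / 2\<close> for a Brownian motion
\<open>b\<close>, and the size divided by \<open>n\<^sup>3\<close> tends to twice the integral of
\<open>W\<^sup>2\<close> minus the square of the integral of \<open>\<bar>W\<bar>\<close>. Its
mean is \<open>5 / 16\<close> and its variance \<open>467 / 7680\<close>.
\<close>

unbundle fps_syntax
unbundle no vec_syntax

section \<open>Generating functions of height walks\<close>

text \<open>Weighted walks of length \<open>L\<close> through positive heights, starting after
height \<open>k\<close> and rising by at most one per step. For \<open>k = 0\<close> they are Dyck
paths read at their up steps: between two up steps the path may fall arbitrarily far, and weights
are attached to the heights reached.\<close>

fun run_coeff :: "(nat \<Rightarrow> 'r::comm_ring_1) \<Rightarrow> nat \<Rightarrow> nat \<Rightarrow> 'r" where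
  "run_coeff w k 0 = 1"
| "run_coeff w k (Suc L) = (\<Sum>h=1..Suc k. w h * run_coeff w h L)"

definition Run :: "(nat \<Rightarrow> 'r::comm_ring_1) \<Rightarrow> nat \<Rightarrow> 'r fps" where
  "Run w k = Abs_fps (run_coeff w k)"

text \<open>The one-step operator of such walks. All generating functions below are fixed points
of \<open>climb\<close> plus an inhomogeneous term. As \<open>climb\<close> shifts the degree in
\<open>z\<close>, such a fixed point is unique, and identities between generating functions are
proved by checking that both sides solve the same system.\<close>

definition climb :: "(nat \<Rightarrow> 'r::comm_ring_1) \<Rightarrow> (nat \<Rightarrow> 'r fps) \<Rightarrow> nat \<Rightarrow> 'r fps" where
  "climb w F k = fps_X * (\<Sum>h=1..Suc k. fps_const (w h) * F h)"

lemma climb_nth_0 [simp]: "climb w F k $ 0 = 0"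
  by (simp add: climb_def)

lemma climb_nth_Suc [simp]: "climb w F k $ Suc L = (\<Sum>h=1..Suc k. w h * F h $ L)"
  by (simp add: climb_def fps_sum_nth)

lemma climb_diff: "climb w (\<lambda>h. F h - G h) k = climb w F k - climb w G k"
  by (simp add: climb_def algebra_simps sum_subtractf)

lemma climb_add: "climb w (\<lambda>h. F h + G h) k = climb w F k + climb w G k"
  by (simp add: climb_def algebra_simps sum.distrib)

lemma climb_mult: "climb w (\<lambda>h. c * F h) k = c * climb w F k"
  by (simp add: climb_def sum_distrib_left mult_ac del: sum.cl_ivl_Suc)

text \<open>Splitting off the visit to height \<open>1\<close> turns the rest of the system into
the same system with shifted weights; this is what replaces the first-passage decomposition of
lattice paths.\<close>

lemma climb_shift:
  "climb w F (Suc k) = climb w F 0 + climb (w \<circ> Suc) (F \<circ> Suc) k"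
proof -
  have "(\<Sum>h=1..Suc (Suc k). fps_const (w h) * F h) =
      fps_const (w 1) * F 1 + (\<Sum>h=Suc 1..Suc (Suc k). fps_const (w h) * F h)"
    by (simp add: sum.atLeast_Suc_atMost)
  also have "(\<Sum>h=Suc 1..Suc (Suc k). fps_const (w h) * F h) =
      (\<Sum>h=1..Suc k. fps_const (w (Suc h)) * F (Suc h))"
    by (rule sum.shift_bounds_cl_Suc_ivl)
  finally show ?thesis by (simp add: climb_def algebra_simps)
qed

lemma climb_unique:
  assumes "\<And>k. F k = A k + climb w F k" and "\<And>k. G k = A k + climb w G k"
  shows "F k = G k"
proof -
  have "F k $ L = G k $ L" for L
  proof (induction L arbitrary: k)
    case 0
    show ?case by (subst assms(1), subst assms(2)) simp
  next
    case (Suc L)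
    show ?case by (subst assms(1), subst assms(2)) (simp add: Suc del: sum.cl_ivl_Suc)
  qed
  then show ?thesis by (simp add: fps_eq_iff)
qed

lemma Run_eq: "Run w k = 1 + climb w (Run w) k"
proof (rule fps_ext)
  fix n show "Run w k $ n = (1 + climb w (Run w) k) $ n"
    by (cases n) (simp_all add: Run_def del: sum.cl_ivl_Suc)
qed

lemma climb_const_eq:
  assumes "\<And>k. F k = c + climb w F k"
  shows "F k = c * Run w k"
proof (rule climb_unique[where A = "\<lambda>_. c"])
  show "F k = c + climb w F k" for k by (rule assms)
  show "c * Run w k = c + climb w (\<lambda>k. c * Run w k) k" for k
    unfolding climb_mult by (subst Run_eq) (simp add: algebra_simps)
qed

text \<open>A walk that starts one level higher first runs above level \<open>1\<close>, where it
sees the shifted weights, and then continues as a walk from the ground.\<close>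

lemma Run_Suc: "Run w (Suc k) = Run w 0 * Run (w \<circ> Suc) k"
proof -
  have "Run w (Suc k) = Run w 0 + climb (w \<circ> Suc) (Run w \<circ> Suc) k" for k
    by (subst Run_eq[of w "Suc k"], subst climb_shift, subst Run_eq[of w 0]) (simp add: algebra_simps)
  then show ?thesis
    using climb_const_eq[of "Run w \<circ> Suc" "Run w 0" "w \<circ> Suc" k] by simp
qed

lemma climb_0: "climb w F 0 = fps_X * fps_const (w 1) * F 1"
  by (simp add: climb_def mult.assoc)

text \<open>The weighted form of the Catalan equation \<open>C = 1 + z C\<^sup>2\<close>.\<close>

lemma Run_0: "Run w 0 = 1 + fps_X * fps_const (w 1) * Run w 0 * Run (w \<circ> Suc) 0"
  by (subst Run_eq, subst climb_0) (simp add: Run_Suc mult_ac)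

text \<open>Pairs of walks: the first starts after height \<open>k\<close> and stops at some
height \<open>e\<close>, the second starts after height \<open>e + 1\<close> and is unrestricted.
They are the excursions that a closed walk interrupts at its end and resumes, with opposite sign,
at its beginning; the extra unit comes from the closing condition.\<close>

fun cut_coeff :: "(nat \<Rightarrow> 'r::comm_ring_1) \<Rightarrow> nat \<Rightarrow> nat \<Rightarrow> 'r" where
  "cut_coeff w k 0 = Run w (Suc k) $ 0"
| "cut_coeff w k (Suc L) = Run w (Suc k) $ Suc L + (\<Sum>h=1..Suc k. w h * cut_coeff w h L)"

definition Cut :: "(nat \<Rightarrow> 'r::comm_ring_1) \<Rightarrow> nat \<Rightarrow> 'r fps" where
  "Cut w k = Abs_fps (cut_coeff w k)"

lemma Cut_eq: "Cut w k = Run w (Suc k) + climb w (Cut w) k"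
proof (rule fps_ext)
  fix n show "Cut w k $ n = (Run w (Suc k) + climb w (Cut w) k) $ n"
    by (cases n) (simp_all add: Cut_def del: sum.cl_ivl_Suc)
qed

lemma Cut_Suc: "Cut w (Suc k) = Run w 0 * Cut (w \<circ> Suc) k + climb w (Cut w) 0 * Run (w \<circ> Suc) k"
proof -
  let ?w = "w \<circ> Suc" and ?B = "climb w (Cut w) 0"
  let ?A = "\<lambda>k. Run w 0 * Run ?w (Suc k) + ?B"
  have "Cut w (Suc k) = ?A k + climb ?w (\<lambda>k. Cut w (Suc k)) k" for k
    by (subst Cut_eq, subst climb_shift) (simp add: Run_Suc[of w "Suc k"] o_def algebra_simps)
  moreover have "Run w 0 * Cut ?w k + ?B * Run ?w k =
      ?A k + climb ?w (\<lambda>k. Run w 0 * Cut ?w k + ?B * Run ?w k) k" for k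
    unfolding climb_add climb_mult
    by (subst Cut_eq, subst Run_eq[of ?w k]) (simp add: algebra_simps)
  ultimately show ?thesis by (rule climb_unique)
qed

text \<open>Combining the recursion for \<open>Cut w 1\<close> with \<open>Run_0\<close> removes
the inverse of \<open>1 - w 1 z C'\<close>, which equals \<open>C\<close>.\<close>

lemma Cut_0:
  "Cut w 0 = Run w 0 * Run (w \<circ> Suc) 0 + fps_X * fps_const (w 1) * (Run w 0)\<^sup>2 * Cut (w \<circ> Suc) 0"
proof -
  let ?C = "Run w 0" and ?C' = "Run (w \<circ> Suc) 0" and ?z = "fps_X * fps_const (w 1)"
  have C: "?C = 1 + ?z * ?C * ?C'" by (rule Run_0)
  \<comment> \<open>At \<open>k = 0\<close> the series \<open>Cut w 1\<close> occurs on both sides.\<close>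
  have K: "Cut w 1 = ?C * Cut (w \<circ> Suc) 0 + ?z * Cut w 1 * ?C'"
    using Cut_Suc[of w 0] by (simp add: climb_0)
  have "Cut w 1 = Cut w 1 * (?C - ?z * ?C * ?C')"
    by (subst (1) C) (simp only: add_diff_cancel_right' mult_1_right)
  also have "\<dots> = ?C * (Cut w 1 - ?z * Cut w 1 * ?C')" by (simp add: algebra_simps)
  also have "\<dots> = ?C\<^sup>2 * Cut (w \<circ> Suc) 0" by (subst (1) K) (simp add: power2_eq_square)
  finally have "Cut w 1 = ?C\<^sup>2 * Cut (w \<circ> Suc) 0" .
  then show ?thesis
    by (subst Cut_eq) (simp add: Run_Suc climb_0 mult_ac)
qed

text \<open>Positive and negative entries stand for occupied even and odd residue classes. An odd
class cannot follow an occupied even one, as the two residues would be consecutive; hence the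
asymmetry between the signs.\<close>

definition succs :: "int \<Rightarrow> int set" where
  "succs x = {y. y \<le> max x 0 + 1 \<and> - y \<le> max (- x) 0 + 1 \<and> (0 < x \<longrightarrow> 0 \<le> y)}"

text \<open>Walks from \<open>x\<close> whose final height, counted as zero on the negative side,
is \<open>e\<close>.\<close>

fun walk_coeff :: "(nat \<Rightarrow> 'r::comm_ring_1) \<Rightarrow> nat \<Rightarrow> int \<Rightarrow> nat \<Rightarrow> 'r" where
  "walk_coeff w e x 0 = (if max x 0 = int e then 1 else 0)"
| "walk_coeff w e x (Suc L) = (\<Sum>y\<in>succs x. w (nat \<bar>y\<bar>) * walk_coeff w e y L)"

text \<open>Starting from \<open>- (e + 1)\<close> expresses that the first negative height is at
most \<open>e + 2\<close>, where \<open>e\<close> is the final positive height. The final height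
of a walk of length \<open>n\<close> that starts at a negative value is at most \<open>n\<close>,
so the sum is complete.\<close>

definition Closed :: "(nat \<Rightarrow> 'r::comm_ring_1) \<Rightarrow> 'r fps" where
  "Closed w = Abs_fps (\<lambda>n. \<Sum>e\<le>n. walk_coeff w e (- int (Suc e)) n)"

lemma finite_succs [simp]: "finite (succs x)"
  by (rule finite_subset[of _ "{- (max (- x) 0 + 1)..max x 0 + 1}"]) (auto simp: succs_def)

lemma succs_nonpos:
  "succs (- int k) = (\<lambda>h. - int h) ` {1..Suc k} \<union> {0, 1}"
proof -
  have "y \<in> (\<lambda>h. - int h) ` {1..Suc k} \<union> {0, 1}" if "y \<in> succs (- int k)" for y
  proof (cases "y < 0")
    case True
    then have "y = - int (nat (- y))" "nat (- y) \<in> {1..Suc k}" using that by (auto simp: succs_def)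
    then show ?thesis by blast
  next
    case False
    then show ?thesis using that by (auto simp: succs_def)
  qed
  then show ?thesis by (auto simp: succs_def)
qed

lemma succs_pos: "succs (int (Suc k)) = int ` {1..Suc (Suc k)} \<union> {0}"
proof -
  have "y \<in> int ` {1..Suc (Suc k)} \<union> {0}" if "y \<in> succs (int (Suc k))" for y
  proof (cases "y = 0")
    case False
    then have "y = int (nat y)" "nat y \<in> {1..Suc (Suc k)}" using that by (auto simp: succs_def)
    then show ?thesis by blast
  qed auto
  then show ?thesis by (auto simp: succs_def)
qed

lemma sum_succs_nonpos:
  "(\<Sum>y\<in>succs (- int k). f y) = (\<Sum>h=1..Suc k. f (- int h)) + f 0 + (f 1 :: 'r::comm_ring_1)"
proof -
  have "(\<Sum>y\<in>succs (- int k). f y) = (\<Sum>y\<in>(\<lambda>h. - int h) ` {1..Suc k}. f y) + (\<Sum>y\<in>{0,1}. f y)"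
    unfolding succs_nonpos by (rule sum.union_disjoint) auto
  also have "(\<Sum>y\<in>(\<lambda>h. - int h) ` {1..Suc k}. f y) = (\<Sum>h=1..Suc k. f (- int h))"
    by (subst sum.reindex) (auto simp: inj_on_def)
  finally show ?thesis by (simp add: add.assoc)
qed

lemma sum_succs_pos:
  "(\<Sum>y\<in>succs (int (Suc k)). f y) = (\<Sum>h=1..Suc (Suc k). f (int h)) + (f 0 :: 'r::comm_ring_1)"
proof -
  have "(\<Sum>y\<in>succs (int (Suc k)). f y) = (\<Sum>y\<in>int ` {1..Suc (Suc k)}. f y) + (\<Sum>y\<in>{0}. f y)"
    unfolding succs_pos by (rule sum.union_disjoint) auto
  also have "(\<Sum>y\<in>int ` {1..Suc (Suc k)}. f y) = (\<Sum>h=1..Suc (Suc k). f (int h))"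
    by (subst sum.reindex) (auto simp: inj_on_def)
  finally show ?thesis by simp
qed

fun tail_coeff :: "(nat \<Rightarrow> 'r::comm_ring_1) \<Rightarrow> nat \<Rightarrow> nat \<Rightarrow> nat \<Rightarrow> 'r" where
  "tail_coeff w e k 0 = (if k = e then 1 else 0)"
| "tail_coeff w e k (Suc L) = (\<Sum>h=1..Suc k. w h * tail_coeff w e h L)"

definition Ending :: "(nat \<Rightarrow> 'r::comm_ring_1) \<Rightarrow> nat \<Rightarrow> nat \<Rightarrow> 'r fps" where
  "Ending w e k = Abs_fps (tail_coeff w e k)"

lemma Ending_eq: "Ending w e k = (if k = e then 1 else 0) + climb w (Ending w e) k"
proof (rule fps_ext)
  fix n show "Ending w e k $ n = ((if k = e then 1 else 0) + climb w (Ending w e) k) $ n"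
    by (cases n) (simp_all add: Ending_def del: sum.cl_ivl_Suc)
qed

text \<open>The walks from the nonpositive side solve a \<open>climb\<close> system with a
constant inhomogeneity \<open>Y\<close>, and so do the walks from the positive side up to the runs
that end at height \<open>e\<close> before reaching zero. Comparing the two expressions for
\<open>Y\<close> yields the factor \<open>1 - z C\<^sup>2\<close>, where
\<open>z C\<^sup>2\<close> stands for a visit to zero with an optional positive run before it and
an optional negative run after it.\<close>

lemma walk_from_nonpos:
  fixes w :: "nat \<Rightarrow> 'r::comm_ring_1"
  assumes w0: "w 0 = 1"
  defines "C \<equiv> Run w 0"
  shows "Abs_fps (walk_coeff w e (- int k)) * (1 - fps_X * C\<^sup>2) = Ending w e 0 * Run w k"
proof -
  define W where "W x = Abs_fps (walk_coeff w e x)" for x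
  define Y where "Y = (if e = 0 then 1 else 0) + fps_X * W 0 + fps_X * fps_const (w 1) * W 1"
  have neg: "W (- int k) = Y + climb w (\<lambda>k. W (- int k)) k" for k
  proof (rule fps_ext)
    fix n
    show "W (- int k) $ n = (Y + climb w (\<lambda>k. W (- int k)) k) $ n"
    proof (cases n)
      case 0 then show ?thesis by (auto simp: W_def Y_def)
    next
      case (Suc L)
      have "W (- int k) $ n = (\<Sum>y\<in>succs (- int k). w (nat \<bar>y\<bar>) * W y $ L)"
        by (simp add: W_def Suc)
      also have "\<dots> = (\<Sum>h=1..Suc k. w h * W (- int h) $ L) + W 0 $ L + w 1 * W 1 $ L"
        unfolding sum_succs_nonpos by (simp add: w0)
      finally show ?thesis
        by (simp add: Suc Y_def mult.assoc del: sum.cl_ivl_Suc)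
    qed
  qed
  have W_neg: "W (- int k) = Y * Run w k" for k
    by (rule climb_const_eq[where F = "\<lambda>k. W (- int k)"]) (rule neg)
  define F where "F k = (if k = 0 then Y else W (int k))" for k
  have pos: "F k = ((if k = e then 1 else 0) + fps_X * W 0) + climb w F k" for k
  proof (cases k)
    case 0
    then show ?thesis by (auto simp: F_def Y_def climb_0 add_ac)
  next
    case k: (Suc k')
    show ?thesis
    proof (rule fps_ext)
      fix n
      show "F k $ n = ((if k = e then 1 else 0) + fps_X * W 0 + climb w F k) $ n"
      proof (cases n)
        case 0 then show ?thesis by (auto simp: W_def F_def k)
      next
        case (Suc L)
        have "F k $ n = (\<Sum>y\<in>succs (int k). w (nat \<bar>y\<bar>) * W y $ L)"
          by (simp add: F_def W_def Suc k)
        also have "\<dots> = (\<Sum>h=1..Suc k. w h * W (int h) $ L) + W 0 $ L"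
          unfolding k sum_succs_pos by (simp add: w0)
        also have "(\<Sum>h=1..Suc k. w h * W (int h) $ L) = (\<Sum>h=1..Suc k. w h * F h $ L)"
          by (intro sum.cong) (auto simp: F_def)
        finally show ?thesis
          by (simp add: Suc del: sum.cl_ivl_Suc)
      qed
    qed
  qed
  \<comment> \<open>Removing the runs that end at height \<open>e\<close> makes the inhomogeneity on the positive side constant as well.\<close>
  have "F k - Ending w e k = (fps_X * W 0) * Run w k" for k
  proof (rule climb_const_eq[where F = "\<lambda>k. F k - Ending w e k"])
    fix k
    show "F k - Ending w e k = fps_X * W 0 + climb w (\<lambda>k. F k - Ending w e k) k"
      unfolding climb_diff by (subst pos, subst Ending_eq) simp
  qed
  from this[of 0] have "Y = fps_X * W 0 * C + Ending w e 0" by (simp add: F_def C_def algebra_simps)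
  moreover have "W 0 = Y * C" using W_neg[of 0] by (simp add: C_def)
  ultimately have "Y = fps_X * (Y * C) * C + Ending w e 0" by simp
  then have "Y * (1 - fps_X * C\<^sup>2) = Ending w e 0" by (simp add: algebra_simps power2_eq_square)
  then have "Y * Run w k * (1 - fps_X * C\<^sup>2) = Ending w e 0 * Run w k"
    by (metis mult.assoc mult.commute)
  then show ?thesis using W_neg[of k] by (simp add: W_def)
qed

lemma walk_coeff_eq_0: "max x 0 + int L < int e \<Longrightarrow> walk_coeff w e x L = 0"
proof (induction L arbitrary: x)
  case (Suc L)
  have "walk_coeff w e y L = 0" if "y \<in> succs x" for y
    using that Suc.prems by (intro Suc.IH) (auto simp: succs_def)
  then show ?case by simp
qed auto

text \<open>Summing over the height at which the first walk of a cut excursion stops gives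
\<open>Cut\<close>. The sum is infinite, but heights above \<open>k + L\<close> do not contribute
to the coefficient of degree \<open>L\<close>.\<close>

lemma sum_Ending_Run:
  assumes "k + L \<le> N"
  shows "(\<Sum>e\<le>N. Ending w e k * Run w (Suc e)) $ L = Cut w k $ L"
proof -
  define G where "G k = (\<Sum>e\<le>N. Ending w e k * Run w (Suc e))" for k
  have G: "G k = (if k \<le> N then Run w (Suc k) else 0) + climb w G k" for k
  proof -
    have "G k = (\<Sum>e\<le>N. (if k = e then 1 else 0) * Run w (Suc e))
        + (\<Sum>e\<le>N. climb w (Ending w e) k * Run w (Suc e))"
      unfolding G_def by (subst Ending_eq) (simp add: algebra_simps sum.distrib)
    also have "(\<Sum>e\<le>N. (if k = e then 1 else 0) * Run w (Suc e)) = (if k \<le> N then Run w (Suc k) else 0)"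
      by (simp add: if_distrib[of "\<lambda>x. x * _"] cong: if_cong)
    also have "(\<Sum>e\<le>N. climb w (Ending w e) k * Run w (Suc e)) = climb w G k"
      unfolding climb_def G_def sum_distrib_left sum_distrib_right
      by (subst sum.swap) (simp add: mult_ac)
    finally show ?thesis .
  qed
  have "G k $ L = Cut w k $ L" using assms
  proof (induction L arbitrary: k)
    case 0
    then show ?case by (subst G, subst Cut_eq) simp
  next
    case (Suc L)
    have "(\<Sum>h=1..Suc k. w h * G h $ L) = (\<Sum>h=1..Suc k. w h * Cut w h $ L)"
      using Suc by (intro sum.cong) auto
    then show ?case using Suc.prems by (subst G, subst Cut_eq) (simp del: sum.cl_ivl_Suc)
  qed
  then show ?thesis by (simp add: G_def)
qed

lemma Closed_eq:
  assumes "w 0 = 1"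
  shows "Closed w * (1 - fps_X * (Run w 0)\<^sup>2) = Cut w 0"
proof (rule fps_ext)
  fix n
  define D where "D = 1 - fps_X * (Run w 0)\<^sup>2"
  define TN where "TN = (\<Sum>e\<le>n. Abs_fps (walk_coeff w e (- int (Suc e))))"
  have "Closed w $ i = TN $ i" if "i \<le> n" for i
  proof -
    have "Closed w $ i = (\<Sum>e\<le>i. walk_coeff w e (- int (Suc e)) i)" by (simp add: Closed_def)
    also have "\<dots> = (\<Sum>e\<le>n. walk_coeff w e (- int (Suc e)) i)"
      using that by (intro sum.mono_neutral_left) (auto intro: walk_coeff_eq_0)
    finally show ?thesis by (simp add: TN_def fps_sum_nth)
  qed
  then have "(Closed w * D) $ n = (TN * D) $ n"
    unfolding fps_mult_nth by (intro sum.cong) auto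
  also have "TN * D = (\<Sum>e\<le>n. Ending w e 0 * Run w (Suc e))"
    unfolding TN_def D_def sum_distrib_right walk_from_nonpos[of w, OF assms] ..
  also have "\<dots> $ n = Cut w 0 $ n" by (rule sum_Ending_Run) simp
  finally show "(Closed w * (1 - fps_X * (Run w 0)\<^sup>2)) $ n = Cut w 0 $ n" by (simp add: D_def)
qed

section \<open>Recording the sum and the sum of squares of the heights\<close>

text \<open>The formal exponential \<open>exp (\<alpha> A + \<beta> B)\<close>, with
\<open>\<beta>\<close> as the outer and \<open>\<alpha>\<close> as the inner variable. Its
coefficients are the divided powers of \<open>A\<close> and \<open>B\<close>, so that sums of
exponentials over walks record the joint moments.\<close>

definition wexp :: "real \<Rightarrow> real \<Rightarrow> real fps fps" where
  "wexp A B = Abs_fps (\<lambda>j. fps_const (B ^ j / fact j) * fps_exp A)"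

lemma wexp_nth: "wexp A B $ j $ i = A ^ i / fact i * (B ^ j / fact j)"
  by (simp add: wexp_def mult_ac)

lemma wexp_mult: "wexp A B * wexp A' B' = wexp (A + A') (B + B')"
proof (rule fps_ext)
  fix j
  define c where "c b = B ^ b / fact b * (B' ^ (j - b) / fact (j - b))" for b
  have c: "(\<Sum>b=0..j. c b) = (B + B') ^ j / fact j"
    using fps_exp_add_mult[of B B'] by (simp add: fps_eq_iff fps_mult_nth c_def)
  have const: "fps_const x * f * (fps_const y * g) = fps_const (x * y) * (f * g)"
    for x y :: real and f g
    by (simp only: fps_const_mult[symmetric] mult_ac)
  have "(wexp A B * wexp A' B') $ j = (\<Sum>b=0..j. fps_const (c b) * fps_exp (A + A'))"
    by (simp add: fps_mult_nth wexp_def const fps_exp_add_mult c_def del: fps_const_mult)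
  also have "\<dots> = fps_const (\<Sum>b=0..j. c b) * fps_exp (A + A')"
    by (simp add: fps_eq_iff fps_sum_nth sum_distrib_right sum_divide_distrib)
  finally show "(wexp A B * wexp A' B') $ j = wexp (A + A') (B + B') $ j"
    by (simp add: wexp_def c)
qed

lemma wexp_0 [simp]: "wexp 0 0 = 1"
  by (simp add: fps_eq_iff wexp_nth power_0_left)

definition weight :: "nat \<Rightarrow> real fps fps" where
  "weight h = wexp (real h) (real (h\<^sup>2))"

lemma weight_0: "weight 0 = 1"
  by (simp add: weight_def)

text \<open>The substitution \<open>\<alpha> := \<alpha> + 2 \<beta>\<close>, which is how
\<open>exp (\<alpha> h + \<beta> h\<^sup>2)\<close> reacts, apart from the factor
\<open>exp (\<alpha> + \<beta>)\<close>, to raising \<open>h\<close> by one.\<close>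

definition shear :: "real fps fps \<Rightarrow> real fps fps" where
  "shear g = Abs_fps (\<lambda>j. Abs_fps (\<lambda>i. \<Sum>c\<le>j. real ((i + c) choose c) * 2 ^ c * g $ (j - c) $ (i + c)))"

lemma shear_0 [simp]: "shear 0 = 0"
  by (simp add: shear_def fps_eq_iff)

lemma shear_add: "shear (g + h) = shear g + shear h"
  by (simp add: shear_def fps_eq_iff algebra_simps sum.distrib)

lemma shear_wexp: "shear (wexp A B) = wexp A (B + 2 * A)"
proof (rule fps_ext, rule fps_ext)
  fix j i
  have *: "real ((i + c) choose c) = fact (i + c) / (fact c * fact i)" for c
    using binomial_fact[of c "i + c", where 'a = real] by simp
  have "shear (wexp A B) $ j $ i =
      (\<Sum>c\<le>j. A ^ i / fact i * ((2 * A) ^ c / fact c * (B ^ (j - c) / fact (j - c))))"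
    unfolding shear_def
    by (simp add: wexp_nth * power_add power_mult_distrib mult_ac)
  also have "\<dots> = A ^ i / fact i * (\<Sum>c=0..j. (2 * A) ^ c / fact c * (B ^ (j - c) / fact (j - c)))"
    by (simp add: sum_distrib_left atMost_atLeast0)
  also have "(\<Sum>c=0..j. (2 * A) ^ c / fact c * (B ^ (j - c) / fact (j - c))) = (2 * A + B) ^ j / fact j"
    using fps_exp_add_mult[of "2 * A" B] by (simp add: fps_eq_iff fps_mult_nth)
  finally show "shear (wexp A B) $ j $ i = wexp A (B + 2 * A) $ j $ i"
    by (simp add: wexp_nth add.commute)
qed

text \<open>Multiplicativity of \<open>shear\<close> is only needed on finite sums of
exponentials, where it follows from the law for exponents; all coefficients of the walk series are
of this kind.\<close>

inductive_set esums :: "real fps fps set" where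
  zero: "0 \<in> esums"
| step: "g \<in> esums \<Longrightarrow> wexp A B + g \<in> esums"

lemma wexp_in_esums: "wexp A B \<in> esums"
  using esums.step[OF esums.zero] by simp

lemma esums_add: "g \<in> esums \<Longrightarrow> h \<in> esums \<Longrightarrow> g + h \<in> esums"
  by (induction rule: esums.induct) (auto simp: add.assoc intro: esums.step)

lemma esums_sum: "(\<And>x. x \<in> X \<Longrightarrow> f x \<in> esums) \<Longrightarrow> sum f X \<in> esums"
  by (induction X rule: infinite_finite_induct) (auto intro: esums_add esums.zero)

lemma esums_wexp_mult:
  assumes "h \<in> esums"
  shows "wexp A B * h \<in> esums" "shear (wexp A B * h) = shear (wexp A B) * shear h"
  using assms
proof (induction h rule: esums.induct)
  case (step g A' B')
  show "wexp A B * (wexp A' B' + g) \<in> esums"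
    using esums.step[OF step(2)] by (simp add: distrib_left wexp_mult)
  have "B + B' + 2 * (A + A') = B + 2 * A + (B' + 2 * A')" by simp
  then show "shear (wexp A B * (wexp A' B' + g)) = shear (wexp A B) * shear (wexp A' B' + g)"
    by (simp only: distrib_left shear_add step wexp_mult shear_wexp)
qed (auto intro: esums.zero)

lemma esums_mult:
  assumes "g \<in> esums" and h: "h \<in> esums"
  shows "g * h \<in> esums" "shear (g * h) = shear g * shear h"
  using assms(1)
proof (induction g rule: esums.induct)
  case (step g A B)
  show "(wexp A B + g) * h \<in> esums"
    using step h by (simp add: distrib_right esums_add esums_wexp_mult(1))
  show "shear ((wexp A B + g) * h) = shear (wexp A B + g) * shear h"
    using step h by (simp add: distrib_right shear_add esums_wexp_mult)
qed (auto intro: esums.zero)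

lemma shear_sum: "shear (sum f X) = (\<Sum>x\<in>X. shear (f x))"
  by (induction X rule: infinite_finite_induct) (auto simp: shear_add)

text \<open>The effect of raising all \<open>L\<close> heights of a walk by one: \<open>A\<close>
becomes \<open>A + L\<close> and \<open>B\<close> becomes \<open>B + 2 A + L\<close>.\<close>

definition lift_coeff :: "nat \<Rightarrow> real fps fps \<Rightarrow> real fps fps" where
  "lift_coeff L g = wexp (real L) (real L) * shear g"

definition lift :: "real fps fps fps \<Rightarrow> real fps fps fps" where
  "lift F = Abs_fps (\<lambda>L. lift_coeff L (F $ L))"

lemma weight_Suc: "weight (Suc h) = wexp 1 1 * shear (weight h)"
  by (simp add: weight_def shear_wexp wexp_mult power2_eq_square algebra_simps)

lemma weight_in_esums: "weight h \<in> esums"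
  unfolding weight_def by (rule wexp_in_esums)

lemma lift_coeff_weight_mult:
  assumes "g \<in> esums"
  shows "lift_coeff (Suc L) (weight h * g) = weight (Suc h) * lift_coeff L g"
proof -
  have "wexp (real (Suc L)) (real (Suc L)) = wexp 1 1 * wexp (real L) (real L)"
    by (simp add: wexp_mult)
  then show ?thesis
    by (simp add: lift_coeff_def weight_Suc esums_mult weight_in_esums assms mult_ac)
qed

lemma lift_coeff_add: "lift_coeff L (g + h) = lift_coeff L g + lift_coeff L h"
  by (simp add: lift_coeff_def shear_add distrib_left)

lemma lift_coeff_sum: "lift_coeff L (sum f X) = (\<Sum>x\<in>X. lift_coeff L (f x))"
  by (simp add: lift_coeff_def shear_sum sum_distrib_left)

lemma run_coeff_esums: "run_coeff weight k L \<in> esums"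
  using wexp_in_esums[of 0 0]
  by (induction L arbitrary: k) (auto intro!: esums_sum esums_mult weight_in_esums simp del: sum.cl_ivl_Suc)

lemma run_coeff_shift: "run_coeff (weight \<circ> Suc) k L = lift_coeff L (run_coeff weight k L)"
proof (induction L arbitrary: k)
  case 0
  show ?case using shear_wexp[of 0 0] by (simp add: lift_coeff_def)
next
  case (Suc L)
  then show ?case
    by (simp add: lift_coeff_sum lift_coeff_weight_mult run_coeff_esums del: sum.cl_ivl_Suc)
qed

lemma Run_shift: "Run (weight \<circ> Suc) k = lift (Run weight k)"
  by (simp add: fps_eq_iff Run_def lift_def run_coeff_shift)

lemma cut_coeff_esums: "cut_coeff weight k L \<in> esums"
  by (induction L arbitrary: k)
    (auto intro!: esums_add esums_sum esums_mult weight_in_esums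
      simp: Run_def run_coeff_esums simp del: sum.cl_ivl_Suc run_coeff.simps)

lemma Run_shift_nth: "Run (weight \<circ> Suc) k $ L = lift_coeff L (Run weight k $ L)"
  by (simp add: Run_shift lift_def)

lemma cut_coeff_shift: "cut_coeff (weight \<circ> Suc) k L = lift_coeff L (cut_coeff weight k L)"
  by (induction L arbitrary: k)
    (simp_all add: Run_shift_nth lift_coeff_add lift_coeff_sum lift_coeff_weight_mult cut_coeff_esums
      del: sum.cl_ivl_Suc)

lemma Cut_shift: "Cut (weight \<circ> Suc) k = lift (Cut weight k)"
  by (simp add: fps_eq_iff Cut_def lift_def cut_coeff_shift)

lemma lift_X_mult: "lift (fps_X * F) = fps_X * fps_const (weight 1) * lift F"
proof (rule fps_ext)
  fix n
  have "lift_coeff (Suc L) g = weight 1 * lift_coeff L g" for L g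
    by (simp add: lift_coeff_def weight_def wexp_mult flip: mult.assoc)
  moreover have "lift_coeff 0 0 = 0" by (simp add: lift_coeff_def)
  ultimately show "lift (fps_X * F) $ n = (fps_X * fps_const (weight 1) * lift F) $ n"
    by (cases n) (simp_all add: lift_def mult.assoc)
qed

text \<open>The additional factor \<open>z\<close> makes the unweighted series,
\<open>(1 - y) / 2\<close>, a polynomial in \<open>y = sqrt (1 - 4 z)\<close>, and it absorbs the
weight of the up step that precedes a raised excursion.\<close>

definition exc_gf :: "real fps fps fps" where "exc_gf = fps_X * Run weight 0"
definition cut_gf :: "real fps fps fps" where "cut_gf = fps_X * Cut weight 0"

lemma exc_gf_eq: "exc_gf = fps_X + lift exc_gf * exc_gf"
  unfolding exc_gf_def lift_X_mult
  by (subst Run_0) (simp add: algebra_simps Run_shift)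

lemma cut_gf_eq: "fps_X * cut_gf = fps_X * (lift (Run weight 0) * exc_gf) + exc_gf\<^sup>2 * lift cut_gf"
  unfolding exc_gf_def cut_gf_def lift_X_mult
  by (subst Cut_0) (simp add: algebra_simps Run_shift Cut_shift power2_eq_square)

lemma Closed_exc_gf: "Closed weight * (fps_X - exc_gf\<^sup>2) = cut_gf"
  using arg_cong[OF Closed_eq[of weight, OF weight_0], of "\<lambda>F. fps_X * F"]
  by (simp add: exc_gf_def cut_gf_def algebra_simps power2_eq_square)

text \<open>The series in \<open>z\<close> whose coefficients are the moments of order
\<open>(i, j)\<close>, divided by \<open>i! j!\<close>. The division turns products of weighted
series into plain convolutions.\<close>

definition mom :: "nat \<Rightarrow> nat \<Rightarrow> real fps fps fps \<Rightarrow> real fps" where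
  "mom i j F = Abs_fps (\<lambda>L. F $ L $ j $ i)"

lemma mom_add: "mom i j (F + G) = mom i j F + mom i j G"
  by (simp add: mom_def fps_eq_iff)

lemma mom_X_mult: "mom i j (fps_X * F) = fps_X * mom i j F"
  by (simp add: mom_def fps_eq_iff)

lemma mom_X: "mom i j fps_X = (if i = 0 \<and> j = 0 then fps_X else 0)"
  by (auto simp: mom_def fps_eq_iff fps_X_def)

lemma mom_mult: "mom i j (F * G) = (\<Sum>a\<le>i. \<Sum>b\<le>j. mom a b F * mom (i - a) (j - b) G)"
proof (rule fps_ext)
  fix L
  have "mom i j (F * G) $ L = (\<Sum>l=0..L. \<Sum>b=0..j. \<Sum>a=0..i. F $ l $ b $ a * G $ (L - l) $ (j - b) $ (i - a))"
    by (simp add: mom_def fps_mult_nth fps_sum_nth)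
  also have "\<dots> = (\<Sum>l=0..L. \<Sum>a=0..i. \<Sum>b=0..j. F $ l $ b $ a * G $ (L - l) $ (j - b) $ (i - a))"
    by (intro sum.cong refl sum.swap)
  also have "\<dots> = (\<Sum>a=0..i. \<Sum>l=0..L. \<Sum>b=0..j. F $ l $ b $ a * G $ (L - l) $ (j - b) $ (i - a))"
    by (rule sum.swap)
  also have "\<dots> = (\<Sum>a=0..i. \<Sum>b=0..j. \<Sum>l=0..L. F $ l $ b $ a * G $ (L - l) $ (j - b) $ (i - a))"
    by (intro sum.cong refl sum.swap)
  also have "\<dots> = (\<Sum>a\<le>i. \<Sum>b\<le>j. mom a b F * mom (i - a) (j - b) G) $ L"
    by (simp add: mom_def fps_mult_nth fps_sum_nth atMost_atLeast0)
  finally show "mom i j (F * G) $ L = (\<Sum>a\<le>i. \<Sum>b\<le>j. mom a b F * mom (i - a) (j - b) G) $ L" .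
qed

text \<open>The operator \<open>z d/dz\<close>, which multiplies the coefficient of degree
\<open>L\<close> by \<open>L\<close>.\<close>

definition theta :: "real fps \<Rightarrow> real fps" where
  "theta f = fps_X * fps_deriv f"

lemma theta_nth: "theta f $ n = real n * f $ n"
  by (cases n) (simp_all add: theta_def)

lemma theta_pow_nth: "(theta ^^ k) f $ n = real n ^ k * f $ n"
  by (induction k) (simp_all add: theta_nth)

text \<open>The expansion of \<open>(A + L)\<^sup>i (B + 2 A + L)\<^sup>j\<close> in divided
powers, with \<open>L\<close> expressed through \<open>theta\<close>.\<close>

lemma mom_lift:
  "mom i j (lift F) = (\<Sum>b\<le>j. \<Sum>a\<le>i. \<Sum>c\<le>j - b.
     fps_const (real ((i - a + c) choose c) * 2 ^ c / (fact a * fact b)) *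
     (theta ^^ (a + b)) (mom (i - a + c) (j - b - c) F))"
proof (rule fps_ext)
  fix L
  let ?c = "\<lambda>a b c. real ((i - a + c) choose c) * 2 ^ c / (fact a * fact b)"
  have "mom i j (lift F) $ L = (\<Sum>b\<le>j. \<Sum>a\<le>i. real L ^ a / fact a * (real L ^ b / fact b) *
      (\<Sum>c\<le>j - b. real ((i - a + c) choose c) * 2 ^ c * F $ L $ (j - b - c) $ (i - a + c)))"
    by (simp add: mom_def lift_def lift_coeff_def fps_mult_nth fps_sum_nth wexp_nth shear_def
        atMost_atLeast0)
  also have "\<dots> = (\<Sum>b\<le>j. \<Sum>a\<le>i. \<Sum>c\<le>j - b.
      ?c a b c * (real L ^ (a + b) * F $ L $ (j - b - c) $ (i - a + c)))"
    unfolding sum_distrib_left by (intro sum.cong refl) (simp add: power_add)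
  also have "\<dots> = (\<Sum>b\<le>j. \<Sum>a\<le>i. \<Sum>c\<le>j - b. fps_const (?c a b c) *
      (theta ^^ (a + b)) (mom (i - a + c) (j - b - c) F)) $ L"
    by (simp add: fps_sum_nth theta_pow_nth mom_def del: fps_const_mult)
  finally show "mom i j (lift F) $ L = \<dots>" .
qed

section \<open>Expansions at the singularity 1/4\<close>

text \<open>The power series of \<open>(1 - 4 z)\<^sup>r\<close>.\<close>

definition disc_pow :: "real \<Rightarrow> real fps" where
  "disc_pow r = Abs_fps (\<lambda>n. (- 4) ^ n * (r gchoose n))"

lemma disc_pow_compose: "disc_pow r = fps_binomial r oo (fps_const (- 4) * fps_X)"
  by (simp add: disc_pow_def fps_compose_linear)

lemma disc_pow_add: "disc_pow (r + s) = disc_pow r * disc_pow s"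
  unfolding disc_pow_compose by (simp add: fps_binomial_add_mult fps_compose_mult_distrib)

lemma disc_pow_0 [simp]: "disc_pow 0 = 1"
  by (simp add: disc_pow_compose)

lemma disc_pow_1: "disc_pow 1 = 1 - fps_const 4 * fps_X"
  by (simp add: disc_pow_compose fps_binomial_1 fps_compose_add_distrib flip: fps_const_neg)

lemma X_disc_pow: "fps_X = fps_const (1/4) * (1 - disc_pow 1)"
  by (simp add: disc_pow_1 flip: mult.assoc)

lemma theta_mult: "theta (f * g) = theta f * g + f * theta g"
  by (simp add: theta_def algebra_simps)

lemma theta_add: "theta (f + g) = theta f + theta g"
  by (simp add: theta_def algebra_simps)

lemma theta_diff: "theta (f - g) = theta f - theta g"
  by (simp add: theta_def algebra_simps)

lemma theta_const_mult: "theta (fps_const c * f) = fps_const c * theta f"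
  by (simp add: theta_def algebra_simps)

lemma theta_disc_pow: "theta (disc_pow r) = fps_const r * (disc_pow r - disc_pow (r - 1))"
proof -
  have "real n * (r gchoose n) = r * ((r gchoose n) - ((r - 1) gchoose n))" for n
  proof (cases n)
    case (Suc m)
    have "r gchoose Suc m = (r - 1 gchoose m) + (r - 1 gchoose Suc m)"
      using gbinomial_Suc_Suc[of "r - 1" m] by simp
    moreover have "real (Suc m) * (r gchoose Suc m) = r * (r - 1 gchoose m)"
      using gbinomial_absorption[of m r] by simp
    ultimately show ?thesis using Suc by simp
  qed simp
  then have "(- 4) ^ n * (real n * (r gchoose n)) = (- 4) ^ n * (r * ((r gchoose n) - ((r - 1) gchoose n)))" for n
    by simp
  then show ?thesis
    by (simp add: fps_eq_iff theta_nth disc_pow_def algebra_simps)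
qed

text \<open>Laurent polynomials in \<open>y = sqrt (1 - 4 z)\<close> whose pole at
\<open>y = 0\<close> has order at most \<open>m\<close>.\<close>

inductive_set order_le :: "int \<Rightarrow> real fps set" for m where
  zero: "0 \<in> order_le m"
| step: "f \<in> order_le m \<Longrightarrow> k \<le> m \<Longrightarrow> fps_const c * disc_pow (- (real_of_int k / 2)) + f \<in> order_le m"

lemma order_le_single: "k \<le> m \<Longrightarrow> fps_const c * disc_pow (- (real_of_int k / 2)) \<in> order_le m"
  using order_le.step[OF order_le.zero] by simp

lemma order_le_disc_pow: "- 2 * r = real_of_int k \<Longrightarrow> k \<le> m \<Longrightarrow> disc_pow r \<in> order_le m"
proof -
  assume "- 2 * r = real_of_int k" "k \<le> m"
  moreover from this have "r = - (real_of_int k / 2)" by simp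
  ultimately show ?thesis using order_le_single[of k m 1] by simp
qed

lemma order_le_mono: "f \<in> order_le m \<Longrightarrow> m \<le> m' \<Longrightarrow> f \<in> order_le m'"
  by (induction rule: order_le.induct) (auto intro: order_le.intros)

lemma order_le_add: "f \<in> order_le m \<Longrightarrow> g \<in> order_le m \<Longrightarrow> f + g \<in> order_le m"
  by (induction rule: order_le.induct) (auto simp: add.assoc intro: order_le.step)

lemma order_le_const_mult: "f \<in> order_le m \<Longrightarrow> fps_const c * f \<in> order_le m"
  by (induction rule: order_le.induct)
    (auto simp: distrib_left simp flip: mult.assoc intro: order_le.intros)

lemma order_le_diff: "f \<in> order_le m \<Longrightarrow> g \<in> order_le m \<Longrightarrow> f - g \<in> order_le m"
  using order_le_add[of f m "fps_const (- 1) * g"] order_le_const_mult[of g m "- 1"]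
  by (simp flip: fps_const_neg)

lemma order_le_disc_pow_mult:
  assumes "f \<in> order_le m" "- 2 * r = real_of_int k"
  shows "disc_pow r * f \<in> order_le (m + k)"
  using assms(1)
proof (induction rule: order_le.induct)
  case (step f l c)
  have *: "disc_pow r * (fps_const c * disc_pow (- (real_of_int l / 2))) = fps_const c * disc_pow (- (real_of_int (l + k) / 2))"
  proof -
    have "- (real_of_int (l + k) / 2) = r + - (real_of_int l / 2)"
      using assms(2) by (simp add: field_simps)
    then show ?thesis by (simp only: disc_pow_add mult_ac)
  qed
  show ?case unfolding distrib_left * using step by (intro order_le.step) auto
qed (auto intro: order_le.zero)

lemma order_le_mult:
  assumes "f \<in> order_le m" "g \<in> order_le m'"
  shows "f * g \<in> order_le (m + m')"
  using assms(1)
proof (induction rule: order_le.induct)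
  case (step f k c)
  have "disc_pow (- (real_of_int k / 2)) * g \<in> order_le (m' + k)"
    by (rule order_le_disc_pow_mult[OF assms(2)]) simp
  then have "fps_const c * (disc_pow (- (real_of_int k / 2)) * g) \<in> order_le (m + m')"
    using step(2) by (intro order_le_const_mult) (auto elim: order_le_mono)
  then show ?case using step(3) by (simp add: distrib_right mult.assoc order_le_add)
qed (auto intro: order_le.zero)

lemma order_le_theta: "f \<in> order_le m \<Longrightarrow> theta f \<in> order_le (m + 2)"
proof (induction rule: order_le.induct)
  case (step f k c)
  let ?r = "- (real_of_int k / 2)"
  have "disc_pow ?r \<in> order_le (m + 2)" "disc_pow (?r - 1) \<in> order_le (m + 2)"
    using step(2) by (auto intro: order_le_disc_pow[of _ k] order_le_disc_pow[of _ "k + 2"])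
  then have "fps_const c * (fps_const ?r * (disc_pow ?r - disc_pow (?r - 1))) \<in> order_le (m + 2)"
    by (intro order_le_const_mult order_le_diff)
  then show ?case using step(3) by (simp add: theta_add theta_const_mult theta_disc_pow order_le_add)
qed (auto simp: theta_def intro: order_le.zero)

lemma order_le_X_mult: "f \<in> order_le m \<Longrightarrow> fps_X * f \<in> order_le m"
proof -
  assume f: "f \<in> order_le m"
  have "disc_pow 1 * f \<in> order_le (m + - 2)" by (rule order_le_disc_pow_mult[OF f]) simp
  then have "disc_pow 1 * f \<in> order_le m" by (rule order_le_mono) simp
  then have "fps_const (1/4) * (f - disc_pow 1 * f) \<in> order_le m" using f by (intro order_le_const_mult order_le_diff)
  then show ?thesis by (subst X_disc_pow) (simp add: algebra_simps)
qed

text \<open>Up to terms of lower pole order, \<open>f\<close> is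
\<open>c y\<^bsup>-m\<^esup>\<close>. The factor \<open>z\<^sup>k\<close> permits division by
\<open>z\<close> and by \<open>1 \<plusminus> y\<close>, whose product is \<open>4 z\<close>;
since \<open>z\<close> equals \<open>1/4\<close> at \<open>y = 0\<close>, the coefficient is
divided by \<open>4\<^sup>k\<close>.\<close>

definition lead :: "int \<Rightarrow> real \<Rightarrow> real fps \<Rightarrow> bool" where
  "lead m c f \<longleftrightarrow> (\<exists>k. fps_X ^ k * f - fps_const (c / 4 ^ k) * disc_pow (- (real_of_int m / 2)) \<in> order_le (m - 1))"

text \<open>Multiplying by \<open>z = (1 - y\<^sup>2) / 4\<close> changes the leading term only by
the factor \<open>1/4\<close>, so the exponent of \<open>z\<close> in the definition of
\<open>lead\<close> may be increased. This allows two series to share one exponent.\<close>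

lemma lead_step:
  assumes "fps_X ^ k * f - fps_const (c / 4 ^ k) * disc_pow (- (real_of_int m / 2)) \<in> order_le (m - 1)"
  shows "fps_X ^ (k + d) * f - fps_const (c / 4 ^ (k + d)) * disc_pow (- (real_of_int m / 2)) \<in> order_le (m - 1)"
proof (induction d)
  case (Suc d)
  let ?y = "disc_pow (- (real_of_int m / 2))" and ?c = "c / 4 ^ (k + d)"
  have "fps_X * (fps_X ^ (k + d) * f - fps_const ?c * ?y) \<in> order_le (m - 1)"
    using Suc by (rule order_le_X_mult)
  moreover have "disc_pow 1 * ?y \<in> order_le (m - 1)"
    using order_le_disc_pow[of "1 - real_of_int m / 2" "m - 2" "m - 1"] by (simp flip: disc_pow_add)
  ultimately have "fps_X * (fps_X ^ (k + d) * f - fps_const ?c * ?y)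
      - fps_const (?c / 4) * (disc_pow 1 * ?y) \<in> order_le (m - 1)"
    by (intro order_le_diff order_le_const_mult)
  moreover have "fps_X * (fps_const ?c * ?y) = fps_const (?c / 4) * ?y - fps_const (?c / 4) * (disc_pow 1 * ?y)"
  proof -
    have "fps_X * (fps_const ?c * ?y) = (fps_const (1/4) * fps_const ?c) * ((1 - disc_pow 1) * ?y)"
      by (subst X_disc_pow) (simp only: mult_ac)
    then show ?thesis by (simp add: algebra_simps)
  qed
  ultimately show ?case by (simp add: algebra_simps)
qed (use assms in simp)

lemma lead_order_le: "f - fps_const c * disc_pow (- (real_of_int m / 2)) \<in> order_le (m - 1) \<Longrightarrow> lead m c f"
  unfolding lead_def by (intro exI[of _ 0]) simp

lemma lead_disc_pow: "- 2 * r = real_of_int m \<Longrightarrow> lead m c (fps_const c * disc_pow r)"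
proof (rule lead_order_le)
  assume "- 2 * r = real_of_int m"
  then have "r = - (real_of_int m / 2)" by simp
  then show "fps_const c * disc_pow r - fps_const c * disc_pow (- (real_of_int m / 2)) \<in> order_le (m - 1)"
    by (simp add: order_le.zero)
qed

lemma lead_common:
  assumes "lead m c f" "lead m' c' g"
  obtains k where "fps_X ^ k * f - fps_const (c / 4 ^ k) * disc_pow (- (real_of_int m / 2)) \<in> order_le (m - 1)"
    and "fps_X ^ k * g - fps_const (c' / 4 ^ k) * disc_pow (- (real_of_int m' / 2)) \<in> order_le (m' - 1)"
proof -
  obtain k1 k2 where
    k1: "fps_X ^ k1 * f - fps_const (c / 4 ^ k1) * disc_pow (- (real_of_int m / 2)) \<in> order_le (m - 1)" and
    k2: "fps_X ^ k2 * g - fps_const (c' / 4 ^ k2) * disc_pow (- (real_of_int m' / 2)) \<in> order_le (m' - 1)"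
    using assms unfolding lead_def by blast
  show thesis
    using that[of "k1 + k2"] lead_step[OF k1, of k2] lead_step[OF k2, of k1]
    by (simp add: add.commute)
qed

lemma lead_add: "lead m c f \<Longrightarrow> lead m c' g \<Longrightarrow> lead m (c + c') (f + g)"
proof -
  assume "lead m c f" "lead m c' g"
  then obtain k where
    "fps_X ^ k * f - fps_const (c / 4 ^ k) * disc_pow (- (real_of_int m / 2)) \<in> order_le (m - 1)"
    "fps_X ^ k * g - fps_const (c' / 4 ^ k) * disc_pow (- (real_of_int m / 2)) \<in> order_le (m - 1)"
    by (rule lead_common)
  from order_le_add[OF this] show ?thesis
    unfolding lead_def
    by (intro exI[of _ k])
      (simp add: algebra_simps add_divide_distrib flip: fps_const_add)
qed

lemma lead_0: "lead m 0 0"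
  by (rule lead_order_le) (simp add: order_le.zero)

lemma lead_sum: "(\<And>x. x \<in> X \<Longrightarrow> lead m (c x) (f x)) \<Longrightarrow> lead m (sum c X) (sum f X)"
  by (induction X rule: infinite_finite_induct) (auto intro: lead_add lead_0)

lemma lead_const_mult: "lead m c f \<Longrightarrow> lead m (d * c) (fps_const d * f)"
proof -
  assume "lead m c f"
  then obtain k where
    "fps_X ^ k * f - fps_const (c / 4 ^ k) * disc_pow (- (real_of_int m / 2)) \<in> order_le (m - 1)"
    unfolding lead_def by blast
  from order_le_const_mult[OF this, of d]
  have "fps_X ^ k * (fps_const d * f) - (fps_const d * fps_const (c / 4 ^ k)) * disc_pow (- (real_of_int m / 2)) \<in> order_le (m - 1)"
    by (simp only: right_diff_distrib mult_ac)
  then show ?thesis unfolding lead_def by (intro exI[of _ k]) simp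
qed

lemma lead_minus: "lead m c f \<Longrightarrow> lead m (- c) (- f)"
  using lead_const_mult[of m c f "- 1"] by (simp flip: fps_const_neg)

lemma lead_diff: "lead m c f \<Longrightarrow> lead m c' g \<Longrightarrow> lead m (c - c') (f - g)"
  using lead_add[of m c f "- c'" "- g"] lead_minus[of m c' g] by simp

lemma lead_mono: "lead m c f \<Longrightarrow> m < m' \<Longrightarrow> lead m' 0 f"
proof -
  assume "lead m c f" and m: "m < m'"
  then obtain k where
    k: "fps_X ^ k * f - fps_const (c / 4 ^ k) * disc_pow (- (real_of_int m / 2)) \<in> order_le (m - 1)"
    unfolding lead_def by blast
  have "fps_X ^ k * f - fps_const (c / 4 ^ k) * disc_pow (- (real_of_int m / 2)) +
      fps_const (c / 4 ^ k) * disc_pow (- (real_of_int m / 2)) \<in> order_le (m' - 1)"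
    using m by (intro order_le_add order_le_mono[OF k] order_le_single) auto
  then show ?thesis unfolding lead_def by (intro exI[of _ k]) simp
qed

lemma lead_mult: "lead m c f \<Longrightarrow> lead m' c' g \<Longrightarrow> lead (m + m') (c * c') (f * g)"
proof -
  assume "lead m c f" "lead m' c' g"
  then obtain k where
    f: "fps_X ^ k * f - fps_const (c / 4 ^ k) * disc_pow (- (real_of_int m / 2)) \<in> order_le (m - 1)" (is "?f - ?yf \<in> _") and
    g: "fps_X ^ k * g - fps_const (c' / 4 ^ k) * disc_pow (- (real_of_int m' / 2)) \<in> order_le (m' - 1)" (is "?g - ?yg \<in> _")
    by (rule lead_common)
  have yf: "?yf \<in> order_le m" and yg: "?yg \<in> order_le m'" by (rule order_le_single, simp)+
  have "?f \<in> order_le m" using order_le_add[OF order_le_mono[OF f, of m] yf] by simp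
  from order_le_mult[OF this g] order_le_mult[OF f yg]
  have "?f * (?g - ?yg) + (?f - ?yf) * ?yg \<in> order_le (m + m' - 1)"
    by (intro order_le_add) (simp_all add: algebra_simps)
  also have "?f * (?g - ?yg) + (?f - ?yf) * ?yg = ?f * ?g - ?yf * ?yg" by (simp add: algebra_simps)
  also have "?f * ?g = fps_X ^ (k + k) * (f * g)" by (simp add: power_add mult_ac)
  also have "?yf * ?yg = fps_const (c * c' / 4 ^ (k + k)) * disc_pow (- (real_of_int (m + m') / 2))"
  proof -
    have "- (real_of_int (m + m') / 2) = - (real_of_int m / 2) + - (real_of_int m' / 2)" by (simp add: field_simps)
    moreover have "c * c' / 4 ^ (k + k) = (c / 4 ^ k) * (c' / 4 ^ k)" by (simp add: power_add)
    ultimately show ?thesis by (simp only: disc_pow_add fps_const_mult[symmetric] mult_ac)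
  qed
  finally show ?thesis unfolding lead_def by blast
qed

lemma lead_disc_pow_div:
  assumes "lead m c (disc_pow r * f)" "2 * r = real_of_int k"
  shows "lead (m + k) c f"
proof -
  have "lead k 1 (disc_pow (- r))" using lead_disc_pow[of "- r" k 1] assms(2) by simp
  from lead_mult[OF this assms(1)] show ?thesis
    by (simp add: add.commute flip: mult.assoc disc_pow_add)
qed

lemma lead_X_div: "lead m c (fps_X * f) \<Longrightarrow> lead m (4 * c) f"
proof -
  assume "lead m c (fps_X * f)"
  then obtain k where
    "fps_X ^ k * (fps_X * f) - fps_const (c / 4 ^ k) * disc_pow (- (real_of_int m / 2)) \<in> order_le (m - 1)"
    unfolding lead_def by blast
  then show ?thesis
    unfolding lead_def by (intro exI[of _ "Suc k"]) (simp add: algebra_simps)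
qed

lemma lead_X: "lead 0 (1/4) fps_X"
proof (rule lead_order_le)
  have "fps_const (- (1/4)) * disc_pow 1 \<in> order_le (0 - 1)" by (intro order_le_const_mult order_le_disc_pow[of _ "- 2"]) auto
  then show "fps_X - fps_const (1 / 4) * disc_pow (- (real_of_int 0 / 2)) \<in> order_le (0 - 1)"
    by (subst X_disc_pow) (simp add: algebra_simps flip: fps_const_neg)
qed

text \<open>On \<open>y\<^bsup>-m\<^esup>\<close> the operator \<open>z d/dz\<close> acts as
\<open>(m / 2) (y\<^bsup>-m-2\<^esup> - y\<^bsup>-m\<^esup>)\<close>.\<close>

lemma lead_theta: "lead m c f \<Longrightarrow> lead (m + 2) (real_of_int m / 2 * c) (theta f)"
proof -
  assume "lead m c f"
  then obtain k where
    k: "fps_X ^ k * f - fps_const (c / 4 ^ k) * disc_pow (- (real_of_int m / 2)) \<in> order_le (m - 1)" (is "?f - ?y \<in> _")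
    unfolding lead_def by blast
  let ?r = "- (real_of_int m / 2)"
  have y: "?y \<in> order_le m" by (rule order_le_single) simp
  have f: "?f \<in> order_le m" using order_le_add[OF order_le_mono[OF k, of m] y] by simp
  have th: "theta (fps_X ^ k * f) = of_nat k * ?f + fps_X ^ k * theta f"
  proof -
    have "theta (fps_X ^ k) = of_nat k * fps_X ^ k" by (rule fps_ext) (simp add: theta_nth fps_X_power_nth fps_of_nat[symmetric] del: fps_of_nat)
    then show ?thesis by (simp add: theta_mult mult.assoc)
  qed
  have 1: "theta (?f - ?y) \<in> order_le (m + 2 - 1)" using order_le_theta[OF k] by (simp add: algebra_simps)
  have 2: "fps_const (real k) * ?f \<in> order_le (m + 2 - 1)" by (intro order_le_const_mult order_le_mono[OF f]) simp
  have 3: "fps_const (c / 4 ^ k * ?r) * disc_pow ?r \<in> order_le (m + 2 - 1)"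
    by (intro order_le_const_mult order_le_disc_pow[of _ m]) auto
  have "theta (?f - ?y) - fps_const (real k) * ?f + fps_const (c / 4 ^ k * ?r) * disc_pow ?r \<in> order_le (m + 2 - 1)"
    by (rule order_le_add[OF order_le_diff[OF 1 2] 3])
  also have "theta (?f - ?y) - fps_const (real k) * ?f + fps_const (c / 4 ^ k * ?r) * disc_pow ?r =
     fps_X ^ k * theta f + fps_const (c / 4 ^ k * ?r) * disc_pow (?r - 1)"
  proof -
    define u v where "u = fps_const (c / 4 ^ k)" and "v = fps_const ?r"
    have uv: "fps_const (c / 4 ^ k * ?r) = u * v" by (simp add: u_def v_def)
    have "theta (fps_const (c / 4 ^ k) * disc_pow ?r) = u * (v * (disc_pow ?r - disc_pow (?r - 1)))"
      by (simp only: theta_const_mult theta_disc_pow u_def v_def)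
    then show ?thesis
      unfolding theta_diff th uv by (simp add: fps_of_nat algebra_simps)
  qed
  also have "\<dots> = fps_X ^ k * theta f - fps_const (real_of_int m / 2 * c / 4 ^ k) * disc_pow (- (real_of_int (m + 2) / 2))"
  proof -
    have "?r - 1 = - (real_of_int (m + 2) / 2)" by (simp add: field_simps)
    moreover have "c / 4 ^ k * ?r = - (real_of_int m / 2 * c / 4 ^ k)" by (simp add: field_simps)
    ultimately show ?thesis
      by (simp only: fps_const_neg[symmetric] mult_minus_left diff_minus_eq_add minus_mult_left[symmetric]
          diff_conv_add_uminus)
  qed
  finally show ?thesis unfolding lead_def by blast
qed

lemma lead_theta_pow: "lead m c f \<Longrightarrow> \<exists>c'. lead (m + 2 * int k) c' ((theta ^^ k) f)"
proof (induction k)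
  case (Suc k)
  then obtain c' where "lead (m + 2 * int k) c' ((theta ^^ k) f)" by blast
  from lead_theta[OF this] show ?case by (auto simp: algebra_simps)
qed auto

lemma disc_pow_asymptotic:
  "(\<lambda>n. disc_pow (- r) $ n / 4 ^ n * real n powr (1 - r)) \<longlonglongrightarrow> rGamma r"
proof -
  have "(\<lambda>n. (- r gchoose n) / ((- 1) ^ n / exp ((- r + 1) * ln (real n)))) \<longlonglongrightarrow> inverse (Gamma r)"
    using gbinomial_asymptotic[of "- r"] by simp
  moreover have "eventually (\<lambda>n. (- r gchoose n) / ((- 1) ^ n / exp ((- r + 1) * ln (real n))) =
      disc_pow (- r) $ n / 4 ^ n * real n powr (1 - r)) sequentially"
    using eventually_gt_at_top[of 0]
  proof eventually_elim
    case (elim n)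
    have "(- 4 :: real) ^ n = (- 1) ^ n * 4 ^ n" by (simp flip: power_mult_distrib)
    moreover have "inverse ((- 1 :: real) ^ n) = (- 1) ^ n" by (simp flip: power_inverse)
    ultimately show ?case using elim
      by (simp add: disc_pow_def powr_def divide_inverse)
  qed
  ultimately have "(\<lambda>n. disc_pow (- r) $ n / 4 ^ n * real n powr (1 - r)) \<longlonglongrightarrow> inverse (Gamma r)"
    by (rule Lim_transform_eventually)
  then show ?thesis by (simp add: rGamma_inverse_Gamma)
qed

lemma order_le_asymptotic:
  assumes "f \<in> order_le (m - 1)"
  shows "(\<lambda>n. f $ n / 4 ^ n * real n powr (1 - real_of_int m / 2)) \<longlonglongrightarrow> 0"
  using assms
proof (induction rule: order_le.induct)
  case (step f k c)
  define r where "r = real_of_int k / 2"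
  have "(\<lambda>n. real n powr - (real_of_int m / 2 - r)) \<longlonglongrightarrow> 0"
    using step(2) unfolding r_def
    by (intro tendsto_neg_powr filterlim_real_sequentially) auto
  with disc_pow_asymptotic[of r]
  have "(\<lambda>n. disc_pow (- r) $ n / 4 ^ n * real n powr (1 - r) * real n powr - (real_of_int m / 2 - r)) \<longlonglongrightarrow> rGamma r * 0"
    by (rule tendsto_mult)
  then have "(\<lambda>n. c * (disc_pow (- r) $ n / 4 ^ n * real n powr (1 - real_of_int m / 2))) \<longlonglongrightarrow> c * 0"
    by (intro tendsto_mult tendsto_const) (simp add: mult.assoc flip: powr_add)
  from tendsto_add[OF this step(3)] show ?case
    by (simp add: r_def add_divide_distrib algebra_simps)
qed simp

text \<open>Singularity analysis for this class of series: it reduces to the asymptotics of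
generalised binomial coefficients, as the lower order terms are finitely many.\<close>

lemma lead_asymptotic:
  assumes "lead m c f"
  shows "(\<lambda>n. f $ n / 4 ^ n * real n powr (1 - real_of_int m / 2)) \<longlonglongrightarrow> c * rGamma (real_of_int m / 2)"
proof -
  define s where "s = 1 - real_of_int m / 2"
  obtain k where k: "fps_X ^ k * f - fps_const (c / 4 ^ k) * disc_pow (- (real_of_int m / 2)) \<in> order_le (m - 1)" (is "?f - _ \<in> _")
    using assms unfolding lead_def by blast
  have "(\<lambda>n. c / 4 ^ k * (disc_pow (- (real_of_int m / 2)) $ n / 4 ^ n * real n powr s)) \<longlonglongrightarrow> c / 4 ^ k * rGamma (real_of_int m / 2)"
    unfolding s_def by (intro tendsto_mult tendsto_const disc_pow_asymptotic)
  from tendsto_add[OF order_le_asymptotic[OF k] this]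
  have "(\<lambda>n. ?f $ n / 4 ^ n * real n powr s) \<longlonglongrightarrow> c / 4 ^ k * rGamma (real_of_int m / 2)"
    by (simp add: s_def algebra_simps diff_divide_distrib)
  then have "(\<lambda>n. ?f $ (n + k) / 4 ^ (n + k) * real (n + k) powr s) \<longlonglongrightarrow> c / 4 ^ k * rGamma (real_of_int m / 2)"
    by (rule LIMSEQ_ignore_initial_segment)
  from tendsto_mult_left[OF this, of "4 ^ k"]
  have lim: "(\<lambda>n. f $ n / 4 ^ n * real (n + k) powr s) \<longlonglongrightarrow> c * rGamma (real_of_int m / 2)"
    by (simp add: fps_X_power_mult_nth power_add)
  have "(\<lambda>n. (real n / real (n + k)) powr s) \<longlonglongrightarrow> 1 powr s"
    by (intro tendsto_powr tendsto_const) (real_asymp, simp)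
  from tendsto_mult[OF lim this]
  have "(\<lambda>n. f $ n / 4 ^ n * real (n + k) powr s * (real n / real (n + k)) powr s) \<longlonglongrightarrow> c * rGamma (real_of_int m / 2)"
    by simp
  moreover have "eventually (\<lambda>n. f $ n / 4 ^ n * real (n + k) powr s * (real n / real (n + k)) powr s =
     f $ n / 4 ^ n * real n powr s) sequentially"
    using eventually_gt_at_top[of 0]
    by eventually_elim (simp add: powr_divide)
  ultimately show ?thesis unfolding s_def by (rule Lim_transform_eventually)
qed

section \<open>Leading coefficients for excursions\<close>

abbreviation grid :: "nat \<Rightarrow> nat \<Rightarrow> (nat \<times> nat) set" where
  "grid i j \<equiv> {..i} \<times> {..j}"

lemma mom_mult_grid:
  "mom i j (F * G) = (\<Sum>x\<in>grid i j. mom (fst x) (snd x) F * mom (i - fst x) (j - snd x) G)"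
  by (simp add: mom_mult sum.cartesian_product case_prod_unfold)

text \<open>In the scaling regime \<open>z\<close> counts with pole order \<open>2\<close>,
heights scale like the square root of the length, and therefore \<open>A\<close> and
\<open>B\<close> contribute \<open>3\<close> and \<open>4\<close> to the pole order.\<close>

definition hom_lead :: "int \<Rightarrow> (nat \<Rightarrow> nat \<Rightarrow> real) \<Rightarrow> real fps fps fps \<Rightarrow> nat \<Rightarrow> nat \<Rightarrow> bool" where
  "hom_lead \<kappa> c F i j \<longleftrightarrow> lead (3 * int i + 4 * int j + \<kappa>) (c i j) (mom i j F)"

text \<open>The leading contribution of raising: either one factor \<open>A\<close> turns into a
length, or one factor \<open>B\<close> turns into \<open>2 A\<close>. Both lower the pole order by
exactly one.\<close>

definition lift_lead :: "int \<Rightarrow> (nat \<Rightarrow> nat \<Rightarrow> real) \<Rightarrow> nat \<Rightarrow> nat \<Rightarrow> real" where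
  "lift_lead \<kappa> c i j =
     (if 0 < i then (3 * (real i - 1) + 4 * real j + real_of_int \<kappa>) / 2 * c (i - 1) j else 0) +
     (if 0 < j then 2 * (real i + 1) * c (i + 1) (j - 1) else 0)"

text \<open>In \<open>mom_lift\<close> the index \<open>(b, a, c)\<close> lowers the pole order by
\<open>a + 2 b + c\<close>. The index zero is the moment itself, two indices lower the order by
one and form \<open>lift_lead\<close>, and all others are negligible. The moment of order zero is
excluded from the first hypothesis because for excursions its expansion starts with a constant;
only its derivative has the homogeneous form.\<close>

lemma lead_mom_lift_diff:
  assumes lead: "\<And>i' j'. i' + 2 * j' < i + 2 * j \<Longrightarrow> (i', j') \<noteq> (0, 0) \<Longrightarrow> hom_lead \<kappa> c F i' j'"
    and zero: "lead (\<kappa> + 2) (real_of_int \<kappa> / 2 * c 0 0) (theta (mom 0 0 F))"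
  shows "lead (3 * int i + 4 * int j + \<kappa> - 1) (lift_lead \<kappa> c i j) (mom i j (lift F) - mom i j F)"
proof -
  define m where "m = 3 * int i + 4 * int j + \<kappa> - 1"
  define S where "S = (SIGMA b:{..j}. SIGMA a:{..i}. {..j - b})"
  define h where "h = (\<lambda>(b, a, c'). fps_const (real ((i - a + c') choose c') * 2 ^ c' / (fact a * fact b)) *
     (theta ^^ (a + b)) (mom (i - a + c') (j - b - c') F))"
  define u where "u = (3 * (real i - 1) + 4 * real j + real_of_int \<kappa>) / 2 * c (i - 1) j"
  define v where "v = 2 * (real i + 1) * c (i + 1) (j - 1)"
  define g where "g x = (if x = (0, 1, 0) then u else 0) + (if x = (0, 0, 1) then v else 0)" for x :: "nat \<times> nat \<times> nat"
  have fin: "finite S" by (auto simp: S_def)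
  have "mom i j (lift F) = (\<Sum>x\<in>S. h x)"
    unfolding mom_lift S_def h_def
    by (simp add: sum.Sigma case_prod_unfold, intro sum.cong refl) auto
  also have "\<dots> = h (0, 0, 0) + (\<Sum>x\<in>S - {(0, 0, 0)}. h x)"
    using fin by (rule sum.remove) (auto simp: S_def)
  also have "h (0, 0, 0) = mom i j F" by (simp add: h_def)
  finally have diff: "mom i j (lift F) - mom i j F = (\<Sum>x\<in>S - {(0, 0, 0)}. h x)" by simp
  have theta_pow: "\<exists>c'. lead (3 * int i' + 4 * int j' + \<kappa> + 2 * int k) c' ((theta ^^ k) (mom i' j' F))"
    if "i' + 2 * j' < i + 2 * j" "(i', j') \<noteq> (0, 0) \<or> 0 < k" for i' j' k
  proof (cases "(i', j') = (0, 0)")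
    case True
    with that(2) obtain k' where k: "k = Suc k'" by (cases k) auto
    have "(theta ^^ k) f = (theta ^^ k') (theta f)" for f by (simp add: k funpow_swap1)
    with True lead_theta_pow[OF zero, of k'] show ?thesis by (simp add: k algebra_simps)
  next
    case False
    with lead[of i' j'] that(1) lead_theta_pow show ?thesis by (simp add: hom_lead_def)
  qed
  have "lead m (g x) (h x)" if "x \<in> S - {(0, 0, 0)}" for x
  proof -
    obtain b a c' where x: "x = (b, a, c')" by (metis surj_pair)
    from that x have le: "b \<le> j" "a \<le> i" "c' \<le> j - b" and nz: "a + b + c' > 0" by (auto simp: S_def)
    have less: "(i - a + c') + 2 * (j - b - c') < i + 2 * j" using le nz by linarith
    consider "x = (0, 1, 0)" | "x = (0, 0, 1)" | "a + 2 * b + c' \<ge> 2" using nz x by fastforce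
    then show ?thesis
    proof cases
      case 1
      then have i: "0 < i" using le x by simp
      have "lead (3 * int (i - 1) + 4 * int j + \<kappa> + 2) u (theta (mom (i - 1) j F))"
      proof (cases "(i - 1, j) = (0, 0)")
        case True
        then have "i = 1" "j = 0" using i by auto
        with zero show ?thesis by (simp add: u_def)
      next
        case False
        from lead_theta[OF lead[unfolded hom_lead_def, of "i - 1" j]] False i
        show ?thesis by (simp add: u_def of_nat_diff)
      qed
      moreover have "3 * int (i - 1) + 4 * int j + \<kappa> + 2 = m" using i by (simp add: m_def of_nat_diff)
      ultimately show ?thesis using 1 by (simp add: g_def h_def)
    next
      case 2
      then have j: "0 < j" using le x by simp
      then have "lead (3 * int (i + 1) + 4 * int (j - 1) + \<kappa>) (c (i + 1) (j - 1)) (mom (i + 1) (j - 1) F)"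
        using lead[of "i + 1" "j - 1"] by (simp add: hom_lead_def)
      from lead_const_mult[OF this, of "2 * (real i + 1)"]
      have "lead (3 * int (i + 1) + 4 * int (j - 1) + \<kappa>) v (fps_const (2 * (real i + 1)) * mom (i + 1) (j - 1) F)"
        by (simp add: v_def)
      moreover have "3 * int (i + 1) + 4 * int (j - 1) + \<kappa> = m" using j by (simp add: m_def of_nat_diff)
      ultimately show ?thesis using 2 by (simp add: g_def h_def algebra_simps)
    next
      case 3
      have "(i - a + c', j - b - c') \<noteq> (0, 0) \<or> 0 < a + b" using nz by auto
      from theta_pow[OF less this] obtain d where
        d: "lead (3 * int (i - a + c') + 4 * int (j - b - c') + \<kappa> + 2 * int (a + b)) d
          ((theta ^^ (a + b)) (mom (i - a + c') (j - b - c') F))" by blast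
      have "3 * int (i - a + c') + 4 * int (j - b - c') + \<kappa> + 2 * int (a + b) < m"
        using le 3 by (simp add: m_def of_nat_diff)
      from lead_mono[OF lead_const_mult[OF d] this] have "lead m 0 (h x)" by (simp add: x h_def)
      moreover have "g x = 0" using 3 by (auto simp: g_def x)
      ultimately show ?thesis by simp
    qed
  qed
  then have "lead m (sum g (S - {(0, 0, 0)})) (mom i j (lift F) - mom i j F)"
    unfolding diff by (rule lead_sum)
  moreover have "sum g (S - {(0, 0, 0)}) = lift_lead \<kappa> c i j"
    using fin unfolding g_def sum.distrib
    by (simp add: S_def lift_lead_def u_def v_def Suc_le_eq)
  ultimately show ?thesis by (simp add: m_def)
qed

lemma lead_mom_lift:
  assumes lead: "\<And>i' j'. i' + 2 * j' \<le> i + 2 * j \<Longrightarrow> (i', j') \<noteq> (0, 0) \<Longrightarrow> hom_lead \<kappa> c F i' j'"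
    and zero: "lead (\<kappa> + 2) (real_of_int \<kappa> / 2 * c 0 0) (theta (mom 0 0 F))"
    and ij: "(i, j) \<noteq> (0, 0)"
  shows "hom_lead \<kappa> c (lift F) i j"
proof -
  have "lead (3 * int i + 4 * int j + \<kappa> - 1) (lift_lead \<kappa> c i j) (mom i j (lift F) - mom i j F)"
    using lead by (intro lead_mom_lift_diff zero) auto
  from lead_add[OF lead_mono[OF this] lead[of i j, unfolded hom_lead_def]] ij
  show ?thesis by (simp add: hom_lead_def)
qed

lemma theta_const [simp]: "theta (fps_const c) = 0"
  by (simp add: theta_def)

lemma mom_0_0_lift: "mom 0 0 (lift F) = mom 0 0 F"
  by (simp add: mom_lift)

lemma mom_0_0_mult: "mom 0 0 (F * G) = mom 0 0 F * mom 0 0 G"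
  by (simp add: mom_mult)

definition exc0 :: "real fps" where "exc0 = mom 0 0 exc_gf"

lemma exc0_eq: "exc0 = fps_X + exc0 * exc0"
  using arg_cong[OF exc_gf_eq, of "mom 0 0"]
  by (simp add: exc0_def mom_add mom_X mom_0_0_mult mom_0_0_lift)

text \<open>The quadratic equation has two solutions in power series; the constant coefficient
selects the sign.\<close>

lemma exc0_disc_pow: "exc0 = fps_const (1/2) * (1 - disc_pow (1/2))"
proof -
  let ?g = "1 - fps_const 2 * exc0"
  have two: "fps_const 2 = (2 :: real fps)" and four: "fps_const 4 = (4 :: real fps)"
    by (simp_all add: numeral_fps_const)
  have "?g\<^sup>2 = 1 - fps_const 4 * (exc0 - exc0 * exc0)"
    by (simp add: two four power2_eq_square algebra_simps)
  also have "exc0 - exc0 * exc0 = fps_X" using exc0_eq by (simp add: algebra_simps)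
  also have "1 - fps_const 4 * fps_X = (disc_pow (1/2))\<^sup>2"
    by (simp add: disc_pow_1[symmetric] power2_eq_square flip: disc_pow_add)
  finally have "?g = disc_pow (1/2) \<or> ?g = - disc_pow (1/2)" by (simp add: power2_eq_iff)
  moreover have "?g \<noteq> - disc_pow (1/2)"
  proof
    assume "?g = - disc_pow (1/2)"
    then have "?g $ 0 = (- disc_pow (1/2)) $ 0" by (rule arg_cong)
    then show False by (simp add: exc0_def exc_gf_def mom_X_mult disc_pow_def)
  qed
  ultimately have "?g = disc_pow (1/2)" by blast
  then have "fps_const 2 * exc0 = 1 - disc_pow (1/2)" by (simp add: algebra_simps)
  then have "fps_const (1/2) * (fps_const 2 * exc0) = fps_const (1/2) * (1 - disc_pow (1/2))" by simp
  then show ?thesis by (simp flip: mult.assoc)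
qed

lemma disc_pow_half: "1 - exc0 - exc0 = disc_pow (1/2)"
proof -
  have "exc0 + exc0 = (fps_const (1/2) + fps_const (1/2)) * (1 - disc_pow (1/2))"
    by (subst (1 2) exc0_disc_pow) (simp only: distrib_right)
  then show ?thesis by (simp add: algebra_simps)
qed

lemma lead_exc0: "lead 0 (1/2) exc0"
proof (rule lead_order_le)
  have "fps_const (- (1/2)) * disc_pow (1/2) \<in> order_le (0 - 1)" by (intro order_le_const_mult order_le_disc_pow[of _ "- 1"]) auto
  then show "exc0 - fps_const (1/2) * disc_pow (- (real_of_int 0 / 2)) \<in> order_le (0 - 1)"
    by (subst exc0_disc_pow) (simp add: algebra_simps flip: fps_const_neg)
qed

lemma lead_theta_exc0: "lead 1 (1/4) (theta exc0)"
proof -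
  have "theta exc0 = fps_const (1/4) * (disc_pow (-(1/2)) - disc_pow (1/2))"
    by (subst exc0_disc_pow) (simp add: theta_const_mult theta_diff theta_disc_pow algebra_simps
        flip: fps_const_neg mult.assoc)
  also have "lead 1 (1/4) \<dots>"
  proof (rule lead_order_le)
    have "fps_const (- (1/4)) * disc_pow (1/2) \<in> order_le (1 - 1)" by (intro order_le_const_mult order_le_disc_pow[of _ "- 1"]) auto
    then show "fps_const (1/4) * (disc_pow (-(1/2)) - disc_pow (1/2)) - fps_const (1/4) * disc_pow (- (real_of_int 1 / 2)) \<in> order_le (1 - 1)"
      by (simp add: algebra_simps flip: fps_const_neg)
  qed
  finally show ?thesis .
qed

text \<open>The leading coefficients of the moments of excursions. At \<open>(0, 0)\<close> the
series is \<open>1/2 - y / 2\<close>, and it is the coefficient of \<open>y\<close>, not the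
constant, that fits the homogeneous pattern. The recursion says that
\<open>\<phi> = \<Sum> exc_lead i j \<alpha>\<^sup>i \<beta>\<^sup>j\<close> satisfies the Riccati
equation of a Schroedinger operator with a quadratic potential, whose energy parameter has been
eliminated by homogeneity.\<close>

function exc_lead :: "nat \<Rightarrow> nat \<Rightarrow> real" where
  "exc_lead i j = (if i = 0 \<and> j = 0 then - 1 / 2 else
     (if 0 < i then (3 * real i + 4 * real j - 4) / 4 * exc_lead (i - 1) j else 0) +
     (if 0 < j then (real i + 1) * exc_lead (i + 1) (j - 1) else 0) +
     (\<Sum>x\<in>grid i j - {(0, 0), (i, j)}. exc_lead (fst x) (snd x) * exc_lead (i - fst x) (j - snd x)))"
  by pat_completeness auto
termination by (relation "Wellfounded.measure (\<lambda>(i, j). i + 2 * j)") auto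

declare exc_lead.simps [simp del]

lemma exc_lead_0_0: "exc_lead 0 0 = - 1 / 2"
  by (simp add: exc_lead.simps)

lemma exc_lead_rec:
  assumes "(i, j) \<noteq> (0, 0)"
  shows "exc_lead i j = lift_lead (- 1) exc_lead i j / 2 +
    (\<Sum>x\<in>grid i j - {(0, 0), (i, j)}. exc_lead (fst x) (snd x) * exc_lead (i - fst x) (j - snd x))"
  using assms by (subst exc_lead.simps) (auto simp: lift_lead_def field_simps)

lemma grid_remove2:
  fixes g :: "nat \<times> nat \<Rightarrow> 'a::comm_monoid_add"
  assumes "(i, j) \<noteq> (0, 0)"
  shows "(\<Sum>x\<in>grid i j. g x) = g (0, 0) + (g (i, j) + (\<Sum>x\<in>grid i j - {(0, 0), (i, j)}. g x))"
proof -
  have "(\<Sum>x\<in>grid i j. g x) = g (0, 0) + (\<Sum>x\<in>grid i j - {(0, 0)}. g x)"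
    by (rule sum.remove) auto
  also have "(\<Sum>x\<in>grid i j - {(0, 0)}. g x) = g (i, j) + (\<Sum>x\<in>grid i j - {(0, 0)} - {(i, j)}. g x)"
    using assms by (intro sum.remove) auto
  also have "grid i j - {(0, 0)} - {(i, j)} = grid i j - {(0, 0), (i, j)}" by auto
  finally show ?thesis .
qed

lemma lead_exc_gf_zero: "lead (- 1 + 2) (real_of_int (- 1) / 2 * exc_lead 0 0) (theta (mom 0 0 exc_gf))"
  using lead_theta_exc0 by (simp add: exc0_def exc_lead_0_0)

lemma lead_exc_gf: "(i, j) \<noteq> (0, 0) \<Longrightarrow> hom_lead (- 1) exc_lead exc_gf i j"
proof (induction "i + 2 * j" arbitrary: i j rule: less_induct)
  case less
  let ?m = "3 * int i + 4 * int j - 2"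
  define d where "d = mom i j (lift exc_gf) - mom i j exc_gf"
  define R where "R = (\<Sum>x\<in>grid i j - {(0, 0), (i, j)}. mom (fst x) (snd x) (lift exc_gf) * mom (i - fst x) (j - snd x) exc_gf)"
  have IH: "hom_lead (- 1) exc_lead exc_gf i' j'" if "i' + 2 * j' < i + 2 * j" "(i', j') \<noteq> (0, 0)" for i' j'
    using less that by blast
  have "mom i j exc_gf = exc0 * mom i j exc_gf + ((mom i j exc_gf + d) * exc0 + R)"
    by (subst exc_gf_eq, unfold mom_add mom_mult_grid grid_remove2[OF less.prems])
      (use less.prems in \<open>auto simp: mom_X R_def d_def exc0_def mom_0_0_lift\<close>)
  then have "(1 - exc0 - exc0) * mom i j exc_gf = exc0 * d + R" by (simp add: algebra_simps)
  then have eq: "disc_pow (1/2) * mom i j exc_gf = exc0 * d + R" by (simp add: disc_pow_half)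
  have d: "lead ?m (lift_lead (- 1) exc_lead i j) d"
    unfolding d_def using lead_mom_lift_diff[OF IH lead_exc_gf_zero] by simp
  have "lead ?m (\<Sum>x\<in>grid i j - {(0, 0), (i, j)}. exc_lead (fst x) (snd x) * exc_lead (i - fst x) (j - snd x)) R"
    unfolding R_def
  proof (rule lead_sum)
    fix x assume x: "x \<in> grid i j - {(0, 0), (i, j)}"
    obtain a b where ab: "x = (a, b)" by (metis surj_pair)
    from x ab have le: "a \<le> i" "b \<le> j" and nz: "(a, b) \<noteq> (0, 0)" "(a, b) \<noteq> (i, j)" by auto
    have 1: "hom_lead (- 1) exc_lead (lift exc_gf) a b"
      using le nz by (intro lead_mom_lift[OF IH lead_exc_gf_zero]) auto
    have 2: "hom_lead (- 1) exc_lead exc_gf (i - a) (j - b)"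
      using le nz by (intro IH) auto
    from lead_mult[OF 1[unfolded hom_lead_def] 2[unfolded hom_lead_def]] le
    show "lead ?m (exc_lead (fst x) (snd x) * exc_lead (i - fst x) (j - snd x))
        (mom (fst x) (snd x) (lift exc_gf) * mom (i - fst x) (j - snd x) exc_gf)"
      by (simp add: ab of_nat_diff algebra_simps)
  qed
  from lead_add[OF lead_mult[OF lead_exc0 d, simplified] this]
  have "lead ?m (exc_lead i j) (disc_pow (1/2) * mom i j exc_gf)"
    unfolding eq by (simp add: exc_lead_rec[OF less.prems])
  from lead_disc_pow_div[OF this, of 1] show ?case by (simp add: hom_lead_def)
qed

section \<open>Leading coefficients for cut excursions and closed walks\<close>

text \<open>To leading order cutting an excursion amounts to marking one of its positions. This
explains why the coefficients are proportional to those of the \<open>z\<close>-derivative of the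
excursion series.\<close>

definition cut_lead :: "nat \<Rightarrow> nat \<Rightarrow> real" where
  "cut_lead i j = (3 * real i + 4 * real j - 1) * exc_lead i j"

function closed_lead :: "nat \<Rightarrow> nat \<Rightarrow> real" where
  "closed_lead i j = 2 * (cut_lead i j + (\<Sum>x\<in>grid i j - {(0, 0)}. exc_lead (fst x) (snd x) * closed_lead (i - fst x) (j - snd x)))"
  by pat_completeness auto
termination by (relation "Wellfounded.measure (\<lambda>(i, j). i + j)") auto

declare closed_lead.simps [simp del]

lemma grid_remove1:
  fixes g :: "nat \<times> nat \<Rightarrow> 'a::comm_monoid_add"
  shows "(\<Sum>x\<in>grid i j. g x) = g (0, 0) + (\<Sum>x\<in>grid i j - {(0, 0)}. g x)"
  by (rule sum.remove) auto

lemma grid_reflect: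
  fixes g :: "nat \<Rightarrow> nat \<Rightarrow> nat \<Rightarrow> nat \<Rightarrow> 'a::comm_monoid_add"
  shows "(\<Sum>x\<in>grid i j - {(0, 0), (i, j)}. g (fst x) (snd x) (i - fst x) (j - snd x)) =
    (\<Sum>x\<in>grid i j - {(0, 0), (i, j)}. g (i - fst x) (j - snd x) (fst x) (snd x))"
  by (rule sum.reindex_bij_witness[of _ "\<lambda>x. (i - fst x, j - snd x)" "\<lambda>x. (i - fst x, j - snd x)"]) auto

text \<open>The recursion for \<open>exc_lead\<close>, differentiated: it is multiplied by the
pole order, which is additive over products, and the sum over pairs is symmetrised.\<close>

lemma cut_lead_rec:
  assumes "(i, j) \<noteq> (0, 0)"
  shows "cut_lead i j = lift_lead 1 cut_lead i j / 2 +
    2 * (\<Sum>x\<in>grid i j - {(0, 0)}. exc_lead (fst x) (snd x) * cut_lead (i - fst x) (j - snd x))"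
proof -
  define D where "D = grid i j - {(0, 0), (i, j)}"
  define w where "w = 3 * real i + 4 * real j - 1"
  define S where "S = (\<Sum>x\<in>D. exc_lead (fst x) (snd x) * exc_lead (i - fst x) (j - snd x))"
  define Q where "Q = (\<Sum>x\<in>D. exc_lead (fst x) (snd x) * cut_lead (i - fst x) (j - snd x))"
  have "Q = (\<Sum>x\<in>D. exc_lead (i - fst x) (j - snd x) * cut_lead (fst x) (snd x))"
    unfolding Q_def D_def by (rule grid_reflect)
  then have "Q + Q = (\<Sum>x\<in>D. exc_lead (fst x) (snd x) * cut_lead (i - fst x) (j - snd x)
      + exc_lead (i - fst x) (j - snd x) * cut_lead (fst x) (snd x))"
    by (simp add: Q_def sum.distrib)
  also have "\<dots> = (\<Sum>x\<in>D. (w - 1) * (exc_lead (fst x) (snd x) * exc_lead (i - fst x) (j - snd x)))"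
    by (intro sum.cong) (auto simp: D_def cut_lead_def w_def of_nat_diff algebra_simps)
  also have "\<dots> = (w - 1) * S" by (simp add: S_def sum_distrib_left)
  finally have Q: "2 * Q = (w - 1) * S" by simp
  have rem: "(\<Sum>x\<in>grid i j - {(0, 0)}. exc_lead (fst x) (snd x) * cut_lead (i - fst x) (j - snd x)) = exc_lead i j * cut_lead 0 0 + Q"
  proof -
    have "(\<Sum>x\<in>grid i j - {(0, 0)}. exc_lead (fst x) (snd x) * cut_lead (i - fst x) (j - snd x)) =
      exc_lead i j * cut_lead 0 0 + (\<Sum>x\<in>grid i j - {(0, 0)} - {(i, j)}. exc_lead (fst x) (snd x) * cut_lead (i - fst x) (j - snd x))"
      using assms by (subst sum.remove[of _ "(i, j)"]) auto
    also have "grid i j - {(0, 0)} - {(i, j)} = D" by (auto simp: D_def)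
    finally show ?thesis by (simp add: Q_def)
  qed
  have lift: "lift_lead 1 cut_lead i j = (w - 1) * lift_lead (- 1) exc_lead i j"
    by (auto simp: lift_lead_def cut_lead_def w_def of_nat_diff field_simps)
  have "cut_lead i j = w * exc_lead i j" by (simp add: cut_lead_def w_def)
  also have "\<dots> = (w - 1) * (lift_lead (- 1) exc_lead i j / 2 + S) + exc_lead i j"
  proof -
    have "lift_lead (- 1) exc_lead i j / 2 + S = exc_lead i j"
      using exc_lead_rec[OF assms] by (simp add: S_def D_def)
    then show ?thesis by (simp add: algebra_simps)
  qed
  also have "\<dots> = lift_lead 1 cut_lead i j / 2 + 2 * Q + exc_lead i j"
    unfolding lift Q by (simp add: algebra_simps)
  finally show ?thesis unfolding rem by (simp add: cut_lead_def exc_lead_0_0 algebra_simps)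
qed

lemma X_eq: "fps_X = exc0 * (1 - exc0)"
  using exc0_eq by (simp add: algebra_simps)

lemma X_exc0: "fps_X - exc0 * exc0 = exc0 * disc_pow (1/2)"
  by (subst X_eq) (simp add: algebra_simps flip: disc_pow_half)

lemma exc0_nonzero: "exc0 \<noteq> 0"
  using X_eq by auto

lemma lead_1_exc0: "lead 0 (1/2) (1 - exc0)"
  using lead_diff[OF lead_disc_pow[of 0 0 1] lead_exc0] by simp

text \<open>Division by \<open>exc0\<close> is multiplication by \<open>1 - exc0\<close> followed
by division by \<open>z\<close>.\<close>

lemma lead_exc0_disc_pow_div:
  assumes "lead m c (exc0 * disc_pow (1/2) * f)"
  shows "lead (m + 1) (2 * c) f"
proof -
  from lead_mult[OF lead_1_exc0 assms]
  have "lead m (c / 2) (fps_X * (disc_pow (1/2) * f))"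
    by (subst X_eq) (simp add: mult_ac)
  from lead_disc_pow_div[OF lead_X_div[OF this], of 1] show ?thesis by simp
qed

text \<open>A crude bound that suffices for the inhomogeneous term of \<open>cut_gf_eq\<close>,
whose pole order is lower than that of the other terms.\<close>

definition coarse :: "real fps fps fps \<Rightarrow> nat \<Rightarrow> nat \<Rightarrow> bool" where
  "coarse F i j \<longleftrightarrow> (\<exists>c. lead (3 * int i + 4 * int j) c (mom i j F) \<and> ((i, j) \<noteq> (0, 0) \<longrightarrow> c = 0))"

lemma coarseI: "hom_lead (- 1) c F i j \<Longrightarrow> (i, j) \<noteq> (0, 0) \<Longrightarrow> coarse F i j"
  unfolding hom_lead_def coarse_def by (auto intro: lead_mono)

lemma coarse_mult:
  assumes "\<And>a b. a \<le> i \<Longrightarrow> b \<le> j \<Longrightarrow> coarse F a b" "\<And>a b. a \<le> i \<Longrightarrow> b \<le> j \<Longrightarrow> coarse G a b"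
    and "(i, j) \<noteq> (0, 0)"
  shows "lead (3 * int i + 4 * int j) 0 (mom i j (F * G))"
proof -
  have "lead (3 * int i + 4 * int j) 0 (mom (fst x) (snd x) F * mom (i - fst x) (j - snd x) G)"
    if "x \<in> grid i j" for x
  proof -
    obtain a b where x: "x = (a, b)" by fastforce
    with that have le: "a \<le> i" "b \<le> j" by auto
    obtain c where c: "lead (3 * int a + 4 * int b) c (mom a b F)" "(a, b) \<noteq> (0, 0) \<longrightarrow> c = 0"
      using assms(1)[OF le] by (auto simp: coarse_def)
    obtain d where d: "lead (3 * int (i - a) + 4 * int (j - b)) d (mom (i - a) (j - b) G)"
      "(i - a, j - b) \<noteq> (0, 0) \<longrightarrow> d = 0"
      using assms(2)[of "i - a" "j - b"] by (auto simp: coarse_def)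
    have "c * d = 0" using c(2) d(2) assms(3) le by auto
    then show ?thesis
      using lead_mult[OF c(1) d(1), unfolded \<open>c * d = 0\<close>] le by (simp add: x of_nat_diff algebra_simps)
  qed
  from lead_sum[OF this] show ?thesis by (simp add: mom_mult_grid)
qed

lemma coarse_exc_gf: "coarse exc_gf i j"
proof (cases "(i, j) = (0, 0)")
  case True
  then show ?thesis using lead_exc0 by (auto simp: coarse_def exc0_def)
qed (auto intro: coarseI lead_exc_gf)

lemma coarse_lift_Run: "coarse (lift (Run weight 0)) i j"
proof -
  let ?C = "Run weight 0" and ?c = "\<lambda>i j. 4 * exc_lead i j"
  have X: "mom i j exc_gf = fps_X * mom i j ?C" for i j
    unfolding exc_gf_def by (rule mom_X_mult)
  have lead: "hom_lead (- 1) ?c ?C i j" if "(i, j) \<noteq> (0, 0)" for i j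
    using lead_exc_gf[OF that] unfolding hom_lead_def X by (rule lead_X_div)
  have "theta exc0 = fps_X * mom 0 0 ?C + fps_X * theta (mom 0 0 ?C)"
    using arg_cong[OF X[of 0 0], of theta] by (simp add: exc0_def theta_mult) (simp add: theta_def)
  then have "fps_X * theta (mom 0 0 ?C) = theta exc0 - exc0" using X[of 0 0] by (simp add: exc0_def)
  moreover have "lead 1 (1/4) (theta exc0 - exc0)"
    using lead_diff[OF lead_theta_exc0 lead_mono[OF lead_exc0, of 1]] by simp
  ultimately have "lead 1 1 (theta (mom 0 0 ?C))" using lead_X_div[of 1 "1/4"] by simp
  then have zero: "lead (- 1 + 2) (real_of_int (- 1) / 2 * ?c 0 0) (theta (mom 0 0 ?C))"
    by (simp add: exc_lead_0_0)
  show ?thesis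
  proof (cases "(i, j) = (0, 0)")
    case True
    have "lead 0 (1/2) (fps_X * mom 0 0 ?C)" using lead_exc0 X[of 0 0] by (simp add: exc0_def)
    from lead_X_div[OF this] True show ?thesis by (auto simp: coarse_def mom_0_0_lift)
  next
    case False
    show ?thesis
      by (rule coarseI[OF lead_mom_lift[where F = ?C and \<kappa> = "- 1" and c = ?c] False])
        (use lead zero False in auto)
  qed
qed

lemma mom_0_0_cut_gf: "mom 0 0 cut_gf * disc_pow (1/2) = exc0"
proof -
  let ?q = "mom 0 0 cut_gf" and ?c = "mom 0 0 (Run weight 0)"
  have "fps_X * ?c = exc0" unfolding exc0_def exc_gf_def mom_X_mult ..
  moreover have "fps_X * ?q = fps_X * (?c * exc0) + exc0 * exc0 * ?q"
    using arg_cong[OF cut_gf_eq, of "mom 0 0"]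
    by (simp add: mom_add mom_X_mult mom_0_0_mult mom_0_0_lift exc0_def power2_eq_square)
  ultimately have "(fps_X - exc0 * exc0) * ?q = exc0 * exc0"
    by (metis add_diff_cancel_right' left_diff_distrib mult.assoc)
  then have "exc0 * (?q * disc_pow (1/2)) = exc0 * exc0" unfolding X_exc0 by (simp add: mult_ac)
  then show ?thesis using exc0_nonzero by simp
qed

lemma lead_cut_gf_0: "lead 1 (1/2) (mom 0 0 cut_gf)"
  using lead_disc_pow_div[of 0 "1/2" "1/2" "mom 0 0 cut_gf" 1] lead_exc0 mom_0_0_cut_gf by (simp add: mult.commute)

text \<open>As \<open>exc0\<close> is \<open>1/2\<close> to leading order, the two mixed terms add
up to the moment of a single factor; products of two proper moments have lower pole order.\<close>

lemma lead_exc_gf_square: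
  assumes "(i, j) \<noteq> (0, 0)"
  shows "hom_lead (- 1) exc_lead (exc_gf\<^sup>2) i j"
proof -
  let ?m = "3 * int i + 4 * int j + - 1"
  let ?R = "\<Sum>x\<in>grid i j - {(0, 0), (i, j)}. mom (fst x) (snd x) exc_gf * mom (i - fst x) (j - snd x) exc_gf"
  have eq: "mom i j (exc_gf\<^sup>2) = exc0 * mom i j exc_gf + (mom i j exc_gf * exc0 + ?R)"
    unfolding power2_eq_square mom_mult_grid grid_remove2[OF assms] by (simp add: exc0_def)
  have "lead ?m (\<Sum>x\<in>grid i j - {(0, 0), (i, j)}. 0) ?R"
  proof (rule lead_sum)
    fix x assume x: "x \<in> grid i j - {(0, 0), (i, j)}"
    obtain a b where ab: "x = (a, b)" by (metis surj_pair)
    from x ab have le: "a \<le> i" "b \<le> j" and nz: "(a, b) \<noteq> (0, 0)" "(a, b) \<noteq> (i, j)" by auto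
    have 1: "hom_lead (- 1) exc_lead exc_gf a b" using nz by (intro lead_exc_gf) auto
    have 2: "hom_lead (- 1) exc_lead exc_gf (i - a) (j - b)" using le nz by (intro lead_exc_gf) auto
    have "lead (?m - 1) (exc_lead a b * exc_lead (i - a) (j - b)) (mom a b exc_gf * mom (i - a) (j - b) exc_gf)"
      using lead_mult[OF 1[unfolded hom_lead_def] 2[unfolded hom_lead_def]] le
      by (simp add: of_nat_diff algebra_simps)
    then show "lead ?m 0 (mom (fst x) (snd x) exc_gf * mom (i - fst x) (j - snd x) exc_gf)"
      using lead_mono by (simp add: ab)
  qed
  moreover have "lead ?m (1/2 * exc_lead i j) (exc0 * mom i j exc_gf)" "lead ?m (exc_lead i j * (1/2)) (mom i j exc_gf * exc0)"
    using lead_mult[OF lead_exc0 lead_exc_gf[OF assms, unfolded hom_lead_def]]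
      lead_mult[OF lead_exc_gf[OF assms, unfolded hom_lead_def] lead_exc0] by simp_all
  ultimately have "lead ?m (1/2 * exc_lead i j + (exc_lead i j * (1/2) + (\<Sum>x\<in>grid i j - {(0, 0), (i, j)}. 0))) (mom i j (exc_gf\<^sup>2))"
    unfolding eq by (intro lead_add)
  then show ?thesis by (simp add: hom_lead_def)
qed

lemma lead_exc_gf_square_mult:
  assumes "\<And>a b. a \<le> i \<Longrightarrow> b \<le> j \<Longrightarrow> a + b < i + j \<Longrightarrow> hom_lead \<kappa> c F a b"
  shows "lead (3 * int i + 4 * int j + \<kappa> - 1)
    (\<Sum>x\<in>grid i j - {(0, 0)}. exc_lead (fst x) (snd x) * c (i - fst x) (j - snd x))
    (\<Sum>x\<in>grid i j - {(0, 0)}. mom (fst x) (snd x) (exc_gf\<^sup>2) * mom (i - fst x) (j - snd x) F)"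
proof (rule lead_sum)
  fix x assume x: "x \<in> grid i j - {(0, 0)}"
  obtain a b where ab: "x = (a, b)" by (metis surj_pair)
  from x ab have le: "a \<le> i" "b \<le> j" and nz: "(a, b) \<noteq> (0, 0)" by auto
  have "hom_lead \<kappa> c F (i - a) (j - b)" using le nz by (intro assms) auto
  with lead_exc_gf_square[OF nz] have "lead (3 * int a + 4 * int b + - 1 + (3 * int (i - a) + 4 * int (j - b) + \<kappa>))
      (exc_lead a b * c (i - a) (j - b)) (mom a b (exc_gf\<^sup>2) * mom (i - a) (j - b) F)"
    unfolding hom_lead_def by (rule lead_mult)
  then show "lead (3 * int i + 4 * int j + \<kappa> - 1) (exc_lead (fst x) (snd x) * c (i - fst x) (j - snd x))
      (mom (fst x) (snd x) (exc_gf\<^sup>2) * mom (i - fst x) (j - snd x) F)"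
    using le by (simp add: ab of_nat_diff algebra_simps)
qed

lemma mom_0_0_exc_gf_square: "mom 0 0 (exc_gf\<^sup>2) = exc0 * exc0"
  by (simp add: power2_eq_square mom_0_0_mult exc0_def)

lemma lead_cut_gf: "hom_lead 1 cut_lead cut_gf i j"
proof (induction "i + 2 * j" arbitrary: i j rule: less_induct)
  case less
  have IH: "hom_lead 1 cut_lead cut_gf i' j'" if "i' + 2 * j' < i + 2 * j" for i' j'
    using less that by blast
  have zero: "lead (1 + 2) (real_of_int 1 / 2 * cut_lead 0 0) (theta (mom 0 0 cut_gf))"
    using lead_theta[OF lead_cut_gf_0] by (simp add: cut_lead_def exc_lead_0_0)
  show ?case
  proof (cases "(i, j) = (0, 0)")
    case True
    then show ?thesis using lead_cut_gf_0 by (simp add: hom_lead_def cut_lead_def exc_lead_0_0)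
  next
    case False
    let ?m = "3 * int i + 4 * int j"
    define d where "d = mom i j (lift cut_gf) - mom i j cut_gf"
    define B where "B = mom i j (lift (Run weight 0) * exc_gf)"
    define R where "R = (\<Sum>x\<in>grid i j - {(0, 0)}. mom (fst x) (snd x) (exc_gf\<^sup>2) * mom (i - fst x) (j - snd x) (lift cut_gf))"
    have "fps_X * mom i j cut_gf = fps_X * B + (exc0 * exc0 * (mom i j cut_gf + d) + R)"
      using arg_cong[OF cut_gf_eq, of "mom i j"]
      unfolding mom_add mom_X_mult B_def mom_mult_grid[of i j "exc_gf\<^sup>2"] grid_remove1
      by (simp add: R_def d_def mom_0_0_exc_gf_square)
    then have "(fps_X - exc0 * exc0) * mom i j cut_gf = fps_X * B + (exc0 * exc0 * d + R)"
      by (simp add: algebra_simps)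
    then have eq: "exc0 * disc_pow (1/2) * mom i j cut_gf = fps_X * B + (exc0 * exc0 * d + R)" by (simp add: X_exc0)
    have "lead ?m 0 B"
      unfolding B_def using False by (intro coarse_mult coarse_exc_gf coarse_lift_Run)
    from lead_mult[OF lead_X this] have 1: "lead ?m 0 (fps_X * B)" by simp
    have "lead ?m (lift_lead 1 cut_lead i j) d"
      unfolding d_def using lead_mom_lift_diff[OF IH zero] by simp
    from lead_mult[OF lead_mult[OF lead_exc0 lead_exc0] this]
    have 2: "lead ?m (1/4 * lift_lead 1 cut_lead i j) (exc0 * exc0 * d)" by simp
    have "hom_lead 1 cut_lead (lift cut_gf) a b" if "a \<le> i" "b \<le> j" "a + b < i + j" for a b
    proof (cases "(a, b) = (0, 0)")
      case True
      then show ?thesis using lead_cut_gf_0 by (simp add: hom_lead_def cut_lead_def exc_lead_0_0 mom_0_0_lift)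
    next
      case nz: False
      show ?thesis using that nz by (intro lead_mom_lift[OF IH zero]) auto
    qed
    from lead_exc_gf_square_mult[of i j, OF this]
    have 3: "lead ?m (\<Sum>x\<in>grid i j - {(0, 0)}. exc_lead (fst x) (snd x) * cut_lead (i - fst x) (j - snd x)) R"
      by (simp add: R_def)
    have "cut_lead i j / 2 = 0 + (1/4 * lift_lead 1 cut_lead i j +
        (\<Sum>x\<in>grid i j - {(0, 0)}. exc_lead (fst x) (snd x) * cut_lead (i - fst x) (j - snd x)))"
      using cut_lead_rec[OF False] by simp
    then have "lead ?m (cut_lead i j / 2) (exc0 * disc_pow (1/2) * mom i j cut_gf)"
      using lead_add[OF 1 lead_add[OF 2 3]] by (simp only: eq)
    from lead_exc0_disc_pow_div[OF this] show ?thesis by (simp add: hom_lead_def)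
  qed
qed

text \<open>The equation for closed walks reads
\<open>exc0 y T = cut_gf + exc_gf\<^sup>2 T\<close> after moving the term of order zero to the
left, and dividing by \<open>exc0 y\<close> raises the pole order by one.\<close>

lemma lead_Closed: "hom_lead 2 closed_lead (Closed weight) i j"
proof (induction "i + j" arbitrary: i j rule: less_induct)
  case less
  let ?T = "Closed weight" and ?m = "3 * int i + 4 * int j + 1"
  define R where "R = (\<Sum>x\<in>grid i j - {(0, 0)}. mom (fst x) (snd x) (exc_gf\<^sup>2) * mom (i - fst x) (j - snd x) ?T)"
  have "fps_X * ?T = cut_gf + exc_gf\<^sup>2 * ?T"
    using Closed_exc_gf by (simp add: algebra_simps)
  from arg_cong[OF this, of "mom i j"]
  have "fps_X * mom i j ?T = mom i j cut_gf + (exc0 * exc0 * mom i j ?T + R)"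
    unfolding mom_add mom_X_mult mom_mult_grid[of i j "exc_gf\<^sup>2"] grid_remove1
    by (simp add: R_def mom_0_0_exc_gf_square)
  then have "(fps_X - exc0 * exc0) * mom i j ?T = mom i j cut_gf + R" by (simp add: algebra_simps)
  then have eq: "exc0 * disc_pow (1/2) * mom i j ?T = mom i j cut_gf + R" by (simp add: X_exc0)
  have "lead ?m (\<Sum>x\<in>grid i j - {(0, 0)}. exc_lead (fst x) (snd x) * closed_lead (i - fst x) (j - snd x)) R"
    unfolding R_def using lead_exc_gf_square_mult[of i j 2 closed_lead ?T] less by (simp add: add_ac)
  from lead_add[OF lead_cut_gf[of i j, unfolded hom_lead_def] this]
  moreover have "closed_lead i j / 2 = cut_lead i j +
      (\<Sum>x\<in>grid i j - {(0, 0)}. exc_lead (fst x) (snd x) * closed_lead (i - fst x) (j - snd x))"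
    by (subst closed_lead.simps) simp
  ultimately have "lead ?m (closed_lead i j / 2) (exc0 * disc_pow (1/2) * mom i j ?T)"
    by (simp only: eq)
  from lead_exc0_disc_pow_div[OF this] show ?case by (simp add: hom_lead_def add_ac)
qed

section \<open>Numerical values\<close>

text \<open>The restriction of the index set is moved into the summand, so that the sums unfold to
terms that the simplifier evaluates with the values for smaller \<open>i + 2 j\<close>.\<close>

lemma exc_lead_eval:
  assumes "(i, j) \<noteq> (0, 0)"
  shows "exc_lead i j = lift_lead (- 1) exc_lead i j / 2 +
    (\<Sum>a\<le>i. \<Sum>b\<le>j. if a = 0 \<and> b = 0 \<or> a = i \<and> b = j then 0 else exc_lead a b * exc_lead (i - a) (j - b))"
proof -
  have "(\<Sum>x\<in>grid i j - {(0, 0), (i, j)}. exc_lead (fst x) (snd x) * exc_lead (i - fst x) (j - snd x)) =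
    (\<Sum>x\<in>grid i j. if fst x = 0 \<and> snd x = 0 \<or> fst x = i \<and> snd x = j then 0
      else exc_lead (fst x) (snd x) * exc_lead (i - fst x) (j - snd x))"
    by (rule sum.mono_neutral_cong_left) auto
  then show ?thesis
    by (subst exc_lead_rec[OF assms]) (simp add: sum.cartesian_product case_prod_unfold)
qed

lemma closed_lead_eval:
  "closed_lead i j = 2 * (cut_lead i j +
    (\<Sum>a\<le>i. \<Sum>b\<le>j. if a = 0 \<and> b = 0 then 0 else exc_lead a b * closed_lead (i - a) (j - b)))"
proof -
  have "(\<Sum>x\<in>grid i j - {(0, 0)}. exc_lead (fst x) (snd x) * closed_lead (i - fst x) (j - snd x)) =
    (\<Sum>x\<in>grid i j. if fst x = 0 \<and> snd x = 0 then 0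
      else exc_lead (fst x) (snd x) * closed_lead (i - fst x) (j - snd x))"
    by (rule sum.mono_neutral_cong_left) auto
  then show ?thesis
    by (subst closed_lead.simps) (simp add: sum.cartesian_product case_prod_unfold)
qed

lemma sum_atMost_numeral:
  "(\<Sum>a\<le>numeral k. f a) = (\<Sum>a\<le>pred_numeral k. f a) + (f (numeral k) :: real)"
  by (simp add: numeral_eq_Suc)

lemmas table_simps = sum_atMost_numeral lift_lead_def

lemmas exc_lead_0 = exc_lead_0_0

lemma exc_lead_1:
  "exc_lead (Suc 0) 0 = 1 / 8"
  by (subst exc_lead_eval; simp add: table_simps exc_lead_0)+

lemma exc_lead_2:
  "exc_lead 2 0 = 5 / 64"
  "exc_lead 0 (Suc 0) = 1 / 8"
  by (subst exc_lead_eval; simp add: table_simps exc_lead_0 exc_lead_1)+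

lemma exc_lead_3:
  "exc_lead 3 0 = 15 / 128"
  "exc_lead (Suc 0) (Suc 0) = 9 / 32"
  by (subst exc_lead_eval; simp add: table_simps exc_lead_0 exc_lead_1 exc_lead_2)+

lemma exc_lead_4:
  "exc_lead 4 0 = 1105 / 4096"
  "exc_lead 2 (Suc 0) = 221 / 256"
  "exc_lead 0 2 = 19 / 64"
  by (subst exc_lead_eval; simp add: table_simps exc_lead_0 exc_lead_1 exc_lead_2 exc_lead_3)+

lemma exc_lead_5:
  "exc_lead 5 0 = 1695 / 2048"
  "exc_lead 3 (Suc 0) = 1695 / 512"
  "exc_lead (Suc 0) 2 = 153 / 64"
  by (subst exc_lead_eval; simp add: table_simps exc_lead_0 exc_lead_1 exc_lead_2 exc_lead_3 exc_lead_4)+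

lemma exc_lead_6:
  "exc_lead 6 0 = 414125 / 131072"
  "exc_lead 4 (Suc 0) = 248475 / 16384"
  "exc_lead 2 2 = 34503 / 2048"
  "exc_lead 0 3 = 631 / 256"
  by (subst exc_lead_eval; simp add: table_simps exc_lead_0 exc_lead_1 exc_lead_2 exc_lead_3 exc_lead_4 exc_lead_5)+

lemma exc_lead_7:
  "exc_lead 7 0 = 59025 / 4096"
  "exc_lead 5 (Suc 0) = 82635 / 1024"
  "exc_lead 3 2 = 248595 / 2048"
  "exc_lead (Suc 0) 3 = 21429 / 512"
  by (subst exc_lead_eval; simp add: table_simps exc_lead_0 exc_lead_1 exc_lead_2 exc_lead_3 exc_lead_4 exc_lead_5 exc_lead_6)+

lemma exc_lead_8:
  "exc_lead 8 0 = 1282031525 / 16777216"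
  "exc_lead 6 (Suc 0) = 256406305 / 524288"
  "exc_lead 4 2 = 121782417 / 131072"
  "exc_lead 2 3 = 4321753 / 8192"
  "exc_lead 0 4 = 174317 / 4096"
  by (subst exc_lead_eval; simp add: table_simps exc_lead_0 exc_lead_1 exc_lead_2 exc_lead_3 exc_lead_4 exc_lead_5 exc_lead_6 exc_lead_7)+

lemma exc_lead_9:
  "exc_lead 9 0 = 242183775 / 524288"
  "exc_lead 7 (Suc 0) = 435930795 / 131072"
  "exc_lead 5 2 = 62579385 / 8192"
  "exc_lead 3 3 = 12581985 / 2048"
  "exc_lead (Suc 0) 4 = 1268343 / 1024"
  by (subst exc_lead_eval; simp add: table_simps exc_lead_0 exc_lead_1 exc_lead_2 exc_lead_3 exc_lead_4 exc_lead_5 exc_lead_6 exc_lead_7 exc_lead_8)+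

lemma exc_lead_10:
  "exc_lead 10 0 = 1683480621875 / 536870912"
  "exc_lead 8 (Suc 0) = 1683480621875 / 67108864"
  "exc_lead 6 2 = 283532034835 / 4194304"
  "exc_lead 4 3 = 37170498953 / 524288"
  "exc_lead 2 4 = 3210756043 / 131072"
  "exc_lead 0 5 = 20491783 / 16384"
  by (subst exc_lead_eval; simp add: table_simps exc_lead_0 exc_lead_1 exc_lead_2 exc_lead_3 exc_lead_4 exc_lead_5 exc_lead_6 exc_lead_7 exc_lead_8 exc_lead_9)+

lemma exc_lead_11:
  "exc_lead 11 0 = 198147676875 / 8388608"
  "exc_lead 9 (Suc 0) = 435924889125 / 2097152"
  "exc_lead 7 2 = 168547250115 / 262144"
  "exc_lead 5 3 = 54720110505 / 65536"
  "exc_lead 3 4 = 6891019275 / 16384"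
  "exc_lead (Suc 0) 5 = 227803437 / 4096"
  by (subst exc_lead_eval; simp add: table_simps exc_lead_0 exc_lead_1 exc_lead_2 exc_lead_3 exc_lead_4 exc_lead_5 exc_lead_6 exc_lead_7 exc_lead_8 exc_lead_9 exc_lead_10)+

lemma exc_lead_12:
  "exc_lead 12 0 = 6718940277925125 / 34359738368"
  "exc_lead 10 (Suc 0) = 4031364166755075 / 2147483648"
  "exc_lead 8 2 = 3519322894490985 / 536870912"
  "exc_lead 6 3 = 170697667410417 / 16777216"
  "exc_lead 4 4 = 57307008450195 / 8388608"
  "exc_lead 2 5 = 833230887615 / 524288"
  "exc_lead 0 6 = 7334801895 / 131072"
  by (subst exc_lead_eval; simp add: table_simps exc_lead_0 exc_lead_1 exc_lead_2 exc_lead_3 exc_lead_4 exc_lead_5 exc_lead_6 exc_lead_7 exc_lead_8 exc_lead_9 exc_lead_10 exc_lead_11)+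

lemmas exc_lead_table = exc_lead_0 exc_lead_1 exc_lead_2 exc_lead_3 exc_lead_4 exc_lead_5 exc_lead_6 exc_lead_7 exc_lead_8 exc_lead_9 exc_lead_10 exc_lead_11 exc_lead_12

lemma closed_lead_0: "closed_lead 0 0 = 1"
  by (subst closed_lead_eval) (simp add: cut_lead_def exc_lead_0_0)

lemma closed_lead_1:
  "closed_lead (Suc 0) 0 = 3 / 4"
  by (subst closed_lead_eval; simp add: table_simps cut_lead_def exc_lead_table closed_lead_0)+

lemma closed_lead_2:
  "closed_lead 2 0 = 9 / 8"
  "closed_lead 0 (Suc 0) = 1"
  by (subst closed_lead_eval; simp add: table_simps cut_lead_def exc_lead_table closed_lead_0 closed_lead_1)+

lemma closed_lead_3:
  "closed_lead 3 0 = 321 / 128"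
  "closed_lead (Suc 0) (Suc 0) = 35 / 8"
  by (subst closed_lead_eval; simp add: table_simps cut_lead_def exc_lead_table closed_lead_0 closed_lead_1 closed_lead_2)+

lemma closed_lead_4:
  "closed_lead 4 0 = 477 / 64"
  "closed_lead 2 (Suc 0) = 615 / 32"
  "closed_lead 0 2 = 5"
  by (subst closed_lead_eval; simp add: table_simps cut_lead_def exc_lead_table closed_lead_0 closed_lead_1 closed_lead_2 closed_lead_3)+

lemma closed_lead_5:
  "closed_lead 5 0 = 227349 / 8192"
  "closed_lead 3 (Suc 0) = 12077 / 128"
  "closed_lead (Suc 0) 2 = 7161 / 128"
  by (subst closed_lead_eval; simp add: table_simps cut_lead_def exc_lead_table closed_lead_0 closed_lead_1 closed_lead_2 closed_lead_3 closed_lead_4)+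

lemma closed_lead_6:
  "closed_lead 6 0 = 254529 / 2048"
  "closed_lead 4 (Suc 0) = 33513 / 64"
  "closed_lead 2 2 = 31983 / 64"
  "closed_lead 0 3 = 61"
  by (subst closed_lead_eval; simp add: table_simps cut_lead_def exc_lead_table closed_lead_0 closed_lead_1 closed_lead_2 closed_lead_3 closed_lead_4 closed_lead_5)+

lemma closed_lead_7:
  "closed_lead 7 0 = 170484033 / 262144"
  "closed_lead 5 (Suc 0) = 53516103 / 16384"
  "closed_lead 3 2 = 17787389 / 4096"
  "closed_lead (Suc 0) 3 = 332475 / 256"
  by (subst closed_lead_eval; simp add: table_simps cut_lead_def exc_lead_table closed_lead_0 closed_lead_1 closed_lead_2 closed_lead_3 closed_lead_4 closed_lead_5 closed_lead_6)+

lemma closed_lead_8: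
  "closed_lead 8 0 = 15947073 / 4096"
  "closed_lead 6 (Suc 0) = 46477827 / 2048"
  "closed_lead 4 2 = 39790035 / 1024"
  "closed_lead 2 3 = 10048347 / 512"
  "closed_lead 0 4 = 1385"
  by (subst closed_lead_eval; simp add: table_simps cut_lead_def exc_lead_table closed_lead_0 closed_lead_1 closed_lead_2 closed_lead_3 closed_lead_4 closed_lead_5 closed_lead_6 closed_lead_7)+

lemma closed_lead_9:
  "closed_lead 9 0 = 880415984769 / 33554432"
  "closed_lead 7 (Suc 0) = 22814553275 / 131072"
  "closed_lead 5 2 = 95799267627 / 262144"
  "closed_lead 3 3 = 544942181 / 2048"
  "closed_lead (Suc 0) 4 = 393206957 / 8192"
  by (subst closed_lead_eval; simp add: table_simps cut_lead_def exc_lead_table closed_lead_0 closed_lead_1 closed_lead_2 closed_lead_3 closed_lead_4 closed_lead_5 closed_lead_6 closed_lead_7 closed_lead_8)+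

lemma closed_lead_10:
  "closed_lead 10 0 = 103054669839 / 524288"
  "closed_lead 8 (Suc 0) = 95808986931 / 65536"
  "closed_lead 6 2 = 29818312407 / 8192"
  "closed_lead 4 3 = 1792771497 / 512"
  "closed_lead 2 4 = 1126390089 / 1024"
  "closed_lead 0 5 = 50521"
  by (subst closed_lead_eval; simp add: table_simps cut_lead_def exc_lead_table closed_lead_0 closed_lead_1 closed_lead_2 closed_lead_3 closed_lead_4 closed_lead_5 closed_lead_6 closed_lead_7 closed_lead_8 closed_lead_9)+

lemma closed_lead_11:
  "closed_lead 11 0 = 1739691997222023 / 1073741824"
  "closed_lead 9 (Suc 0) = 895991681089717 / 67108864"
  "closed_lead 7 2 = 322798696084089 / 8388608"
  "closed_lead 5 3 = 24272508555855 / 524288"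
  "closed_lead 3 4 = 5625489430875 / 262144"
  "closed_lead (Suc 0) 5 = 42438348225 / 16384"
  by (subst closed_lead_eval; simp add: table_simps cut_lead_def exc_lead_table closed_lead_0 closed_lead_1 closed_lead_2 closed_lead_3 closed_lead_4 closed_lead_5 closed_lead_6 closed_lead_7 closed_lead_8 closed_lead_9 closed_lead_10)+

lemma closed_lead_12:
  "closed_lead 12 0 = 61119388864647 / 4194304"
  "closed_lead 10 (Suc 0) = 276346721444631 / 2097152"
  "closed_lead 8 2 = 3536344181175 / 8192"
  "closed_lead 6 3 = 41003286473025 / 65536"
  "closed_lead 4 4 = 3196407005925 / 8192"
  "closed_lead 2 5 = 343169012667 / 4096"
  "closed_lead 0 6 = 2702765"
  by (subst closed_lead_eval; simp add: table_simps cut_lead_def exc_lead_table closed_lead_0 closed_lead_1 closed_lead_2 closed_lead_3 closed_lead_4 closed_lead_5 closed_lead_6 closed_lead_7 closed_lead_8 closed_lead_9 closed_lead_10 closed_lead_11)+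

lemmas closed_lead_table = closed_lead_0 closed_lead_1 closed_lead_2 closed_lead_3 closed_lead_4 closed_lead_5 closed_lead_6 closed_lead_7 closed_lead_8 closed_lead_9 closed_lead_10 closed_lead_11 closed_lead_12

text \<open>The limit of the \<open>k\<close>-th moment of \<open>n B - A\<^sup>2 / 2\<close>
after scaling, expanded by the binomial theorem. The factorials in the numerator undo the divided
powers, and the one in the denominator is \<open>\<Gamma> (2 k + l + 1)\<close> from singularity
analysis.\<close>

definition limit_moment :: "nat \<Rightarrow> real" where
  "limit_moment k = (\<Sum>l\<le>k. real (k choose l) * (- 1 / 2) ^ l *
     (fact (2 * l) * fact (k - l) * closed_lead (2 * l) (k - l) / fact (2 * k + l)))"

lemma choose_table:
  "(2::nat) choose (Suc 0) = 2"
  "(3::nat) choose (Suc 0) = 3"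
  "(3::nat) choose 2 = 3"
  "(4::nat) choose (Suc 0) = 4"
  "(4::nat) choose 2 = 6"
  "(4::nat) choose 3 = 4"
  "(5::nat) choose (Suc 0) = 5"
  "(5::nat) choose 2 = 10"
  "(5::nat) choose 3 = 10"
  "(5::nat) choose 4 = 5"
  "(6::nat) choose (Suc 0) = 6"
  "(6::nat) choose 2 = 15"
  "(6::nat) choose 3 = 20"
  "(6::nat) choose 4 = 15"
  "(6::nat) choose 5 = 6"
  by code_simp+

lemma limit_moments:
  "limit_moment 0 = 1"
  "limit_moment (Suc 0) = 5 / 16"
  "limit_moment 2 = 1217 / 7680"
  "limit_moment 3 = 1601353 / 13762560"
  "limit_moment 4 = 3264219 / 28835840"
  "limit_moment 5 = 226724203201 / 1648864788480"
  "limit_moment 6 = 55362976940435959 / 276270593039400960"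
  by (simp_all add: limit_moment_def table_simps choose_table closed_lead_table fact_numeral power_divide)

section \<open>Closed walks as lists\<close>

fun chain :: "int \<Rightarrow> int list \<Rightarrow> bool" where
  "chain x [] \<longleftrightarrow> True"
| "chain x (y # ys) \<longleftrightarrow> y \<in> succs x \<and> chain y ys"

definition walks :: "int \<Rightarrow> nat \<Rightarrow> int list set" where
  "walks x L = {xs. length xs = L \<and> chain x xs}"

text \<open>The value \<open>0\<close> in front of the list only serves to make
\<open>last\<close> meaningful for the empty walk.\<close>

definition closed_walks :: "nat \<Rightarrow> int list set" where
  "closed_walks n = {xs. length xs = n \<and> chain (- (max (last (0 # xs)) 0 + 1)) xs}"

definition height_sum :: "int list \<Rightarrow> nat" where
  "height_sum xs = (\<Sum>x\<leftarrow>xs. nat \<bar>x\<bar>)"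

definition square_sum :: "int list \<Rightarrow> nat" where
  "square_sum xs = (\<Sum>x\<leftarrow>xs. (nat \<bar>x\<bar>)\<^sup>2)"

lemma walks_0: "walks x 0 = {[]}"
  by (auto simp: walks_def)

lemma walks_Suc: "walks x (Suc L) = (\<Union>y\<in>succs x. (#) y ` walks y L)"
  by (auto simp: walks_def length_Suc_conv)

lemma finite_walks [simp]: "finite (walks x L)"
  by (induction L arbitrary: x) (auto simp: walks_0 walks_Suc)

lemma sum_walks_Suc:
  "(\<Sum>xs\<in>walks x (Suc L). f xs) = (\<Sum>y\<in>succs x. \<Sum>ys\<in>walks y L. f (y # ys))"
proof -
  have "(\<Sum>xs\<in>walks x (Suc L). f xs) = (\<Sum>y\<in>succs x. sum f ((#) y ` walks y L))"
    unfolding walks_Suc by (rule sum.UNION_disjoint) auto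
  also have "\<dots> = (\<Sum>y\<in>succs x. \<Sum>ys\<in>walks y L. f (y # ys))"
    by (simp add: sum.reindex)
  finally show ?thesis .
qed

definition walk_weight :: "int list \<Rightarrow> real fps fps" where
  "walk_weight xs = wexp (real (height_sum xs)) (real (square_sum xs))"

lemma walk_weight_Cons: "walk_weight (y # ys) = weight (nat \<bar>y\<bar>) * walk_weight ys"
  by (simp add: walk_weight_def weight_def wexp_mult height_sum_def square_sum_def)

lemma walk_coeff_weight:
  "walk_coeff weight e x L =
    (\<Sum>xs\<in>walks x L. if max (last (x # xs)) 0 = int e then walk_weight xs else 0)"
proof (induction L arbitrary: x)
  case 0
  show ?case by (simp add: walks_0 walk_weight_def height_sum_def square_sum_def)
next
  case (Suc L)
  have "walk_coeff weight e x (Suc L) = (\<Sum>y\<in>succs x. weight (nat \<bar>y\<bar>) *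
      (\<Sum>ys\<in>walks y L. if max (last (y # ys)) 0 = int e then walk_weight ys else 0))"
    by (simp only: walk_coeff.simps Suc)
  also have "\<dots> = (\<Sum>y\<in>succs x. \<Sum>ys\<in>walks y L.
      if max (last (y # ys)) 0 = int e then walk_weight (y # ys) else 0)"
    unfolding sum_distrib_left by (intro sum.cong refl) (auto simp: walk_weight_Cons)
  also have "\<dots> = (\<Sum>xs\<in>walks x (Suc L). if max (last (x # xs)) 0 = int e then walk_weight xs else 0)"
    by (simp add: sum_walks_Suc)
  finally show ?case .
qed

lemma last_walk: "xs \<in> walks x L \<Longrightarrow> last (x # xs) \<le> max x 0 + int L"
proof (induction L arbitrary: x xs)
  case (Suc L)
  then obtain y ys where y: "xs = y # ys" "y \<in> succs x" "ys \<in> walks y L" by (auto simp: walks_Suc)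
  with Suc.IH[of ys y] show ?case by (auto simp: succs_def)
qed (auto simp: walks_0)

lemma Closed_weight_nth: "Closed weight $ n = (\<Sum>xs\<in>closed_walks n. walk_weight xs)"
  and finite_closed_walks: "finite (closed_walks n)"
proof -
  define V where "V e = {xs \<in> walks (- int (Suc e)) n. max (last (- int (Suc e) # xs)) 0 = int e}" for e
  have last: "max (last (- int (Suc e) # xs)) 0 = max (last (0 # xs)) 0" for e xs
    by (cases xs) auto
  have V: "closed_walks n = (\<Union>e\<le>n. V e)"
  proof (intro equalityI subsetI)
    fix xs assume xs: "xs \<in> closed_walks n"
    define e where "e = nat (max (last (0 # xs)) 0)"
    have e: "int e = max (last (0 # xs)) 0" by (simp add: e_def)
    then have w: "xs \<in> walks (- int (Suc e)) n"
      using xs by (simp add: closed_walks_def walks_def add.commute)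
    have "e \<le> n"
      using last_walk[OF w] last[of e xs] e by auto
    have "xs \<in> V e" using w e last[of e xs] by (simp add: V_def del: last.simps)
    then show "xs \<in> (\<Union>e\<le>n. V e)" using \<open>e \<le> n\<close> by blast
  next
    fix xs assume "xs \<in> (\<Union>e\<le>n. V e)"
    then obtain e where e: "xs \<in> V e" by blast
    then have "xs \<in> walks (- int (Suc e)) n" "max (last (0 # xs)) 0 = int e"
      using last[of e xs] by (simp_all add: V_def del: last.simps of_nat_Suc)
    then show "xs \<in> closed_walks n" by (simp add: closed_walks_def walks_def add.commute)
  qed
  have fin: "finite (V e)" for e by (simp add: V_def)
  then show "finite (closed_walks n)" by (simp add: V)
  have "Closed weight $ n = (\<Sum>e\<le>n. \<Sum>xs\<in>V e. walk_weight xs)"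
    by (simp add: Closed_def walk_coeff_weight V_def sum.inter_filter del: last.simps)
  also have "\<dots> = (\<Sum>xs\<in>(\<Union>e\<le>n. V e). walk_weight xs)"
    using fin by (intro sum.UNION_disjoint[symmetric]) (auto simp: V_def last simp del: last.simps of_nat_Suc)
  finally show "Closed weight $ n = (\<Sum>xs\<in>closed_walks n. walk_weight xs)" by (simp add: V)
qed

definition walk_sum :: "nat \<Rightarrow> nat \<Rightarrow> nat \<Rightarrow> real" where
  "walk_sum i j n = (\<Sum>xs\<in>closed_walks n. real (height_sum xs) ^ i * real (square_sum xs) ^ j)"

lemma walk_sum_asymptotic:
  "(\<lambda>n. walk_sum i j n / 4 ^ n * real n powr (- (3 * real i + 4 * real j) / 2))
    \<longlonglongrightarrow> fact i * fact j * closed_lead i j * rGamma ((3 * real i + 4 * real j + 2) / 2)"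
proof -
  have mom: "mom i j (Closed weight) $ n = walk_sum i j n / (fact i * fact j)" for n
    by (simp add: mom_def Closed_weight_nth fps_sum_nth walk_weight_def wexp_nth walk_sum_def
        sum_divide_distrib)
  have e: "1 - real_of_int (3 * int i + 4 * int j + 2) / 2 = - (3 * real i + 4 * real j) / 2"
    "real_of_int (3 * int i + 4 * int j + 2) / 2 = (3 * real i + 4 * real j + 2) / 2"
    by (simp_all add: field_simps)
  have "(\<lambda>n. mom i j (Closed weight) $ n / 4 ^ n * real n powr (- (3 * real i + 4 * real j) / 2))
    \<longlonglongrightarrow> closed_lead i j * rGamma ((3 * real i + 4 * real j + 2) / 2)"
    using lead_asymptotic[OF lead_Closed[unfolded hom_lead_def, of i j]] unfolding e(1) unfolding e(2) .
  from tendsto_mult_left[OF this, of "fact i * fact j"] show ?thesis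
    by (simp add: mom mult.assoc)
qed

section \<open>First-column hook lengths\<close>

text \<open>The first-column hook lengths, from the top row downwards.\<close>

fun beta :: "nat list \<Rightarrow> nat list" where
  "beta [] = []"
| "beta (x # xs) = (x + length xs) # beta xs"

lemma length_beta [simp]: "length (beta xs) = length xs"
  by (induction xs) auto

lemma beta_nth: "i < length xs \<Longrightarrow> beta xs ! i = xs ! i + (length xs - Suc i)"
  by (induction xs arbitrary: i) (auto simp: nth_Cons split: nat.splits)

text \<open>A downward closed property of the numbers below \<open>k\<close> holds exactly below
some bound.\<close>

lemma threshold:
  assumes "\<And>l l'. l \<le> l' \<Longrightarrow> l' < k \<Longrightarrow> P l' \<Longrightarrow> P l"
  obtains c where "c \<le> (k :: nat)" "\<And>l. l < k \<Longrightarrow> P l \<longleftrightarrow> l < c"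
proof -
  have "\<exists>c\<le>k. \<forall>l<k. P l \<longleftrightarrow> l < c" using assms
  proof (induction k)
    case (Suc k)
    show ?case
    proof (cases "P k")
      case True
      then have "\<forall>l<Suc k. P l \<longleftrightarrow> l < Suc k" using Suc.prems[of _ k] by auto
      then show ?thesis by blast
    next
      case False
      obtain c where "c \<le> k" "\<forall>l<k. P l \<longleftrightarrow> l < c"
        using Suc.IH Suc.prems less_SucI by metis
      then show ?thesis using False by (intro exI[of _ c]) (auto simp: less_Suc_eq)
    qed
  qed auto
  then show thesis using that by blast
qed

context
  fixes xs :: "nat list"
  assumes part: "is_partition xs"
begin

lemma partition_antimono: "l \<le> l' \<Longrightarrow> l' < length xs \<Longrightarrow> xs ! l' \<le> xs ! l"
  using part sorted_wrt_nth_less[of "(\<ge>)" xs l l'] by (cases "l = l'") (auto simp: is_partition_def)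

lemma partition_pos: "l < length xs \<Longrightarrow> 0 < xs ! l"
  using part by (auto simp: is_partition_def)

lemma conj_part_eq:
  assumes "1 \<le> j" "c \<le> length xs" "\<And>l. l < length xs \<Longrightarrow> j \<le> xs ! l \<longleftrightarrow> l < c"
  shows "conj_part xs j = c"
proof -
  have "{i. (i, j) \<in> cells xs} = {1..c}"
  proof (intro equalityI subsetI)
    fix i assume "i \<in> {i. (i, j) \<in> cells xs}"
    then have "i - 1 < length xs" "j \<le> xs ! (i - 1)" "1 \<le> i" by (auto simp: cells_def part_def)
    then show "i \<in> {1..c}" using assms(3)[of "i - 1"] by auto
  next
    fix i assume "i \<in> {1..c}"
    then show "i \<in> {i. (i, j) \<in> cells xs}" using assms(1,2) assms(3)[of "i - 1"]
      by (auto simp: cells_def part_def)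
  qed
  then show ?thesis by (simp add: conj_part_def)
qed

lemma hook_length_beta:
  assumes "i < length xs" "1 \<le> j" "c \<le> length xs" "\<And>l. l < length xs \<Longrightarrow> j \<le> xs ! l \<longleftrightarrow> l < c"
  shows "hook_length xs (Suc i, j) = int (beta xs ! i) - int (j + (length xs - c) - 1)"
  using assms conj_part_eq[OF assms(2-4)]
  by (simp add: hook_length_def part_def beta_nth of_nat_diff)

text \<open>The hook lengths in a row with first-column hook length \<open>b\<close> are the
differences \<open>b - v\<close> for the numbers \<open>v < b\<close> that are not first-column
hook lengths: the column that contains the hook determines how many of the first-column hook
lengths exceed \<open>v\<close>, and conversely.\<close>

lemma hook_iff_beta:
  "(\<exists>c\<in>cells xs. hook_length xs c = int s) \<longleftrightarrow>
     (\<exists>b\<in>set (beta xs). s \<le> b \<and> b - s \<notin> set (beta xs))"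
proof
  let ?k = "length xs"
  assume "\<exists>c\<in>cells xs. hook_length xs c = int s"
  then obtain i' j where ij: "(i', j) \<in> cells xs" "hook_length xs (i', j) = int s"
    unfolding Bex_def split_paired_Ex by blast
  define i where "i = i' - 1"
  have i: "i' = Suc i" "i < ?k" "1 \<le> j" "j \<le> xs ! i"
    using ij(1) by (auto simp: cells_def part_def i_def)
  obtain c where c: "c \<le> ?k" "\<And>l. l < ?k \<Longrightarrow> j \<le> xs ! l \<longleftrightarrow> l < c"
  proof (rule threshold[of ?k "\<lambda>l. j \<le> xs ! l"])
    show "j \<le> xs ! l" if "l \<le> l'" "l' < ?k" "j \<le> xs ! l'" for l l'
      using partition_antimono[OF that(1,2)] that(3) by simp
  qed blast
  \<comment> \<open>The \<open>j - 1\<close> missing numbers below \<open>v\<close> correspond to the columns left of \<open>j\<close>, the others to the \<open>?k - c\<close> rows below the hook.\<close>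
  define v where "v = j + (?k - c) - 1"
  have ic: "i < c" using c(2) i by auto
  have hook: "int s = int (beta xs ! i) - int v"
    using hook_length_beta[OF i(2,3) c] ij(2) i(1) by (simp add: v_def)
  then have "s \<le> beta xs ! i" "v = beta xs ! i - s" by linarith+
  moreover have "v \<noteq> beta xs ! l" if l: "l < ?k" for l
  proof (cases "l < c")
    case True
    then have "j \<le> xs ! l" using c(2)[OF l] by simp
    then have "v < xs ! l + (?k - Suc l)" using True c(1) i(3) l unfolding v_def by linarith
    then show ?thesis using l by (simp add: beta_nth)
  next
    case False
    then have "xs ! l < j" using c(2)[OF l] by simp
    then have "xs ! l + (?k - Suc l) < v" using False l unfolding v_def by linarith
    then show ?thesis using l by (simp add: beta_nth)
  qed
  then have "v \<notin> set (beta xs)" by (auto simp: in_set_conv_nth)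
  ultimately show "\<exists>b\<in>set (beta xs). s \<le> b \<and> b - s \<notin> set (beta xs)"
    using i by (metis length_beta nth_mem)
next
  let ?k = "length xs"
  assume "\<exists>b\<in>set (beta xs). s \<le> b \<and> b - s \<notin> set (beta xs)"
  then obtain i where i: "i < ?k" "s \<le> beta xs ! i" "beta xs ! i - s \<notin> set (beta xs)"
    by (metis in_set_conv_nth length_beta)
  define v where "v = beta xs ! i - s"
  have v: "v \<noteq> beta xs ! l" if "l < ?k" for l
    using i that by (metis length_beta nth_mem v_def)
  have mono: "beta xs ! l' + (l' - l) \<le> beta xs ! l" if "l \<le> l'" "l' < ?k" for l l'
    using partition_antimono[OF that] that by (simp add: beta_nth)
  have anti: "v < beta xs ! l" if "l \<le> l'" "l' < ?k" "v < beta xs ! l'" for l l'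
    using mono[OF that(1,2)] that(3) by linarith
  obtain c where c: "c \<le> ?k" "\<And>l. l < ?k \<Longrightarrow> v < beta xs ! l \<longleftrightarrow> l < c"
    by (rule threshold[of ?k "\<lambda>l. v < beta xs ! l"]) (use anti in blast)+
  have ic: "i < c" using c(2)[OF i(1)] v[OF i(1)] i(2) by (simp add: v_def)
  have kv: "?k - c \<le> v"
  proof (cases "c < ?k")
    case True
    then have "\<not> v < beta xs ! c" using c(2)[of c] by simp
    with True partition_pos[of c] show ?thesis by (simp add: beta_nth)
  qed simp
  define j where "j = v + 1 - (?k - c)"
  have j: "1 \<le> j" using kv by (simp add: j_def)
  have jc: "j \<le> xs ! l \<longleftrightarrow> l < c" if l: "l < ?k" for l
  proof (cases "l < c")
    case True
    have "v < beta xs ! (c - 1)" using c(2)[of "c - 1"] c(1) ic by simp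
    then have "v + (c - 1 - l) < beta xs ! l" using mono[of l "c - 1"] True c(1) by linarith
    then show ?thesis using True l c(1) kv by (simp add: j_def beta_nth)
  next
    case False
    then have "\<not> v < beta xs ! c" "c < ?k" using c(2)[of c] l by auto
    then have "beta xs ! c < v" using v[of c] by linarith
    then have "beta xs ! l + (l - c) < v" using mono[of c l] False l by linarith
    then show ?thesis using False l c(1) kv by (simp add: j_def beta_nth)
  qed
  have "hook_length xs (Suc i, j) = int (beta xs ! i) - int (j + (?k - c) - 1)"
    by (rule hook_length_beta[OF i(1) j c(1) jc])
  also have "j + (?k - c) - 1 = v" using kv by (simp add: j_def)
  finally have "hook_length xs (Suc i, j) = int s" using i(2) by (simp add: v_def)
  moreover have "(Suc i, j) \<in> cells xs" using i(1) j jc[OF i(1)] ic by (simp add: cells_def part_def)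
  ultimately show "\<exists>c\<in>cells xs. hook_length xs c = int s" by blast
qed

end

text \<open>If \<open>s\<close> itself were an element, closure would force \<open>0\<close> to be
one; so no separate clause excludes it.\<close>

definition beta_set :: "nat \<Rightarrow> nat \<Rightarrow> nat set \<Rightarrow> bool" where
  "beta_set s t S \<longleftrightarrow> finite S \<and> 0 \<notin> S \<and> (\<forall>x\<in>S. Suc x \<notin> S) \<and>
     (\<forall>x\<in>S. s \<le> x \<longrightarrow> x - s \<in> S) \<and> (\<forall>x\<in>S. t \<le> x \<longrightarrow> x - t \<in> S)"

fun unbeta :: "nat list \<Rightarrow> nat list" where
  "unbeta [] = []"
| "unbeta (b # bs) = (b - length bs) # unbeta bs"

lemma length_unbeta [simp]: "length (unbeta bs) = length bs"
  by (induction bs) auto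

lemma beta_inj: "beta xs = beta ys \<Longrightarrow> xs = ys"
proof (induction xs arbitrary: ys)
  case Nil
  then show ?case by (metis length_beta length_0_conv)
next
  case (Cons x xs)
  then obtain y ys' where ys: "ys = y # ys'" by (cases ys) auto
  with Cons.prems have *: "beta xs = beta ys'" "x + length xs = y + length ys'" by auto
  with Cons.IH[of ys'] show ?case by (simp add: ys)
qed

lemma unbeta:
  assumes "sorted_wrt (\<lambda>x y. y + 2 \<le> x) bs" "\<forall>b\<in>set bs. 0 < b"
  shows "beta (unbeta bs) = bs \<and> sorted_wrt (>) (unbeta bs) \<and> (\<forall>p\<in>set (unbeta bs). 0 < p) \<and>
    (bs \<noteq> [] \<longrightarrow> length bs \<le> hd bs \<and> hd (unbeta bs) = hd bs + 1 - length bs)"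
  using assms
proof (induction bs)
  case (Cons b bs)
  show ?case
  proof (cases bs)
    case Nil
    then show ?thesis using Cons.prems by simp
  next
    case bs: (Cons b' bs')
    have IH: "beta (unbeta bs) = bs" "sorted_wrt (>) (unbeta bs)" "\<forall>p\<in>set (unbeta bs). 0 < p"
      "length bs \<le> b'" "hd (unbeta bs) = b' + 1 - length bs"
      using Cons by (auto simp: bs)
    have b: "b' + 2 \<le> b" using Cons.prems by (simp add: bs)
    have "p \<le> hd (unbeta bs)" if "p \<in> set (unbeta bs)" for p
      using IH(2) that by (simp add: bs) fastforce
    then have "p < b - length bs" if "p \<in> set (unbeta bs)" for p
      using that IH(4,5) b by fastforce
    then show ?thesis using IH b by auto
  qed
qed simp

lemma sorted_strict_beta:
  "sorted_wrt (>) xs \<Longrightarrow> sorted_wrt (\<lambda>x y. y + 2 \<le> x) (beta xs)"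
proof (induction xs)
  case (Cons x xs)
  have "b + 2 \<le> x + length xs" if "b \<in> set (beta xs)" for b
  proof -
    obtain i where i: "i < length xs" "b = beta xs ! i" using \<open>b \<in> set (beta xs)\<close> by (metis in_set_conv_nth length_beta)
    then have "xs ! i < x" using Cons.prems by simp
    then show ?thesis using i by (simp add: beta_nth)
  qed
  then show ?case using Cons by auto
qed simp

lemma beta_pos: "\<forall>p\<in>set xs. 0 < p \<Longrightarrow> b \<in> set (beta xs) \<Longrightarrow> 0 < b"
  by (induction xs) auto

lemma sorted_gap_rev:
  "sorted_wrt (\<lambda>x y. y + 2 \<le> (x::nat)) bs \<Longrightarrow> sorted (rev bs) \<and> distinct bs"
  by (induction bs) (auto simp: sorted_append)

lemma sorted_gap_unique:
  assumes "sorted_wrt (\<lambda>x y. y + 2 \<le> x) bs" "sorted_wrt (\<lambda>x y. y + 2 \<le> (x::nat)) cs" "set bs = set cs"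
  shows "bs = cs"
proof -
  have "rev bs = rev cs"
    using assms sorted_gap_rev[OF assms(1)] sorted_gap_rev[OF assms(2)]
    by (intro sorted_distinct_set_unique) auto
  then show ?thesis by simp
qed

text \<open>Parts are distinct exactly when first-column hook lengths differ by at least
two.\<close>

lemma distinct_core_iff:
  "xs \<in> distinct_cores s t \<longleftrightarrow> sorted_wrt (>) xs \<and> (\<forall>p\<in>set xs. 0 < p) \<and> beta_set s t (set (beta xs))"
proof -
  have strict: "sorted_wrt (>) xs \<longleftrightarrow> sorted_wrt (\<ge>) xs \<and> distinct xs"
    by (induction xs) (auto simp: less_le)
  have gap: "0 \<notin> set (beta xs)" "\<forall>x\<in>set (beta xs). Suc x \<notin> set (beta xs)"
    if "sorted_wrt (>) xs" "\<forall>p\<in>set xs. 0 < p"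
  proof -
    show "0 \<notin> set (beta xs)" using beta_pos[OF that(2)] by blast
    have "\<forall>x\<in>set bs. Suc x \<notin> set bs" if "sorted_wrt (\<lambda>x y. y + 2 \<le> x) bs" for bs :: "nat list"
      using that
    proof (induction bs)
      case (Cons b bs)
      then have gap: "y + 2 \<le> b" if "y \<in> set bs" for y using that by auto
      have "Suc b \<notin> set bs" using gap[of "Suc b"] by auto
      moreover have "Suc y \<noteq> b" if "y \<in> set bs" for y using gap[OF that] by auto
      ultimately show ?case using Cons by auto
    qed simp
    then show "\<forall>x\<in>set (beta xs). Suc x \<notin> set (beta xs)" using sorted_strict_beta[OF that(1)] by blast
  qed
  show ?thesis
  proof (cases "is_partition xs")
    case True
    then have "xs \<in> distinct_cores s t \<longleftrightarrow> distinct xs \<and>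
        \<not> (\<exists>c\<in>cells xs. hook_length xs c = int s) \<and> \<not> (\<exists>c\<in>cells xs. hook_length xs c = int t)"
      by (auto simp: distinct_cores_def is_core_def)
    then show ?thesis
      unfolding hook_iff_beta[OF True] using True strict gap
      by (auto simp: beta_set_def is_partition_def)
  next
    case False
    then show ?thesis using strict by (auto simp: distinct_cores_def is_core_def is_partition_def)
  qed
qed

lemma bij_betw_beta: "bij_betw (\<lambda>xs. set (beta xs)) (distinct_cores s t) {S. beta_set s t S}"
  unfolding bij_betw_def
proof (intro conjI equalityI subsetI)
  show "inj_on (\<lambda>xs. set (beta xs)) (distinct_cores s t)"
  proof (rule inj_onI)
    fix xs ys assume "xs \<in> distinct_cores s t" "ys \<in> distinct_cores s t" "set (beta xs) = set (beta ys)"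
    then have "beta xs = beta ys"
      by (intro sorted_gap_unique sorted_strict_beta) (simp_all add: distinct_core_iff)
    then show "xs = ys" by (rule beta_inj)
  qed
  fix S assume "S \<in> (\<lambda>xs. set (beta xs)) ` distinct_cores s t"
  then show "S \<in> {S. beta_set s t S}" by (auto simp: distinct_core_iff)
next
  fix S assume "S \<in> {S. beta_set s t S}"
  then have S: "beta_set s t S" by simp
  then have fin: "finite S" by (simp add: beta_set_def)
  define bs where "bs = rev (sorted_list_of_set S)"
  have set: "set bs = S" using fin by (simp add: bs_def)
  have "sorted_wrt (\<lambda>x y. y < x) bs"
    by (simp add: bs_def sorted_wrt_rev)
  then have "sorted_wrt (\<lambda>x y. y + 2 \<le> x) bs"
  proof (rule sorted_wrt_mono_rel[rotated])
    fix x y assume "x \<in> set bs" "y \<in> set bs" "y < x"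
    moreover have "x \<noteq> Suc y" using S set \<open>x \<in> set bs\<close> \<open>y \<in> set bs\<close> by (auto simp: beta_set_def)
    ultimately show "y + 2 \<le> x" by simp
  qed
  moreover have "\<forall>b\<in>set bs. 0 < b" using S set by (auto simp: beta_set_def intro: gr0I)
  ultimately have "beta (unbeta bs) = bs" "sorted_wrt (>) (unbeta bs)" "\<forall>p\<in>set (unbeta bs). 0 < p"
    using unbeta by blast+
  then have "unbeta bs \<in> distinct_cores s t" "set (beta (unbeta bs)) = S"
    using S set by (simp_all add: distinct_core_iff)
  then show "S \<in> (\<lambda>xs. set (beta xs)) ` distinct_cores s t" by blast
qed

lemma sum_list_beta: "2 * sum_list (beta xs) = 2 * sum_list xs + length xs * (length xs - 1)"
proof (induction xs)
  case (Cons x xs)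
  then show ?case by (cases "length xs") (simp_all add: algebra_simps)
qed simp

lemma core_size:
  assumes "xs \<in> distinct_cores s t"
  shows "2 * \<Sum>(set (beta xs)) = 2 * sum_list xs + card (set (beta xs)) * (card (set (beta xs)) - 1)"
proof -
  have "sorted_wrt (\<lambda>x y. y + 2 \<le> x) (beta xs)"
    using assms distinct_core_iff sorted_strict_beta by blast
  then have "distinct (beta xs)" using sorted_gap_rev by blast
  then show ?thesis
    by (simp add: sum_list_distinct_conv_sum_set[symmetric] distinct_card sum_list_beta)
qed

section \<open>Beta-sets and closed walks\<close>

text \<open>The set with \<open>h r\<close> elements in residue class \<open>r\<close>, namely the
smallest ones; closure under subtracting \<open>2 n + 1\<close> is built in.\<close>

definition residue_set :: "nat \<Rightarrow> (nat \<Rightarrow> nat) \<Rightarrow> nat set" where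
  "residue_set n h = {x. x div (2 * n + 1) < h (x mod (2 * n + 1))}"

lemma residue_set_iff: "r \<le> 2 * n \<Longrightarrow> q * (2 * n + 1) + r \<in> residue_set n h \<longleftrightarrow> q < h r"
proof -
  assume r: "r \<le> 2 * n"
  then have "(r + q * (2 * n + 1)) div (2 * n + 1) = q" "(r + q * (2 * n + 1)) mod (2 * n + 1) = r"
    by (simp_all only: div_mult_self1 mod_mult_self1) simp_all
  then show ?thesis by (simp add: residue_set_def add.commute)
qed

lemma residue_set_eq: "residue_set n h = (\<lambda>(r, q). q * (2 * n + 1) + r) ` (SIGMA r:{..<2 * n + 1}. {..<h r})"
proof (intro equalityI subsetI)
  fix x assume "x \<in> residue_set n h"
  then have "(x mod (2 * n + 1), x div (2 * n + 1)) \<in> (SIGMA r:{..<2 * n + 1}. {..<h r})"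
    by (simp add: residue_set_def)
  moreover have "x = (\<lambda>(r, q). q * (2 * n + 1) + r) (x mod (2 * n + 1), x div (2 * n + 1))"
    by (simp only: prod.case div_mult_mod_eq)
  ultimately show "x \<in> (\<lambda>(r, q). q * (2 * n + 1) + r) ` (SIGMA r:{..<2 * n + 1}. {..<h r})"
    by blast
next
  fix x assume "x \<in> (\<lambda>(r, q). q * (2 * n + 1) + r) ` (SIGMA r:{..<2 * n + 1}. {..<h r})"
  then obtain q r where "x = q * (2 * n + 1) + r" "r \<le> 2 * n" "q < h r" by auto
  then show "x \<in> residue_set n h" by (simp only: residue_set_iff)
qed

lemma finite_residue_set: "finite (residue_set n h)"
  unfolding residue_set_eq by auto

lemma sum_residue_set: "(\<Sum>x\<in>residue_set n h. f x) = (\<Sum>r<2 * n + 1. \<Sum>q<h r. f (q * (2 * n + 1) + r))"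
proof -
  have inj: "inj_on (\<lambda>(r, q). q * (2 * n + 1) + r) (SIGMA r:{..<2 * n + 1}. {..<h r})"
  proof (rule inj_onI, clarify)
    fix r q r' q'
    assume *: "q * (2 * n + 1) + r = q' * (2 * n + 1) + r'" and r: "r < 2 * n + 1" "r' < 2 * n + 1"
    have "(r + q * (2 * n + 1)) div (2 * n + 1) = q" "(r + q * (2 * n + 1)) mod (2 * n + 1) = r"
      "(r' + q' * (2 * n + 1)) div (2 * n + 1) = q'" "(r' + q' * (2 * n + 1)) mod (2 * n + 1) = r'"
      using r by (simp_all only: div_mult_self1 mod_mult_self1) simp_all
    with * show "r = r' \<and> q = q'" by (metis add.commute)
  qed
  show ?thesis
    unfolding residue_set_eq sum.reindex[OF inj]
    by (subst sum.Sigma) (simp_all only: finite_lessThan case_prod_unfold o_def ball_simps simp_thms ball_triv)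
qed

text \<open>Subtracting \<open>2 n + 3\<close> leads from residue \<open>r\<close> to
\<open>r - 2\<close> one level down. From residue \<open>1\<close> it leads to residue
\<open>2 n\<close> two levels down, which accounts for the bound \<open>h (2 n) + 2\<close>.
Residue \<open>0\<close> is empty since \<open>0\<close> is not an element, so consecutive
elements can only occur within one level.\<close>

lemma beta_set_residue_set:
  assumes n: "1 \<le> n"
  shows "beta_set (2 * n + 1) (2 * n + 3) (residue_set n h) \<longleftrightarrow>
    h 0 = 0 \<and> (\<forall>r<2 * n. h r = 0 \<or> h (Suc r) = 0) \<and> h 1 \<le> h (2 * n) + 2 \<and>
    (\<forall>r. 2 \<le> r \<and> r \<le> 2 * n \<longrightarrow> h r \<le> h (r - 2) + 1)"
    (is "_ \<longleftrightarrow> ?zero \<and> ?gap \<and> ?one \<and> ?step")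
proof
  let ?s = "2 * n + 1"
  assume B: "beta_set (2 * n + 1) (2 * n + 3) (residue_set n h)"
  then have t': "x \<in> residue_set n h" if "x + (2 * n + 3) \<in> residue_set n h" for x
    using that unfolding beta_set_def by (metis add_diff_cancel_right' le_add2)
  have mem0: "r \<in> residue_set n h \<longleftrightarrow> 0 < h r" if "r \<le> 2 * n" for r
    using residue_set_iff[OF that, of 0 h] by simp
  have ?zero using B mem0[of 0] by (auto simp: beta_set_def)
  moreover have ?gap
  proof (intro allI impI)
    fix r assume "r < 2 * n"
    then show "h r = 0 \<or> h (Suc r) = 0" using B mem0[of r] mem0[of "Suc r"] by (auto simp: beta_set_def)
  qed
  moreover have ?one
  proof (rule ccontr)
    assume "\<not> ?one"
    define q where "q = h (2 * n)"
    have "(q + 2) * ?s + 1 \<in> residue_set n h"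
      using \<open>\<not> ?one\<close> n by (subst residue_set_iff) (auto simp: q_def)
    also have "(q + 2) * ?s + 1 = q * ?s + 2 * n + (2 * n + 3)" by (simp add: algebra_simps)
    finally have "q * ?s + 2 * n \<in> residue_set n h" by (rule t')
    then show False using residue_set_iff[of "2 * n" n q h] by (simp add: q_def)
  qed
  moreover have ?step
  proof (intro allI impI, rule ccontr)
    fix r assume r: "2 \<le> r \<and> r \<le> 2 * n" "\<not> h r \<le> h (r - 2) + 1"
    define q where "q = h (r - 2)"
    have "(q + 1) * ?s + r \<in> residue_set n h" using r by (subst residue_set_iff) (auto simp: q_def)
    also have "(q + 1) * ?s + r = q * ?s + (r - 2) + (2 * n + 3)" using r by (simp add: algebra_simps)
    finally have "q * ?s + (r - 2) \<in> residue_set n h" by (rule t')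
    moreover have "r - 2 \<le> 2 * n" using r by linarith
    ultimately show False unfolding residue_set_iff[OF \<open>r - 2 \<le> 2 * n\<close>] by (simp add: q_def)
  qed
  ultimately show "?zero \<and> ?gap \<and> ?one \<and> ?step" by blast
next
  let ?s = "2 * n + 1"
  assume all: "?zero \<and> ?gap \<and> ?one \<and> ?step"
  note zero = all[THEN conjunct1] and gap = all[THEN conjunct2, THEN conjunct1]
    and one = all[THEN conjunct2, THEN conjunct2, THEN conjunct1]
    and step = all[THEN conjunct2, THEN conjunct2, THEN conjunct2]
  have x: "\<exists>q r. x = q * ?s + r \<and> r \<le> 2 * n \<and> q < h r" if "x \<in> residue_set n h" for x
  proof (intro exI conjI)
    show "x = x div ?s * ?s + x mod ?s" by (simp only: div_mult_mod_eq)
    have "x mod ?s < ?s" by simp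
    then show "x mod ?s \<le> 2 * n" by linarith
    show "x div ?s < h (x mod ?s)" using that by (simp add: residue_set_def)
  qed
  have "0 \<notin> residue_set n h" using residue_set_iff[of 0 n 0 h] zero by simp
  moreover have "Suc x \<notin> residue_set n h" if mem: "x \<in> residue_set n h" for x
  proof
    assume suc: "Suc x \<in> residue_set n h"
    obtain q r where qr: "x = q * ?s + r" "r \<le> 2 * n" "q < h r" using x[OF mem] by blast
    show False
    proof (cases "r = 2 * n")
      case True
      then have "Suc x = (q + 1) * ?s + 0" using qr by simp
      then have "(q + 1) * ?s + 0 \<in> residue_set n h" using suc by simp
      then show False using residue_set_iff[of 0 n "q + 1" h] zero by simp
    next
      case False
      then have "Suc x = q * ?s + Suc r" "Suc r \<le> 2 * n" using qr by auto
      then have "q < h (Suc r)" using suc residue_set_iff[of "Suc r" n q h] by simp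
      moreover have "h r = 0 \<or> h (Suc r) = 0" using gap False qr(2) by simp
      ultimately show False using qr(3) by auto
    qed
  qed
  moreover have "x - ?s \<in> residue_set n h" if mem: "x \<in> residue_set n h" and ge: "?s \<le> x" for x
  proof -
    obtain q r where qr: "x = q * ?s + r" "r \<le> 2 * n" "q < h r" using x[OF mem] by blast
    then obtain q' where q: "q = Suc q'" using ge by (cases q) auto
    have eq: "x - ?s = q' * ?s + r" using qr by (simp add: q)
    have "q' < h r" using qr(3) by (simp add: q)
    then show ?thesis unfolding eq residue_set_iff[OF qr(2)] .
  qed
  moreover have "x - (2 * n + 3) \<in> residue_set n h" if mem: "x \<in> residue_set n h" and ge: "2 * n + 3 \<le> x" for x
  proof -
    obtain q r where qr: "x = q * ?s + r" "r \<le> 2 * n" "q < h r" using x[OF mem] by blast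
    then obtain q' where q: "q = Suc q'" using ge by (cases q) auto
    consider "r = 0" | "r = 1" | "2 \<le> r" by linarith
    then show ?thesis
    proof cases
      case 1 then show ?thesis using qr zero by simp
    next
      case 2
      then obtain q'' where q'': "q' = Suc q''" using ge qr q by (cases q') auto
      have eq: "x - (2 * n + 3) = q'' * ?s + 2 * n" using qr 2 by (simp add: q q'')
      have "q'' < h (2 * n)" using qr 2 one by (simp add: q q'')
      then show ?thesis unfolding eq by (simp only: residue_set_iff le_refl)
    next
      case 3
      have eq: "x - (2 * n + 3) = q' * ?s + (r - 2)" using qr 3 by (simp add: q)
      have "h r \<le> h (r - 2) + 1" using step 3 qr(2) by blast
      then have "q' < h (r - 2)" using qr(3) by (simp add: q)
      moreover have "r - 2 \<le> 2 * n" using qr(2) by linarith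
      ultimately show ?thesis unfolding eq by (simp only: residue_set_iff)
    qed
  qed
  ultimately show "beta_set (2 * n + 1) (2 * n + 3) (residue_set n h)"
    using finite_residue_set by (simp add: beta_set_def)
qed

lemma beta_set_is_residue_set:
  assumes "beta_set (2 * n + 1) t S"
  obtains h where "S = residue_set n h"
proof -
  let ?s = "2 * n + 1"
  have down: "q * ?s + r \<in> S" if "q \<le> q'" "q' * ?s + r \<in> S" for q q' r
    using that
  proof (induction rule: dec_induct)
    case (step m)
    have "\<forall>x\<in>S. ?s \<le> x \<longrightarrow> x - ?s \<in> S" using assms unfolding beta_set_def by blast
    moreover have "?s \<le> Suc m * ?s + r" by simp
    ultimately have "Suc m * ?s + r - ?s \<in> S" using step.prems by blast
    also have "Suc m * ?s + r - ?s = m * ?s + r" by simp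
    finally show ?case by (rule step.IH)
  qed
  have "\<exists>c. \<forall>q. q * ?s + r \<in> S \<longleftrightarrow> q < c" for r
  proof -
    have "finite S" using assms by (simp add: beta_set_def)
    then obtain N where N: "\<forall>x\<in>S. x < N" using finite_nat_set_iff_bounded by blast
    obtain c where c: "c \<le> N" "\<And>q. q < N \<Longrightarrow> q * ?s + r \<in> S \<longleftrightarrow> q < c"
      by (rule threshold[of N "\<lambda>q. q * ?s + r \<in> S"]) (use down in blast)+
    have "q * ?s + r \<in> S \<longleftrightarrow> q < c" for q
    proof (cases "q < N")
      case False
      have "N \<le> q * ?s + r" using False by (simp add: algebra_simps)
      then have "q * ?s + r \<notin> S" using N by force
      then show ?thesis using False c(1) by simp
    qed (use c in auto)
    then show ?thesis by blast
  qed
  then obtain h where h: "\<And>r q. q * ?s + r \<in> S \<longleftrightarrow> q < h r" by metis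
  have "S = residue_set n h"
  proof (intro set_eqI)
    fix x
    show "x \<in> S \<longleftrightarrow> x \<in> residue_set n h"
      using h[of "x div ?s" "x mod ?s"] by (simp add: residue_set_def del: mult_Suc_right)
  qed
  then show thesis by (rule that)
qed

definition height :: "int list \<Rightarrow> nat \<Rightarrow> nat" where
  "height xs r = (if r = 0 then 0 else if even r then nat (xs ! (r div 2 - 1)) else nat (- (xs ! (r div 2))))"

lemma height_simps [simp]:
  "height xs 0 = 0" "height xs (2 * j + 2) = nat (xs ! j)" "height xs (2 * j + 1) = nat (- (xs ! j))"
  "height xs (Suc (Suc (2 * j))) = nat (xs ! j)" "height xs (Suc (2 * j)) = nat (- (xs ! j))"
  by (simp_all add: height_def)

lemma chain_nth: "chain x xs \<longleftrightarrow> (\<forall>j<length xs. xs ! j \<in> succs ((x # xs) ! j))"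
  by (induction xs arbitrary: x) (simp_all add: All_less_Suc2)

lemma res_cases:
  fixes r n :: nat
  assumes "r \<le> 2 * n"
  obtains "r = 0" | j where "r = 2 * j + 2" "j < n" | j where "r = 2 * j + 1" "j < n"
proof -
  consider "r = 0" | "even r" "r \<noteq> 0" | "odd r" by blast
  then show thesis
  proof cases
    case 2
    then obtain k where "r = 2 * k" "k \<noteq> 0" by auto
    then show thesis using that(2)[of "k - 1"] assms by (cases k) auto
  next
    case 3
    then obtain k where "r = 2 * k + 1" by (auto elim: oddE)
    then show thesis using that(3)[of k] assms by auto
  qed (use that in auto)
qed

text \<open>Both sides are conditions on neighbouring entries: the gap condition is the sign rule
of \<open>succs\<close>, the steps from \<open>r - 2\<close> to \<open>r\<close> bound the growth
of positive and of negative entries, and the exceptional condition at residue \<open>1\<close> is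
the closing condition.\<close>

lemma closed_walk_iff:
  assumes n: "1 \<le> n" and len: "length xs = n"
  shows "xs \<in> closed_walks n \<longleftrightarrow> beta_set (2 * n + 1) (2 * n + 3) (residue_set n (height xs))"
proof -
  let ?x = "- (max (xs ! (n - 1)) 0 + 1)"
  define start where "start \<longleftrightarrow> xs ! 0 \<le> 1 \<and> - (xs ! 0) \<le> max (xs ! (n - 1)) 0 + 2"
  define steps where "steps \<longleftrightarrow> (\<forall>j. Suc j < n \<longrightarrow> xs ! Suc j \<le> max (xs ! j) 0 + 1 \<and>
     - (xs ! Suc j) \<le> max (- (xs ! j)) 0 + 1 \<and> (0 < xs ! j \<longrightarrow> 0 \<le> xs ! Suc j))"
  have last: "last (0 # xs) = xs ! (n - 1)" using len n by (auto simp: last_conv_nth)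
  have "xs \<in> closed_walks n \<longleftrightarrow> (\<forall>j<n. xs ! j \<in> succs ((?x # xs) ! j))"
    by (simp add: closed_walks_def len chain_nth last del: last.simps)
  also have "\<dots> \<longleftrightarrow> start \<and> steps"
  proof
    assume *: "\<forall>j<n. xs ! j \<in> succs ((?x # xs) ! j)"
    have start using *[rule_format, of 0] n by (simp add: start_def succs_def max_def split: if_splits)
    moreover have steps unfolding steps_def
    proof (intro allI impI)
      fix j assume "Suc j < n"
      with *[rule_format, of "Suc j"] show "xs ! Suc j \<le> max (xs ! j) 0 + 1 \<and>
        - (xs ! Suc j) \<le> max (- (xs ! j)) 0 + 1 \<and> (0 < xs ! j \<longrightarrow> 0 \<le> xs ! Suc j)"
        by (simp add: succs_def)
    qed
    ultimately show "start \<and> steps" ..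
  next
    assume *: "start \<and> steps"
    show "\<forall>j<n. xs ! j \<in> succs ((?x # xs) ! j)"
    proof (intro allI impI)
      fix j assume "j < n"
      then show "xs ! j \<in> succs ((?x # xs) ! j)"
        using * by (cases j) (auto simp: start_def steps_def succs_def)
    qed
  qed
  also have "\<dots> \<longleftrightarrow> (\<forall>r<2 * n. height xs r = 0 \<or> height xs (Suc r) = 0) \<and> height xs 1 \<le> height xs (2 * n) + 2 \<and>
    (\<forall>r. 2 \<le> r \<and> r \<le> 2 * n \<longrightarrow> height xs r \<le> height xs (r - 2) + 1)"
    (is "_ \<longleftrightarrow> ?gap \<and> ?one \<and> ?step")
  proof -
    have h1: "height xs 1 = nat (- (xs ! 0))" by (simp add: height_def)
    have h2: "height xs 2 = nat (xs ! 0)" by (simp add: height_def)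
    have h2n: "height xs (2 * n) = nat (xs ! (n - 1))" using n by (simp add: height_def)
    have he: "height xs (2 * j + 4) = nat (xs ! Suc j)" for j by (simp add: height_def)
    have ho: "height xs (2 * j + 3) = nat (- (xs ! Suc j))" for j using height_simps(3)[of xs "Suc j"] by (simp add: numeral_3_eq_3)
    show ?thesis
    proof
      assume *: "start \<and> steps"
      have ?gap
      proof (intro allI impI)
        fix r assume r: "r < 2 * n"
        then have "r \<le> 2 * n" by simp
        then show "height xs r = 0 \<or> height xs (Suc r) = 0"
        proof (cases rule: res_cases)
          case (2 j)
          then have "Suc j < n" using r by simp
          then show ?thesis using * 2 ho[of j] by (auto simp: steps_def numeral_3_eq_3)
        next
          case (3 j)
          then have "height xs r = nat (- (xs ! j))" "height xs (Suc r) = nat (xs ! j)" by simp_all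
          then show ?thesis by linarith
        qed auto
      qed
      moreover have ?one unfolding h1 h2n using * by (auto simp: start_def)
      moreover have ?step
      proof (intro allI impI)
        fix r assume r: "2 \<le> r \<and> r \<le> 2 * n"
        then have "r \<le> 2 * n" by simp
        then show "height xs r \<le> height xs (r - 2) + 1"
        proof (cases rule: res_cases)
          case (2 j)
          show ?thesis
          proof (cases j)
            case 0
            then have "height xs r = nat (xs ! 0)" using 2 by (simp add: height_def)
            then show ?thesis using * by (auto simp: start_def)
          next
            case (Suc i)
            then have "xs ! Suc i \<le> max (xs ! i) 0 + 1" using 2 * by (auto simp: steps_def)
            moreover have "height xs r = nat (xs ! Suc i)" "height xs (r - 2) = nat (xs ! i)"
              using 2 Suc by (simp_all add: height_def)
            ultimately show ?thesis by linarith
          qed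
        next
          case (3 j)
          then obtain i where i: "j = Suc i" using r by (cases j) auto
          then have "- (xs ! Suc i) \<le> max (- (xs ! i)) 0 + 1" using 3 * by (auto simp: steps_def)
          moreover have "height xs r = nat (- (xs ! Suc i))" "height xs (r - 2) = nat (- (xs ! i))"
            using 3 i by (simp_all add: height_def)
          ultimately show ?thesis by linarith
        qed (use r in auto)
      qed
      ultimately show "?gap \<and> ?one \<and> ?step" by blast
    next
      assume *: "?gap \<and> ?one \<and> ?step"
      note gap = *[THEN conjunct1] and one = *[THEN conjunct2, THEN conjunct1]
        and step = *[THEN conjunct2, THEN conjunct2]
      have "2 \<le> (2 :: nat) \<and> 2 \<le> 2 * n" using n by simp
      then have "height xs 2 \<le> height xs (2 - 2) + 1" by (rule step[rule_format])
      then have "xs ! 0 \<le> 1" by (simp add: h2)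
      moreover have "- (xs ! 0) \<le> max (xs ! (n - 1)) 0 + 2"
      proof -
        have "height xs 1 \<le> height xs (2 * n) + 2" by (rule one)
        then show ?thesis unfolding h1 h2n by linarith
      qed
      ultimately have start by (simp add: start_def)
      moreover have steps unfolding steps_def
      proof (intro allI impI)
        fix j assume j: "Suc j < n"
        have "2 * j + 2 < 2 * n" using j by simp
        then have "height xs (2 * j + 2) = 0 \<or> height xs (Suc (2 * j + 2)) = 0" by (rule gap[rule_format])
        moreover have "height xs (Suc (2 * j + 2)) = nat (- (xs ! Suc j))" by (simp add: height_def)
        ultimately have 1: "0 < xs ! j \<longrightarrow> 0 \<le> xs ! Suc j" by auto
        have b: "2 \<le> 2 * j + 4 \<and> 2 * j + 4 \<le> 2 * n" "2 \<le> 2 * j + 3 \<and> 2 * j + 3 \<le> 2 * n"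
          using j by simp_all
        note up = step[rule_format, OF b(1)] step[rule_format, OF b(2)]
        have lower: "height xs (2 * j + 4 - 2) = nat (xs ! j)" "height xs (2 * j + 3 - 2) = nat (- (xs ! j))"
          by (simp_all add: height_def)
        have 2: "xs ! Suc j \<le> max (xs ! j) 0 + 1"
          using up(1) unfolding lower he by linarith
        have 3: "- (xs ! Suc j) \<le> max (- (xs ! j)) 0 + 1"
          using up(2) unfolding lower ho by linarith
        show "xs ! Suc j \<le> max (xs ! j) 0 + 1 \<and>
          - (xs ! Suc j) \<le> max (- (xs ! j)) 0 + 1 \<and> (0 < xs ! j \<longrightarrow> 0 \<le> xs ! Suc j)"
          using 1 2 3 by blast
      qed
      ultimately show "start \<and> steps" ..
    qed
  qed
  finally show ?thesis unfolding beta_set_residue_set[OF n] by (simp only: height_simps(1) simp_thms)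
qed

lemma bij_betw_residue_set:
  assumes n: "1 \<le> n"
  shows "bij_betw (\<lambda>xs. residue_set n (height xs)) (closed_walks n) {S. beta_set (2 * n + 1) (2 * n + 3) S}"
  unfolding bij_betw_def
proof (intro conjI equalityI subsetI inj_onI)
  fix xs ys assume xs: "xs \<in> closed_walks n" and ys: "ys \<in> closed_walks n"
    and eq: "residue_set n (height xs) = residue_set n (height ys)"
  have len: "length xs = n" "length ys = n" using xs ys by (auto simp: closed_walks_def)
  have height: "height xs r = height ys r" if "r \<le> 2 * n" for r
  proof -
    have "q < height xs r \<longleftrightarrow> q < height ys r" for q
      using residue_set_iff[OF that, of q "height xs"] residue_set_iff[OF that, of q "height ys"] eq by simp
    then show ?thesis by (meson less_irrefl linorder_neqE_nat)
  qed
  show "xs = ys"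
  proof (rule nth_equalityI)
    fix j assume "j < length xs"
    then have "nat (xs ! j) = nat (ys ! j)" "nat (- (xs ! j)) = nat (- (ys ! j))"
      using height[of "2 * j + 2"] height[of "2 * j + 1"] len by simp_all
    then show "xs ! j = ys ! j" by linarith
  qed (simp add: len)
next
  fix S assume "S \<in> (\<lambda>xs. residue_set n (height xs)) ` closed_walks n"
  then show "S \<in> {S. beta_set (2 * n + 1) (2 * n + 3) S}"
    using closed_walk_iff[OF n] by (auto simp: closed_walks_def)
next
  fix S assume "S \<in> {S. beta_set (2 * n + 1) (2 * n + 3) S}"
  then have S: "beta_set (2 * n + 1) (2 * n + 3) S" by simp
  obtain h where h: "S = residue_set n h" using beta_set_is_residue_set[OF S] .
  have h0: "h 0 = 0" and gap: "\<forall>r<2 * n. h r = 0 \<or> h (Suc r) = 0"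
    using S beta_set_residue_set[OF n] by (auto simp: h)
  define xs where "xs = map (\<lambda>j. int (h (2 * j + 2)) - int (h (2 * j + 1))) [0..<n]"
  have len: "length xs = n" by (simp add: xs_def)
  have height: "height xs r = h r" if "r \<le> 2 * n" for r
    using that
  proof (cases rule: res_cases)
    case (2 j)
    moreover have "h (2 * j + 1) = 0 \<or> h (2 * j + 2) = 0" using gap[rule_format, of "2 * j + 1"] 2 by simp
    ultimately show ?thesis by (auto simp: xs_def)
  next
    case (3 j)
    moreover have "h (2 * j + 1) = 0 \<or> h (2 * j + 2) = 0" using gap[rule_format, of "2 * j + 1"] 3 by simp
    ultimately show ?thesis by (auto simp: xs_def)
  qed (use h0 in auto)
  have "residue_set n (height xs) = residue_set n h"
    unfolding residue_set_def by (intro Collect_cong) (simp add: height less_Suc_eq_le[symmetric])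
  moreover from this have "xs \<in> closed_walks n"
    using closed_walk_iff[OF n len] S h by simp
  ultimately show "S \<in> (\<lambda>xs. residue_set n (height xs)) ` closed_walks n" using h by blast
qed

lemma sum_residues:
  "(\<Sum>r<2 * n + 1. g r) = g 0 + (\<Sum>j<n. g (2 * j + 1) + g (2 * j + 2 :: nat))" for g :: "nat \<Rightarrow> nat"
  by (induction n) simp_all

lemma sum_residue_set_height:
  assumes "length xs = n"
  defines "S \<equiv> residue_set n (height xs)" and "R \<equiv> (\<Sum>r<2 * n + 1. r * height xs r)"
  shows "card S = height_sum xs"
    and "2 * \<Sum>S + (2 * n + 1) * height_sum xs = (2 * n + 1) * square_sum xs + 2 * R"
    and "R \<le> 2 * n * height_sum xs"
proof -
  have sum: "(\<Sum>r<2 * n + 1. height xs r) = height_sum xs"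
  proof -
    have "nat (- x) + nat x = nat \<bar>x\<bar>" for x :: int by auto
    then show ?thesis
      unfolding sum_residues using assms(1)
      by (simp add: height_sum_def sum_list_sum_nth atLeast0LessThan del: One_nat_def)
  qed
  have sq: "(\<Sum>r<2 * n + 1. (height xs r)\<^sup>2) = square_sum xs"
  proof -
    have "(nat (- x))\<^sup>2 + (nat x)\<^sup>2 = (nat \<bar>x\<bar>)\<^sup>2" for x :: int by (cases "0 \<le> x") auto
    then show ?thesis
      unfolding sum_residues using assms(1)
      by (simp add: square_sum_def sum_list_sum_nth atLeast0LessThan del: One_nat_def)
  qed
  show "card S = height_sum xs"
    using sum_residue_set[of "\<lambda>_. 1 :: nat" n "height xs"] sum by (simp add: S_def)
  have inner: "2 * (\<Sum>q<m. q * s + r) + s * m = s * m\<^sup>2 + 2 * (r * m)" for m s r :: nat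
    by (induction m) (simp_all add: algebra_simps power2_eq_square)
  have "2 * \<Sum>S + (2 * n + 1) * height_sum xs =
      (\<Sum>r<2 * n + 1. 2 * (\<Sum>q<height xs r. q * (2 * n + 1) + r) + (2 * n + 1) * height xs r)"
    unfolding S_def sum_residue_set sum[symmetric] sum.distrib[of "\<lambda>r. 2 * _ r"] sum_distrib_left[symmetric] ..
  also have "\<dots> = (2 * n + 1) * square_sum xs + 2 * R"
    unfolding inner sq[symmetric] R_def by (simp only: sum.distrib sum_distrib_left)
  finally show "2 * \<Sum>S + (2 * n + 1) * height_sum xs = (2 * n + 1) * square_sum xs + 2 * R" .
  show "R \<le> 2 * n * height_sum xs"
    unfolding R_def sum[symmetric] sum_distrib_left by (intro sum_mono mult_right_mono) auto
qed

definition main_size :: "nat \<Rightarrow> int list \<Rightarrow> real" where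
  "main_size n xs = real n * real (square_sum xs) - (real (height_sum xs))\<^sup>2 / 2"

text \<open>Summing the elements of each residue class expresses twice the size as
\<open>2 n B - A\<^sup>2 + B - 2 n A + 2 R\<close>, where \<open>R\<close> is the sum of the
residues weighted by the heights and satisfies \<open>0 \<le> R \<le> 2 n A\<close>.\<close>

lemma cores_walks:
  assumes n: "1 \<le> n"
  obtains \<psi> where "bij_betw \<psi> (closed_walks n) (distinct_cores (2 * n + 1) (2 * n + 3))"
    and "\<And>xs. xs \<in> closed_walks n \<Longrightarrow>
      \<bar>partition_size (\<psi> xs) - main_size n xs\<bar> \<le> real (square_sum xs) / 2 + 2 * real n * real (height_sum xs)"
proof -
  let ?D = "distinct_cores (2 * n + 1) (2 * n + 3)" and ?f = "\<lambda>xs. set (beta xs)"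
  let ?g = "\<lambda>xs. residue_set n (height xs)"
  have f: "bij_betw ?f ?D {S. beta_set (2 * n + 1) (2 * n + 3) S}" by (rule bij_betw_beta)
  have g: "bij_betw ?g (closed_walks n) {S. beta_set (2 * n + 1) (2 * n + 3) S}" by (rule bij_betw_residue_set[OF n])
  define \<psi> where "\<psi> = inv_into ?D ?f \<circ> ?g"
  have bij: "bij_betw \<psi> (closed_walks n) ?D"
    unfolding \<psi>_def by (rule bij_betw_trans[OF g bij_betw_inv_into[OF f]])
  moreover have "\<bar>partition_size (\<psi> xs) - main_size n xs\<bar> \<le> real (square_sum xs) / 2 + 2 * real n * real (height_sum xs)"
    if xs: "xs \<in> closed_walks n" for xs
  proof -
    have core: "\<psi> xs \<in> ?D" using bij xs by (auto simp: bij_betw_def)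
    have "?g xs \<in> {S. beta_set (2 * n + 1) (2 * n + 3) S}" using g xs by (auto simp: bij_betw_def)
    then have "?g xs \<in> ?f ` ?D" using f by (simp add: bij_betw_def)
    from f_inv_into_f[OF this] have "set (beta (\<psi> xs)) = ?g xs" by (simp add: \<psi>_def)
    then have size: "2 * \<Sum>(?g xs) = 2 * sum_list (\<psi> xs) + card (?g xs) * (card (?g xs) - 1)"
      using core_size[OF core] by simp
    have len: "length xs = n" using xs by (simp add: closed_walks_def)
    define A B R where "A = height_sum xs" and "B = square_sum xs" and "R = (\<Sum>r<2 * n + 1. r * height xs r)"
    have 1: "2 * \<Sum>(?g xs) = 2 * sum_list (\<psi> xs) + A * (A - 1)"
      using size sum_residue_set_height(1)[OF len] by (simp add: A_def)
    have 2: "2 * \<Sum>(?g xs) + (2 * n + 1) * A = (2 * n + 1) * B + 2 * R"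
      using sum_residue_set_height(2)[OF len] by (simp add: A_def B_def R_def)
    have 3: "R \<le> 2 * n * A" using sum_residue_set_height(3)[OF len] by (simp add: A_def R_def)
    have "2 * sum_list (\<psi> xs) + A * (A - 1) + (2 * n + 1) * A = (2 * n + 1) * B + 2 * R"
      using 1 2 by simp
    from arg_cong[OF this, of real]
    have "2 * real (sum_list (\<psi> xs)) + real A * (real A - 1) + (2 * real n + 1) * real A =
        (2 * real n + 1) * real B + 2 * real R"
      by (cases A) (simp_all add: algebra_simps)
    then have eq: "2 * (partition_size (\<psi> xs) - main_size n xs) = real B - 2 * real n * real A + 2 * real R"
      by (simp add: partition_size_def main_size_def A_def[symmetric] B_def[symmetric] algebra_simps power2_eq_square)
    have bound: "\<bar>d\<bar> \<le> b / 2 + 2 * t"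
      if "2 * d = b - 2 * t + 2 * r" "r \<le> 2 * t" "0 \<le> t" "0 \<le> b" "0 \<le> r" for b d r t :: real
      using that by linarith
    have "real R \<le> 2 * (real n * real A)" using of_nat_mono[OF 3, where 'a = real] by simp
    with eq have "\<bar>partition_size (\<psi> xs) - main_size n xs\<bar> \<le> real B / 2 + 2 * (real n * real A)"
      by (intro bound[of _ _ _ "real R"]) (simp_all only: mult.assoc of_nat_0_le_iff mult_nonneg_nonneg)
    then show ?thesis by (simp add: A_def B_def mult.assoc)
  qed
  ultimately show thesis by (rule that)
qed

section \<open>Moments of the size\<close>

lemma main_size_moment:
  "(\<lambda>n. (\<Sum>xs\<in>closed_walks n. main_size n xs ^ k) / (4 ^ n * real n ^ (3 * k))) \<longlonglongrightarrow> limit_moment k"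
proof -
  define c where "c l = real (k choose l) * (- 1 / 2) ^ l" for l
  have "(\<lambda>n. \<Sum>l\<le>k. c l * (walk_sum (2 * l) (k - l) n / 4 ^ n *
      real n powr (- (3 * real (2 * l) + 4 * real (k - l)) / 2))) \<longlonglongrightarrow>
    (\<Sum>l\<le>k. c l * (fact (2 * l) * fact (k - l) * closed_lead (2 * l) (k - l) *
      rGamma ((3 * real (2 * l) + 4 * real (k - l) + 2) / 2)))"
    by (intro tendsto_sum tendsto_mult tendsto_const walk_sum_asymptotic)
  also have "(\<Sum>l\<le>k. c l * (fact (2 * l) * fact (k - l) * closed_lead (2 * l) (k - l) *
      rGamma ((3 * real (2 * l) + 4 * real (k - l) + 2) / 2))) = limit_moment k"
    unfolding limit_moment_def
  proof (rule sum.cong[OF refl])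
    fix l assume "l \<in> {..k}"
    then have e: "(3 * real (2 * l) + 4 * real (k - l) + 2) / 2 = 1 + real (2 * k + l)"
      by (simp add: of_nat_diff field_simps)
    have "rGamma (1 + real (2 * k + l)) = 1 / fact (2 * k + l)"
      unfolding rGamma_inverse_Gamma Gamma_fact by (simp only: inverse_eq_divide)
    then show "c l * (fact (2 * l) * fact (k - l) * closed_lead (2 * l) (k - l) *
        rGamma ((3 * real (2 * l) + 4 * real (k - l) + 2) / 2)) =
      real (k choose l) * (- 1 / 2) ^ l *
        (fact (2 * l) * fact (k - l) * closed_lead (2 * l) (k - l) / fact (2 * k + l))"
      unfolding e c_def by simp
  qed
  finally have lim: "(\<lambda>n. \<Sum>l\<le>k. c l * (walk_sum (2 * l) (k - l) n / 4 ^ n *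
      real n powr (- (3 * real (2 * l) + 4 * real (k - l)) / 2))) \<longlonglongrightarrow> limit_moment k" .
  have "eventually (\<lambda>n. (\<Sum>l\<le>k. c l * (walk_sum (2 * l) (k - l) n / 4 ^ n *
      real n powr (- (3 * real (2 * l) + 4 * real (k - l)) / 2))) =
    (\<Sum>xs\<in>closed_walks n. main_size n xs ^ k) / (4 ^ n * real n ^ (3 * k))) sequentially"
    using eventually_gt_at_top[of 0]
  proof eventually_elim
    case (elim n)
    have "(\<Sum>xs\<in>closed_walks n. main_size n xs ^ k) = (\<Sum>xs\<in>closed_walks n. \<Sum>l\<le>k.
        c l * real n ^ (k - l) * (real (height_sum xs) ^ (2 * l) * real (square_sum xs) ^ (k - l)))"
    proof (rule sum.cong[OF refl])
      fix xs
      have "main_size n xs ^ k = (- (real (height_sum xs))\<^sup>2 / 2 + real n * real (square_sum xs)) ^ k"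
        by (simp add: main_size_def)
      also have "\<dots> = (\<Sum>l\<le>k. real (k choose l) * (- (real (height_sum xs))\<^sup>2 / 2) ^ l *
          (real n * real (square_sum xs)) ^ (k - l))"
        by (rule binomial_ring)
      also have "\<dots> = (\<Sum>l\<le>k. c l * real n ^ (k - l) *
          (real (height_sum xs) ^ (2 * l) * real (square_sum xs) ^ (k - l)))"
      proof (rule sum.cong[OF refl])
        fix l
        have "(- (real (height_sum xs))\<^sup>2 / 2) ^ l = (- 1 / 2) ^ l * real (height_sum xs) ^ (2 * l)"
          by (simp add: power_mult flip: power_mult_distrib)
        then show "real (k choose l) * (- (real (height_sum xs))\<^sup>2 / 2) ^ l *
            (real n * real (square_sum xs)) ^ (k - l) = c l * real n ^ (k - l) *
          (real (height_sum xs) ^ (2 * l) * real (square_sum xs) ^ (k - l))"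
          by (simp add: c_def power_mult_distrib)
      qed
      finally show "main_size n xs ^ k = (\<Sum>l\<le>k. c l * real n ^ (k - l) *
          (real (height_sum xs) ^ (2 * l) * real (square_sum xs) ^ (k - l)))" .
    qed
    also have "\<dots> = (\<Sum>l\<le>k. c l * real n ^ (k - l) * walk_sum (2 * l) (k - l) n)"
      unfolding walk_sum_def sum_distrib_left by (rule sum.swap)
    finally have sum: "(\<Sum>xs\<in>closed_walks n. main_size n xs ^ k) =
        (\<Sum>l\<le>k. c l * real n ^ (k - l) * walk_sum (2 * l) (k - l) n)" .
    have pow: "real n powr (- (3 * real (2 * l) + 4 * real (k - l)) / 2) = real n ^ (k - l) / real n ^ (3 * k)"
      if "l \<le> k" for l
    proof -
      have e: "- (3 * real (2 * l) + 4 * real (k - l)) / 2 = real (k - l) - real (3 * k)"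
        using that by (simp add: of_nat_diff field_simps)
      have "0 < real n" using elim by simp
      then show ?thesis unfolding e powr_diff by (simp only: powr_realpow)
    qed
    show ?case
      unfolding sum sum_divide_distrib by (intro sum.cong refl, subst pow; simp)
  qed
  with lim show ?thesis by (rule Lim_transform_eventually)
qed

lemma height_sum_le_square_sum: "height_sum xs \<le> square_sum xs"
  unfolding height_sum_def square_sum_def by (rule sum_list_mono) (simp add: power2_nat_le_imp_le power2_eq_square)

lemma height_sum_square_le: "(real (height_sum xs))\<^sup>2 \<le> real (length xs) * real (square_sum xs)"
proof -
  have "real (height_sum xs) = (\<Sum>i<length xs. real (nat \<bar>xs ! i\<bar>))"
    by (simp add: height_sum_def sum_list_sum_nth atLeast0LessThan)
  moreover have "real (square_sum xs) = (\<Sum>i<length xs. (real (nat \<bar>xs ! i\<bar>))\<^sup>2)"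
    by (simp add: square_sum_def sum_list_sum_nth atLeast0LessThan)
  ultimately show ?thesis
    using sum_squared_le_sum_of_squares[of "\<lambda>i. real (nat \<bar>xs ! i\<bar>)" "{..<length xs}"]
    by (simp add: mult.commute)
qed

lemma power_diff_bound:
  fixes x y c :: real
  assumes "\<bar>x\<bar> \<le> c" "\<bar>y\<bar> \<le> c"
  shows "\<bar>x ^ Suc k - y ^ Suc k\<bar> \<le> real (Suc k) * \<bar>x - y\<bar> * c ^ k"
proof (induction k)
  case (Suc k)
  have c: "0 \<le> c" using assms by simp
  have "x ^ Suc (Suc k) - y ^ Suc (Suc k) = x * (x ^ Suc k - y ^ Suc k) + (x - y) * y ^ Suc k"
    by (simp add: algebra_simps)
  then have "\<bar>x ^ Suc (Suc k) - y ^ Suc (Suc k)\<bar> \<le> \<bar>x\<bar> * \<bar>x ^ Suc k - y ^ Suc k\<bar> + \<bar>x - y\<bar> * \<bar>y\<bar> ^ Suc k"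
    by (metis abs_mult abs_triangle_ineq power_abs)
  also have "\<dots> \<le> c * (real (Suc k) * \<bar>x - y\<bar> * c ^ k) + \<bar>x - y\<bar> * c ^ Suc k"
    using assms c Suc by (intro add_mono mult_mono power_mono) auto
  also have "\<dots> = real (Suc (Suc k)) * \<bar>x - y\<bar> * c ^ Suc k" by (simp add: algebra_simps)
  finally show ?case .
qed simp

definition cores :: "nat \<Rightarrow> nat list set" where
  "cores n = distinct_cores (2 * n + 1) (2 * n + 3)"

text \<open>The right-hand side involves sums of smaller order than the \<open>k\<close>-th
moment: the first is smaller by the factor \<open>n\<close>, the second by the square root of
\<open>n\<close>. All quantities are bounded by a multiple of \<open>n B\<close> by the
Cauchy-Schwarz inequality \<open>A\<^sup>2 \<le> n B\<close>.\<close>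

lemma size_power_sum_diff:
  assumes n: "1 \<le> n"
  shows "\<bar>(\<Sum>xs\<in>cores n. partition_size xs ^ Suc k) - (\<Sum>xs\<in>closed_walks n. main_size n xs ^ Suc k)\<bar>
    \<le> real (Suc k) * 4 ^ k * real n ^ k * (walk_sum 0 (Suc k) n + 2 * real n * walk_sum 1 k n)"
proof -
  obtain \<psi> where bij: "bij_betw \<psi> (closed_walks n) (cores n)"
    and close: "\<And>xs. xs \<in> closed_walks n \<Longrightarrow>
      \<bar>partition_size (\<psi> xs) - main_size n xs\<bar> \<le> real (square_sum xs) / 2 + 2 * real n * real (height_sum xs)"
    using cores_walks[OF n] unfolding cores_def by blast
  have bound: "\<bar>partition_size (\<psi> xs) ^ Suc k - main_size n xs ^ Suc k\<bar> \<le> real (Suc k) * 4 ^ k * real n ^ k *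
      (real (square_sum xs) ^ Suc k + 2 * real n * (real (height_sum xs) * real (square_sum xs) ^ k))"
    if xs: "xs \<in> closed_walks n" for xs
  proof -
    define A B where "A = real (height_sum xs)" and "B = real (square_sum xs)"
    have AB: "0 \<le> A" "0 \<le> B" "A \<le> B" using height_sum_le_square_sum by (auto simp: A_def B_def)
    have nA: "real n * A \<le> real n * B" and nB: "B \<le> real n * B"
      using AB n by (auto intro: mult_left_mono simp: mult_le_cancel_right1)
    have sq: "A\<^sup>2 \<le> real n * B"
      using height_sum_square_le[of xs] xs by (simp add: A_def B_def closed_walks_def)
    have Y: "main_size n xs = real n * B - A\<^sup>2 / 2" by (simp add: main_size_def A_def B_def)
    have d: "\<bar>partition_size (\<psi> xs) - main_size n xs\<bar> \<le> B / 2 + 2 * real n * A"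
      using close[OF xs] by (simp add: A_def B_def)
    have "\<bar>main_size n xs\<bar> \<le> real n * B" using sq zero_le_power2[of A] unfolding Y by linarith
    moreover from this d nA nB AB have "\<bar>partition_size (\<psi> xs)\<bar> \<le> 4 * (real n * B)" by (simp add: mult.assoc)
    ultimately have "\<bar>partition_size (\<psi> xs) ^ Suc k - main_size n xs ^ Suc k\<bar> \<le>
        real (Suc k) * \<bar>partition_size (\<psi> xs) - main_size n xs\<bar> * (4 * (real n * B)) ^ k"
      by (intro power_diff_bound) auto
    also have "\<dots> \<le> real (Suc k) * (B + 2 * real n * A) * (4 * (real n * B)) ^ k"
      using d AB by (intro mult_right_mono mult_left_mono) auto
    also have "\<dots> = real (Suc k) * 4 ^ k * real n ^ k * (B ^ Suc k + 2 * real n * (A * B ^ k))"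
      by (simp add: power_mult_distrib algebra_simps)
    finally show ?thesis by (simp add: A_def B_def)
  qed
  have "(\<Sum>xs\<in>cores n. partition_size xs ^ Suc k) = (\<Sum>xs\<in>closed_walks n. partition_size (\<psi> xs) ^ Suc k)"
    by (rule sum.reindex_bij_betw[OF bij, symmetric])
  then have "\<bar>(\<Sum>xs\<in>cores n. partition_size xs ^ Suc k) - (\<Sum>xs\<in>closed_walks n. main_size n xs ^ Suc k)\<bar> =
      \<bar>\<Sum>xs\<in>closed_walks n. partition_size (\<psi> xs) ^ Suc k - main_size n xs ^ Suc k\<bar>"
    by (simp add: sum_subtractf)
  also have "\<dots> \<le> (\<Sum>xs\<in>closed_walks n. real (Suc k) * 4 ^ k * real n ^ k *
      (real (square_sum xs) ^ Suc k + 2 * real n * (real (height_sum xs) * real (square_sum xs) ^ k)))"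
    by (rule order_trans[OF sum_abs sum_mono]) (rule bound)
  also have "\<dots> = real (Suc k) * 4 ^ k * real n ^ k * (walk_sum 0 (Suc k) n + 2 * real n * walk_sum 1 k n)"
    by (simp add: walk_sum_def sum.distrib flip: sum_distrib_left)
  finally show ?thesis .
qed

text \<open>Here \<open>4\<^sup>n\<close> stands for the number of cores; the case
\<open>k = 0\<close> of \<open>size_moment_limit\<close> justifies this asymptotically.\<close>

definition size_moment :: "nat \<Rightarrow> nat \<Rightarrow> real" where
  "size_moment k n = (\<Sum>xs\<in>cores n. partition_size xs ^ k) / (4 ^ n * real n ^ (3 * k))"

lemma card_cores:
  assumes "1 \<le> n"
  shows "card (cores n) = card (closed_walks n)" "finite (cores n)"
proof -
  obtain \<psi> where bij: "bij_betw \<psi> (closed_walks n) (cores n)"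
    using cores_walks[OF assms] unfolding cores_def by blast
  then show "card (cores n) = card (closed_walks n)" by (metis bij_betw_same_card)
  show "finite (cores n)" using bij finite_closed_walks bij_betw_finite by blast
qed

lemma size_moment_limit: "size_moment k \<longlonglongrightarrow> limit_moment k"
proof (cases k)
  case 0
  have "eventually (\<lambda>n. (\<Sum>xs\<in>closed_walks n. main_size n xs ^ 0) / (4 ^ n * real n ^ (3 * 0)) = size_moment 0 n) sequentially"
    using eventually_ge_at_top[of 1]
    by eventually_elim (simp add: size_moment_def card_cores)
  with main_size_moment[of 0] show ?thesis unfolding 0 by (rule Lim_transform_eventually)
next
  case (Suc k')
  define D where "D n = size_moment k n - (\<Sum>xs\<in>closed_walks n. main_size n xs ^ k) / (4 ^ n * real n ^ (3 * k))" for n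
  define b where "b n = real k * 4 ^ k' *
      (walk_sum 0 k n / 4 ^ n * real n powr (- (3 * real 0 + 4 * real k) / 2) * real n powr (- 1) +
       2 * (walk_sum 1 k' n / 4 ^ n * real n powr (- (3 * real 1 + 4 * real k') / 2) * real n powr (- (1/2))))" for n
  have "(\<lambda>n. real n powr (- 1)) \<longlonglongrightarrow> 0" "(\<lambda>n. real n powr (- (1/2))) \<longlonglongrightarrow> 0"
    by (rule tendsto_neg_powr; simp add: filterlim_real_sequentially)+
  then have "b \<longlonglongrightarrow> real k * 4 ^ k' *
      (fact 0 * fact k * closed_lead 0 k * rGamma ((3 * real 0 + 4 * real k + 2) / 2) * 0 +
       2 * (fact 1 * fact k' * closed_lead 1 k' * rGamma ((3 * real 1 + 4 * real k' + 2) / 2) * 0))"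
    unfolding b_def by (intro tendsto_mult tendsto_add tendsto_const walk_sum_asymptotic)
  then have b: "b \<longlonglongrightarrow> 0" by simp
  have "eventually (\<lambda>n. norm (D n) \<le> b n) sequentially"
    using eventually_ge_at_top[of 1]
  proof eventually_elim
    case (elim n)
    have n: "0 < real n" using elim by simp
    have "norm (D n) = \<bar>(\<Sum>xs\<in>cores n. partition_size xs ^ k) - (\<Sum>xs\<in>closed_walks n. main_size n xs ^ k)\<bar>
        / (4 ^ n * real n ^ (3 * k))"
      by (simp add: D_def size_moment_def abs_divide flip: diff_divide_distrib)
    also have "\<dots> \<le> real k * 4 ^ k' * real n ^ k' * (walk_sum 0 k n + 2 * real n * walk_sum 1 k' n) / (4 ^ n * real n ^ (3 * k))"
      using size_power_sum_diff[OF elim, of k'] by (intro divide_right_mono) (simp_all add: Suc)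
    also have "\<dots> = b n"
    proof -
      have 1: "real n powr (- (3 * real 0 + 4 * real k) / 2) * real n powr (- 1) = real n ^ k' / real n ^ (3 * k)"
      proof -
        have e: "- (3 * real 0 + 4 * real k) / 2 + - 1 = real k' - real (3 * k)" by (simp add: Suc field_simps)
        show ?thesis unfolding powr_add[symmetric] e powr_diff using n by (simp only: powr_realpow)
      qed
      have 2: "real n powr (- (3 * real 1 + 4 * real k') / 2) * real n powr (- (1/2)) = real n ^ Suc k' / real n ^ (3 * k)"
      proof -
        have e: "- (3 * real 1 + 4 * real k') / 2 + - (1/2) = real (Suc k') - real (3 * k)" by (simp add: Suc field_simps)
        show ?thesis unfolding powr_add[symmetric] e powr_diff using n by (simp only: powr_realpow)
      qed
      show ?thesis
        unfolding b_def mult.assoc[of "_ / _"] 1 2 by (simp add: algebra_simps add_divide_distrib)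
    qed
    finally show ?case .
  qed
  then have "D \<longlonglongrightarrow> 0" by (rule Lim_null_comparison[OF _ b])
  from tendsto_add[OF this main_size_moment[of k]] show ?thesis by (simp add: D_def)
qed

lemma Nil_in_cores: "[] \<in> cores n"
  by (simp add: cores_def distinct_cores_def is_core_def is_partition_def cells_def)

lemma expectation_core:
  assumes "1 \<le> n"
  shows "measure_pmf.expectation (core_pmf n) f = (\<Sum>xs\<in>cores n. f xs) / real (card (cores n))"
  unfolding core_pmf_def cores_def[symmetric]
  using card_cores(2)[OF assms] Nil_in_cores[of n] by (intro integral_pmf_of_set) auto

definition central_moment :: "nat \<Rightarrow> nat \<Rightarrow> real" where
  "central_moment k n = measure_pmf.expectation (core_pmf n)
     (\<lambda>xs. (partition_size xs - measure_pmf.expectation (core_pmf n) partition_size) ^ k)"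

lemma raw_moment_limit:
  "(\<lambda>n. measure_pmf.expectation (core_pmf n) (\<lambda>xs. partition_size xs ^ k) / real n ^ (3 * k)) \<longlonglongrightarrow> limit_moment k"
proof -
  have "limit_moment 0 = 1" by (simp add: limit_moment_def closed_lead_0)
  then have "(\<lambda>n. size_moment k n / size_moment 0 n) \<longlonglongrightarrow> limit_moment k"
    using tendsto_divide[OF size_moment_limit[of k] size_moment_limit[of 0]] by simp
  moreover have "eventually (\<lambda>n. size_moment k n / size_moment 0 n =
      measure_pmf.expectation (core_pmf n) (\<lambda>xs. partition_size xs ^ k) / real n ^ (3 * k)) sequentially"
    using eventually_ge_at_top[of 1]
    by eventually_elim (simp add: size_moment_def expectation_core)
  ultimately show ?thesis by (rule Lim_transform_eventually)
qed

lemma central_moment_limit: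
  "(\<lambda>n. central_moment k n / real n ^ (3 * k)) \<longlonglongrightarrow>
    (\<Sum>r\<le>k. real (k choose r) * limit_moment r * (- limit_moment 1) ^ (k - r))"
proof -
  define E where "E r n = measure_pmf.expectation (core_pmf n) (\<lambda>xs. partition_size xs ^ r)" for r n
  have "(\<lambda>n. \<Sum>r\<le>k. real (k choose r) * (E r n / real n ^ (3 * r)) * (- (E 1 n / real n ^ (3 * 1))) ^ (k - r)) \<longlonglongrightarrow>
    (\<Sum>r\<le>k. real (k choose r) * limit_moment r * (- limit_moment 1) ^ (k - r))"
    unfolding E_def by (intro tendsto_sum tendsto_mult tendsto_const tendsto_power tendsto_minus raw_moment_limit)
  moreover have "eventually (\<lambda>n. (\<Sum>r\<le>k. real (k choose r) * (E r n / real n ^ (3 * r)) * (- (E 1 n / real n ^ (3 * 1))) ^ (k - r)) =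
      central_moment k n / real n ^ (3 * k)) sequentially"
    using eventually_ge_at_top[of 1]
  proof eventually_elim
    case (elim n)
    let ?N = "real (card (cores n))" and ?\<mu> = "E 1 n"
    \<comment> \<open>The mean \<open>?\<mu>\<close> is a constant here and is kept folded, as it is itself a sum over cores.\<close>
    have pull: "(\<Sum>xs\<in>cores n. c * partition_size xs ^ r * d / ?N) = c * E r n * d" for c d r
      by (simp add: E_def expectation_core[OF elim] sum_distrib_left sum_distrib_right sum_divide_distrib)
    have "central_moment k n = (\<Sum>xs\<in>cores n. (partition_size xs + - ?\<mu>) ^ k) / ?N"
      by (simp add: central_moment_def E_def expectation_core[OF elim])
    also have "(\<Sum>xs\<in>cores n. (partition_size xs + - ?\<mu>) ^ k) =
        (\<Sum>xs\<in>cores n. \<Sum>r\<le>k. real (k choose r) * partition_size xs ^ r * (- ?\<mu>) ^ (k - r))"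
      by (simp only: binomial_ring)
    also have "\<dots> = (\<Sum>r\<le>k. \<Sum>xs\<in>cores n. real (k choose r) * partition_size xs ^ r * (- ?\<mu>) ^ (k - r))"
      by (rule sum.swap)
    also have "\<dots> / ?N = (\<Sum>r\<le>k. real (k choose r) * E r n * (- ?\<mu>) ^ (k - r))"
      unfolding sum_divide_distrib
      by (intro sum.cong refl) (simp only: pull)
    finally have "central_moment k n / real n ^ (3 * k) =
        (\<Sum>r\<le>k. real (k choose r) * E r n * (- ?\<mu>) ^ (k - r) / real n ^ (3 * k))"
      by (simp add: sum_divide_distrib)
    also have "\<dots> = (\<Sum>r\<le>k. real (k choose r) * (E r n / real n ^ (3 * r)) * (- (?\<mu> / real n ^ (3 * 1))) ^ (k - r))"
    proof (rule sum.cong[OF refl])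
      fix r assume "r \<in> {..k}"
      then have "3 * k = 3 * r + 3 * 1 * (k - r)" by simp
      then have "real n ^ (3 * k) = real n ^ (3 * r) * (real n ^ (3 * 1)) ^ (k - r)"
        by (simp only: power_add power_mult)
      then show "real (k choose r) * E r n * (- ?\<mu>) ^ (k - r) / real n ^ (3 * k) =
          real (k choose r) * (E r n / real n ^ (3 * r)) * (- (?\<mu> / real n ^ (3 * 1))) ^ (k - r)"
        by (simp only: minus_divide_left power_divide) simp
    qed
    finally show ?case ..
  qed
  ultimately show ?thesis by (rule Lim_transform_eventually)
qed

theorem mainTheorem13:
  shows "(\<lambda>n. measure_pmf.expectation (core_pmf n)
              (\<lambda>xs. (partition_size xs - measure_pmf.expectation (core_pmf n) partition_size) ^ 6)
            / (measure_pmf.variance (core_pmf n) partition_size) ^ 3)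
         \<longlonglongrightarrow> 382564191044644975 / 1552893421695616"
proof -
  have c2: "(\<lambda>n. central_moment 2 n / real n ^ (3 * 2)) \<longlonglongrightarrow> 467 / 7680"
    using central_moment_limit[of 2]
    by (simp add: sum_atMost_numeral limit_moments choose_table power_divide)
  have c6: "(\<lambda>n. central_moment 6 n / real n ^ (3 * 6)) \<longlonglongrightarrow> 382564191044644975 / 1552893421695616 * (467 / 7680) ^ 3"
    using central_moment_limit[of 6]
    by (simp add: sum_atMost_numeral limit_moments choose_table power_divide)
  have lim: "(\<lambda>n. (central_moment 6 n / real n ^ (3 * 6)) / (central_moment 2 n / real n ^ (3 * 2)) ^ 3) \<longlonglongrightarrow>
      (382564191044644975 / 1552893421695616 * (467 / 7680) ^ 3) / (467 / 7680) ^ 3"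
    by (intro tendsto_divide tendsto_power c2 c6) simp
  have "eventually (\<lambda>n. (central_moment 6 n / real n ^ (3 * 6)) / (central_moment 2 n / real n ^ (3 * 2)) ^ 3 =
      central_moment 6 n / central_moment 2 n ^ 3) sequentially"
    using eventually_gt_at_top[of 0]
    by eventually_elim (simp add: power_divide flip: power_mult)
  from Lim_transform_eventually[OF lim this]
  have "(\<lambda>n. central_moment 6 n / central_moment 2 n ^ 3) \<longlonglongrightarrow> 382564191044644975 / 1552893421695616"
    by simp
  then show ?thesis by (simp add: central_moment_def)
qed

end
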